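(* In the homoskedastic regression setting of the context, suppose Assumptions 1 and 3 and the sieve Assumptions 4–7 stated there hold, and that $\hat V$ is an estimator of $V$ such that $\mathbb P(|\hat V-V|\le n^{-\gamma})\ge1-o(n^{-\frac{2S}{2S+1}})$ holds for some universal $\gamma>0$. Let $K\asymp n^{\frac1{2S+1}}$. Then for every fixed $\alpha\in(0,1)$ and every user-defined sequence $d_n$ such that $d_n/\sqrt{\log n}\to\infty$, $$\inf_{m\in\mathcal F_S}\mathbb P\Big(m(0)\in\Big[\hat m_K(0)\pm d_n\Big(\frac{2\log(\frac2\alpha)\hat V\hat C_W}{n}\Big)^{\frac S{2S+1}}\Big]\Big)\ge1-\alpha-\mathrm{CE}_n,$$ where $\mathrm{CE}_n=o(n^{-\frac{2S}{2S+1}})$, $\hat C_W=\frac nK\sum_{i=1}^nW_{iK}^2(0)$, and $\mathcal F_S$ is the function class of Assumption 7.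
   Context: Let $S\ge1$ be fixed and $Y_i=m(X_i)+V^{1/2}\varepsilon_i$, $i=1,\dots,n$, with constant $V>0$, $\mathbb E[\varepsilon_i|X_i]=0$, $\mathbb E[\varepsilon_i^2|X_i]=1$. $[x\pm y]$ denotes $[x-y,x+y]$. Assumption 1: the pairs $(X_i,Y_i)$, $i=1,\dots,n$, are mutually independent; the $X_i$ are independent copies of a random variable $X$ with values in $[a,b]$ and a Lipschitz continuous density $f_X$ with $\inf_{x\in[a,b]}f_X(x)>0$; without loss of generality $[a,b]=[-1,1]$ or $[0,1]$, corresponding to the point of interest $0$ being an interior or a boundary point. Assumption 3: there exists a constant $\varsigma>4+\frac1S$ such that $\max_{1\le i\le n}\mathbb E[|\varepsilon_i|^\varsigma|X_i]\le E_\varsigma<\infty$ almost surely, where $E_\varsigma>0$ does not depend on $n$. Sieve estimator: for each $K$, $\{b_{K1},\dots,b_{KK}\}$ is a sieve basis of dimension $K$, $b_K(x)=(b_{K1}(x),\dots,b_{KK}(x))^\top$, $\widehat Q_K=\frac1n\sum_{i=1}^nb_K(X_i)b_K^\top(X_i)$, $W_{iK}(0)=\frac1nb_K^\top(0)\widehat Q_K^{-1}b_K(X_i)$, $\hat m_K(0)=\sum_{i=1}^nW_{iK}(0)Y_i$. Assumption 4 (basis regularity): there are constants $C_0,C_\infty,C_1,C_2<\infty$ independent of $n$ and $K$ with $\sup_{x\in[-1,1]}\#\{k:b_{Kk}(x)\ne0\}\le C_0$, $\max_{1\le k\le K}\|b_{Kk}\|_\infty\le C_\infty K^{1/2}$,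 $\max_{1\le k\le K}\mathbb E|b_{Kk}(X)|\le C_1K^{-1/2}$, $\max_{1\le k\le K}\mathbb E[b_{Kk}^2(X)]\le C_2$, where $\#A$ is the cardinality of $A$. Assumption 5 (non-overlap): there is a fixed integer $M_0<\infty$, independent of $n$ and $K$, with $b_{Kk}(x)b_{K\ell}(x)\equiv0$ whenever $|k-\ell|>M_0$. (Consequently the $(k,\ell)$ entries of $Q_K:=\mathbb E[b_K(X)b_K^\top(X)]$ and $\widehat Q_K$ vanish once $|k-\ell|>M_0$.) Assumption 6 (eigenvalues of the Gram matrix): there are constants $0<q_-<q_+<\infty$ independent of $K$ with $q_-\le\lambda_{\min}(Q_K)\le\lambda_{\max}(Q_K)\le q_+$, where $\lambda_{\min},\lambda_{\max}$ denote the smallest and largest eigenvalue. Assumption 7 (sieve approximation): $\mathcal F_S$ is a fixed collection of functions such that $m\in\mathcal F_S$, and with $\mathcal B_K=\mathrm{span}\{b_{K1},\dots,b_{KK}\}$, $\sup_{f\in\mathcal F_S}\inf_{g\in\mathcal B_K}\|g-f\|_\infty\le C_SK^{-S}$ for all $K\ge1$, for some constant $C_S>0$ independent of $K$.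
   Formalization: The function class F_S is additionally assumed to contain some f with f(0) ≠ 0; without this the basis may degenerate at the point 0 under Assumptions 4–7, and the coverage claim can fail. *)

theory Defs
  imports
    "HOL-Probability.Probability"
    "HOL-Library.Landau_Symbols"
    "Jordan_Normal_Form.Gauss_Jordan_Elimination"
    "Jordan_Normal_Form.Char_Poly"
begin

definition pm_interval :: "real \<Rightarrow> real \<Rightarrow> real set" where
  "pm_interval x y = {x - y .. x + y}"

text \<open>Supremum norm over a set, with values in the extended reals so that it is \<open>\<infinity>\<close> for
  unbounded functions. All functions of the covariate are only looked at on the design
  interval.\<close>

definition sup_norm_on :: "real set \<Rightarrow> (real \<Rightarrow> real) \<Rightarrow> ennreal" where
  "sup_norm_on A f = (SUP x\<in>A. ennreal \<bar>f x\<bar>)"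

text \<open>Conditional expectation of \<open>Z\<close> given the sigma-algebra generated by \<open>X\<close>.
  It is only meaningful for integrable \<open>Z\<close>, so every use comes with an integrability condition.\<close>

definition cond_exp_given :: "'a measure \<Rightarrow> ('a \<Rightarrow> real) \<Rightarrow> ('a \<Rightarrow> real) \<Rightarrow> 'a \<Rightarrow> real" where
  "cond_exp_given M X Z = real_cond_exp M (vimage_algebra (space M) X borel) Z"

definition homoskedastic_errors ::
    "'a measure \<Rightarrow> nat \<Rightarrow> (nat \<Rightarrow> 'a \<Rightarrow> real) \<Rightarrow> (nat \<Rightarrow> 'a \<Rightarrow> real) \<Rightarrow> bool" where
  "homoskedastic_errors M n X \<epsilon> \<longleftrightarrow>
     (\<forall>i\<in>{1..n}. \<epsilon> i \<in> borel_measurable M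
        \<and> integrable M (\<epsilon> i) \<and> (AE \<omega> in M. cond_exp_given M (X i) (\<epsilon> i) \<omega> = 0)
        \<and> integrable M (\<lambda>\<omega>. (\<epsilon> i \<omega>)\<^sup>2)
        \<and> (AE \<omega> in M. cond_exp_given M (X i) (\<lambda>\<omega>. (\<epsilon> i \<omega>)\<^sup>2) \<omega> = 1))"

definition cond_moment_bound ::
    "'a measure \<Rightarrow> nat \<Rightarrow> (nat \<Rightarrow> 'a \<Rightarrow> real) \<Rightarrow> (nat \<Rightarrow> 'a \<Rightarrow> real) \<Rightarrow> real \<Rightarrow> real \<Rightarrow> bool" where
  "cond_moment_bound M n X \<epsilon> \<sigma> E \<longleftrightarrow>
     (\<forall>i\<in>{1..n}. integrable M (\<lambda>\<omega>. \<bar>\<epsilon> i \<omega>\<bar> powr \<sigma>)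
        \<and> (AE \<omega> in M. cond_exp_given M (X i) (\<lambda>\<omega>. \<bar>\<epsilon> i \<omega>\<bar> powr \<sigma>) \<omega> \<le> E))"

definition response ::
    "(real \<Rightarrow> real) \<Rightarrow> real \<Rightarrow> (nat \<Rightarrow> 'a \<Rightarrow> real) \<Rightarrow> (nat \<Rightarrow> 'a \<Rightarrow> real) \<Rightarrow> nat \<Rightarrow> 'a \<Rightarrow> real" where
  "response m V X \<epsilon> i \<omega> = m (X i \<omega>) + sqrt V * \<epsilon> i \<omega>"

text \<open>\<open>E[h(X)]\<close> for \<open>X\<close> with values in \<open>[a,b]\<close> and density \<open>f\<close>.\<close>

definition design_exp :: "real \<Rightarrow> real \<Rightarrow> (real \<Rightarrow> real) \<Rightarrow> (real \<Rightarrow> real) \<Rightarrow> real" where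
  "design_exp a b f h = (LINT x:{a..b}|lborel. h x * f x)"

text \<open>A sieve \<open>B\<close> provides the basis functions \<open>B K k\<close> for \<open>1 \<le> k \<le> K\<close>. Vector and matrix
  indices start at \<open>0\<close>, so index \<open>k\<close> belongs to the basis function \<open>B K (Suc k)\<close>.\<close>

type_synonym sieve = "nat \<Rightarrow> nat \<Rightarrow> real \<Rightarrow> real"

definition basis_vec :: "sieve \<Rightarrow> nat \<Rightarrow> real \<Rightarrow> real vec" where
  "basis_vec B K x = vec K (\<lambda>k. B K (Suc k) x)"

definition sieve_space :: "sieve \<Rightarrow> nat \<Rightarrow> (real \<Rightarrow> real) set" where
  "sieve_space B K = {(\<lambda>x. \<Sum>k=1..K. c k * B K k x) | c :: nat \<Rightarrow> real. True}"

definition gram :: "real \<Rightarrow> real \<Rightarrow> (real \<Rightarrow> real) \<Rightarrow> sieve \<Rightarrow> nat \<Rightarrow> real mat" where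
  "gram a b f B K =
     mat K K (\<lambda>(k, l). design_exp a b f (\<lambda>x. B K (Suc k) x * B K (Suc l) x))"

definition emp_gram :: "sieve \<Rightarrow> nat \<Rightarrow> nat \<Rightarrow> (nat \<Rightarrow> real) \<Rightarrow> real mat" where
  "emp_gram B K n x =
     mat K K (\<lambda>(k, l). 1 / real n * (\<Sum>i=1..n. B K (Suc k) (x i) * B K (Suc l) (x i)))"

text \<open>Smallest and largest eigenvalue, used for symmetric matrices only.\<close>

definition lambda_min :: "real mat \<Rightarrow> real" where
  "lambda_min A = Min {e. eigenvalue A e}"

definition lambda_max :: "real mat \<Rightarrow> real" where
  "lambda_max A = Max {e. eigenvalue A e}"

text \<open>Inverse of a square matrix, with the convention that singular matrices get the zero
  matrix.\<close>

definition mat_inv :: "real mat \<Rightarrow> real mat" where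
  "mat_inv A = (case mat_inverse A of Some C \<Rightarrow> C | None \<Rightarrow> 0\<^sub>m (dim_row A) (dim_col A))"

definition sieve_weight :: "sieve \<Rightarrow> nat \<Rightarrow> nat \<Rightarrow> (nat \<Rightarrow> real) \<Rightarrow> nat \<Rightarrow> real" where
  "sieve_weight B K n x i =
     1 / real n * scalar_prod (basis_vec B K 0)
                    (mat_inv (emp_gram B K n x) *\<^sub>v basis_vec B K (x i))"

definition sieve_est :: "sieve \<Rightarrow> nat \<Rightarrow> nat \<Rightarrow> (nat \<Rightarrow> real) \<Rightarrow> (nat \<Rightarrow> real) \<Rightarrow> real" where
  "sieve_est B K n x y = (\<Sum>i=1..n. sieve_weight B K n x i * y i)"

definition sieve_CW :: "sieve \<Rightarrow> nat \<Rightarrow> nat \<Rightarrow> (nat \<Rightarrow> real) \<Rightarrow> real" where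
  "sieve_CW B K n x = real n / real K * (\<Sum>i=1..n. (sieve_weight B K n x i)\<^sup>2)"

text \<open>A variance estimator is a measurable function of the data \<open>(x\<^sub>i, y\<^sub>i)\<close>, \<open>i = 1, \<dots>, n\<close>.\<close>

type_synonym estimator = "nat \<Rightarrow> (nat \<Rightarrow> real \<times> real) \<Rightarrow> real"

definition is_estimator :: "estimator \<Rightarrow> bool" where
  "is_estimator T \<longleftrightarrow>
     (\<forall>n. T n \<in> borel_measurable (Pi\<^sub>M {1..n} (\<lambda>_. borel \<Otimes>\<^sub>M borel)))"

definition estimate ::
    "estimator \<Rightarrow> nat \<Rightarrow> (nat \<Rightarrow> 'a \<Rightarrow> real) \<Rightarrow> (nat \<Rightarrow> 'a \<Rightarrow> real) \<Rightarrow> 'a \<Rightarrow> real" where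
  "estimate T n X Y \<omega> = T n (\<lambda>i\<in>{1..n}. (X i \<omega>, Y i \<omega>))"

definition sieve_conf_int ::
    "sieve \<Rightarrow> nat \<Rightarrow> real \<Rightarrow> real \<Rightarrow> real \<Rightarrow> estimator \<Rightarrow> nat
      \<Rightarrow> (nat \<Rightarrow> 'a \<Rightarrow> real) \<Rightarrow> (nat \<Rightarrow> 'a \<Rightarrow> real) \<Rightarrow> 'a \<Rightarrow> real set" where
  "sieve_conf_int B K S \<alpha> d Vhat n X Y \<omega> =
     pm_interval (sieve_est B K n (\<lambda>i. X i \<omega>) (\<lambda>i. Y i \<omega>))
       (d * (2 * ln (2 / \<alpha>) * estimate Vhat n X Y \<omega> * sieve_CW B K n (\<lambda>i. X i \<omega>) / real n)
              powr (S / (2 * S + 1)))"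

text \<open>The four conditions on the sieve, relative to a design interval \<open>[a,b]\<close> and design
  density \<open>f\<close>; all constants are uniform in the sieve dimension.\<close>

definition basis_regular ::
    "real \<Rightarrow> real \<Rightarrow> (real \<Rightarrow> real) \<Rightarrow> sieve \<Rightarrow> real \<Rightarrow> real \<Rightarrow> real \<Rightarrow> real \<Rightarrow> bool" where
  "basis_regular a b f B C0 Cinf C1 C2 \<longleftrightarrow>
     (\<forall>K\<ge>1.
        (\<forall>x\<in>{a..b}. real (card {k\<in>{1..K}. B K k x \<noteq> 0}) \<le> C0)
      \<and> (\<forall>k\<in>{1..K}. sup_norm_on {a..b} (B K k) \<le> ennreal (Cinf * real K powr (1/2))
          \<and> design_exp a b f (\<lambda>x. \<bar>B K k x\<bar>) \<le> C1 * real K powr (-1/2)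
          \<and> design_exp a b f (\<lambda>x. (B K k x)\<^sup>2) \<le> C2))"

definition basis_non_overlap :: "real \<Rightarrow> real \<Rightarrow> sieve \<Rightarrow> nat \<Rightarrow> bool" where
  "basis_non_overlap a b B M0 \<longleftrightarrow>
     (\<forall>K\<ge>1. \<forall>k\<in>{1..K}. \<forall>l\<in>{1..K}. \<bar>int k - int l\<bar> > int M0 \<longrightarrow>
        (\<forall>x\<in>{a..b}. B K k x * B K l x = 0))"

definition gram_eigenvalue_bounds ::
    "real \<Rightarrow> real \<Rightarrow> (real \<Rightarrow> real) \<Rightarrow> sieve \<Rightarrow> real \<Rightarrow> real \<Rightarrow> bool" where
  "gram_eigenvalue_bounds a b f B qm qp \<longleftrightarrow>
     (\<forall>K\<ge>1. qm \<le> lambda_min (gram a b f B K)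
         \<and> lambda_min (gram a b f B K) \<le> lambda_max (gram a b f B K)
         \<and> lambda_max (gram a b f B K) \<le> qp)"

definition sieve_approx ::
    "real \<Rightarrow> real \<Rightarrow> sieve \<Rightarrow> (real \<Rightarrow> real) set \<Rightarrow> real \<Rightarrow> real \<Rightarrow> bool" where
  "sieve_approx a b B F S CS \<longleftrightarrow>
     (\<forall>K\<ge>1. (SUP f\<in>F. INF g\<in>sieve_space B K. sup_norm_on {a..b} (\<lambda>x. g x - f x))
              \<le> ennreal (CS * real K powr (-S)))"

end

theory Submission
  imports Defs
begin

text \<open>The estimation error at \<open>0\<close> splits into a bias \<open>\<Sum>\<^sub>i W\<^sub>i m(X\<^sub>i) - m(0)\<close> and a noise term
\<open>\<surd>V \<Sum>\<^sub>i W\<^sub>i \<epsilon>\<^sub>i\<close>. With \<open>K\<close> of order \<open>n\<^bsup>1/(2S+1)\<^esup>\<close> both \<open>K\<^bsup>-S\<^esup>\<close> and \<open>(K/n)\<^bsup>1/2\<^esup>\<close> are of order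
\<open>n\<^bsup>-S/(2S+1)\<^esup>\<close>, and the half-width of the interval is \<open>d\<^sub>n\<close> times
\<open>(V C\<^sub>W / n)\<^bsup>S/(2S+1)\<^esup>\<close> up to a constant. As \<open>d\<^sub>n\<close> tends to infinity, it is enough to show that, outside
events of total probability at most \<open>\<alpha>\<close>, bias and noise are at most constant multiples of
\<open>n\<^bsup>-S/(2S+1)\<^esup>\<close> while \<open>C\<^sub>W\<close> stays above a positive constant, all uniformly over the function class.
The coverage is then at least \<open>1 - \<alpha>\<close> for all \<open>n\<close> from some point on, and \<open>CE\<^sub>n\<close> can be taken
to be \<open>1\<close> before that point and \<open>0\<close> after it.

Everything about the weights is read off the vector \<open>v\<close> that solves \<open>Q v = b(0)\<close> for the empirical
Gram matrix \<open>Q\<close>, since \<open>W\<^sub>i = v\<^sup>T b(X\<^sub>i) / n\<close>. The mean squared Frobenius distance between \<open>Q\<close> and its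
expectation is of order \<open>K\<^sup>2/n\<close>, which tends to \<open>0\<close> (\<open>gram_concentration\<close>), so that with high probability
the quadratic form of \<open>Q\<close> lies between two positive multiples of the identity. The eigenvalue
conditions enter as bounds on the population quadratic form (\<open>rayleigh_bounds\<close>).

On that event \<open>n \<Sum>\<^sub>i W\<^sub>i\<^sup>2 = v\<^sup>T Q v\<close> is comparable to \<open>|b(0)|\<^sup>2\<close>, which is at most of order \<open>K\<close>. The
crude bound \<open>(n \<Sum>\<^sub>i W\<^sub>i\<^sup>2)\<^bsup>1/2\<^esup>\<close> for \<open>\<Sum>\<^sub>i |W\<^sub>i|\<close> would cost a factor \<open>K\<^bsup>1/2\<^esup>\<close> in the bias. It is
avoided by locality: \<open>Q\<close> is a band matrix and \<open>b(0)\<close> is supported near one index \<open>k\<^sub>0\<close>, so the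
entries of \<open>v\<close> decay geometrically in the distance to \<open>k\<^sub>0\<close> (\<open>band_solution_decay\<close>). Together with
the bound of order \<open>K\<^bsup>-1/2\<^esup>\<close> on the means of \<open>|b\<^sub>k(X)|\<close> this gives
\<open>\<Sum>\<^sub>i |W\<^sub>i| \<le> C K\<^bsup>-1/2\<^esup> |b(0)|\<close> (\<open>sum_abs_weight\<close>, \<open>weighted_abs_mean_markov\<close>), and hence a bias of order
\<open>K\<^bsup>-S\<^esup>\<close>, because the weights reproduce the sieve space.

The same bound yields the lower bound on \<open>C\<^sub>W\<close>. If \<open>f\<close> is a member of the class with \<open>f(0) \<noteq> 0\<close> and
\<open>g\<close> is a sieve function close to it, then \<open>|g(0)| = |\<Sum>\<^sub>i W\<^sub>i g(X\<^sub>i)|\<close> is at most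
\<open>C K\<^bsup>-1/2\<^esup> |b(0)| sup |g|\<close>, which forces \<open>|b(0)|\<^sup>2\<close> to be at least of order \<open>K\<close>
(\<open>value_at_0_bound\<close>, \<open>design_bounds\<close>).

The noise is handled by Chebyshev's inequality (\<open>noise_chebyshev\<close>): its cross terms vanish because the
weights are functions of the design, each error has conditional mean \<open>0\<close> given its own covariate, and
the pairs of covariate and error are independent of each other.\<close>

section \<open>Geometric decay of solutions of band systems\<close>

definition ndist :: "nat \<Rightarrow> nat \<Rightarrow> nat" where
  "ndist k l = (k - l) + (l - k)"

text \<open>The matrix sizes vary with the sample size, so vectors and matrices are functions of which only the
entries below \<open>K\<close> count. This avoids carrier conditions in everything but the statements about
inverses and eigenvalues.\<close>

definition bil :: "nat \<Rightarrow> (nat \<Rightarrow> nat \<Rightarrow> real) \<Rightarrow> (nat \<Rightarrow> real) \<Rightarrow> (nat \<Rightarrow> real) \<Rightarrow> real" where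
  "bil K A c d = (\<Sum>k<K. \<Sum>l<K. c k * A k l * d l)"

lemma bil_add_left: "bil K A (\<lambda>k. c k + c' k) d = bil K A c d + bil K A c' d"
  by (simp add: bil_def algebra_simps sum.distrib)

lemma bil_add_right: "bil K A c (\<lambda>k. d k + d' k) = bil K A c d + bil K A c d'"
  by (simp add: bil_def algebra_simps sum.distrib)

lemma bil_scale_left: "bil K A (\<lambda>k. t * c k) d = t * bil K A c d"
  by (simp add: bil_def sum_distrib_left algebra_simps)

lemma bil_scale_right: "bil K A c (\<lambda>k. t * d k) = t * bil K A c d"
  by (simp add: bil_def sum_distrib_left algebra_simps)

lemma bil_commute:
  assumes "\<And>k l. k < K \<Longrightarrow> l < K \<Longrightarrow> A k l = A l k"
  shows "bil K A c d = bil K A d c"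
  unfolding bil_def by (subst sum.swap) (auto intro!: sum.cong simp: assms mult_ac)

lemma bil_eq_sum_apply: "bil K A c d = (\<Sum>k<K. c k * (\<Sum>l<K. A k l * d l))"
  by (simp add: bil_def sum_distrib_left mult_ac)

text \<open>The form is positive semidefinite only, so the usual division by \<open>d\<^sup>T A d\<close> is possible only when it
is nonzero. In the degenerate case the quadratic \<open>t \<mapsto> (c + t d)\<^sup>T A (c + t d)\<close> is affine, and being
nonnegative it must be constant.\<close>

lemma bil_Cauchy_Schwarz:
  assumes sym: "\<And>k l. k < K \<Longrightarrow> l < K \<Longrightarrow> A k l = A l k"
    and psd: "\<And>c. 0 \<le> bil K A c c"
  shows "(bil K A c d)\<^sup>2 \<le> bil K A c c * bil K A d d"
proof -
  define p r s where "p = bil K A c c" and "r = bil K A c d" and "s = bil K A d d"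
  have quad: "0 \<le> p + 2 * t * r + t\<^sup>2 * s" for t
    using psd[of "\<lambda>k. c k + t * d k"] bil_commute[where K = K and c = d and d = c, OF sym]
    by (simp add: bil_add_left bil_add_right bil_scale_left bil_scale_right p_def r_def s_def
        power2_eq_square algebra_simps)
  have "0 \<le> s" unfolding s_def by (rule psd)
  then consider "s = 0" | "s > 0" by linarith
  then have "r\<^sup>2 \<le> p * s"
  proof cases
    case 1
    have "r = 0"
    proof (rule ccontr)
      assume "r \<noteq> 0"
      then show False using quad[of "- (p + 1) / (2 * r)"] 1 by (simp add: field_simps)
    qed
    then show ?thesis using 1 by simp
  next
    case 2
    then show ?thesis using quad[of "- r / s"]
      by (simp add: power2_eq_square field_simps)
  qed
  then show ?thesis by (simp add: p_def r_def s_def)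
qed

text \<open>Let \<open>u\<close> be the part of the solution at distance at least \<open>(j + 1) N\<close> from \<open>k0\<close> and \<open>w\<close> the part in the
next ring inwards. The right-hand side vanishes on the support of \<open>u\<close> and the band structure
decouples \<open>u\<close> from everything further inside, whence \<open>u\<^sup>T A u = - u\<^sup>T A w\<close>. By Cauchy-Schwarz
\<open>u\<^sup>T A u \<le> w\<^sup>T A w\<close>, so the energy outside is controlled by the energy of the ring, that is, by the
difference of two consecutive tails.\<close>

lemma band_solution_tail_contraction:
  fixes p q :: real
  assumes sym: "\<And>k l. k < K \<Longrightarrow> l < K \<Longrightarrow> A k l = A l k"
    and lower: "\<And>c. q * (\<Sum>k<K. (c k)\<^sup>2) \<le> bil K A c c"
    and upper: "\<And>c. bil K A c c \<le> p * (\<Sum>k<K. (c k)\<^sup>2)"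
    and q: "0 < q"
    and band: "\<And>k l. k < K \<Longrightarrow> l < K \<Longrightarrow> N \<le> ndist k l \<Longrightarrow> A k l = 0"
    and v: "\<And>k. k < K \<Longrightarrow> (\<Sum>l<K. A k l * v l) = \<beta> k"
    and \<beta>: "\<And>k. k < K \<Longrightarrow> N \<le> ndist k k0 \<Longrightarrow> \<beta> k = 0"
  defines "D \<equiv> \<lambda>j. \<Sum>k | k < K \<and> j * N \<le> ndist k k0. (v k)\<^sup>2"
  shows "(p + q) * D (Suc j) \<le> p * D j"
proof -
  have psd: "0 \<le> bil K A c c" for c
    using lower[of c] q by (meson mult_nonneg_nonneg less_imp_le order_trans sum_nonneg zero_le_power2)
  define u where "u k = (if Suc j * N \<le> ndist k k0 then v k else 0)" for k
  define w where "w k = (if j * N \<le> ndist k k0 \<and> \<not> Suc j * N \<le> ndist k k0 then v k else 0)" for k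
  define z where "z k = (if j * N \<le> ndist k k0 then 0 else v k)" for k
  have mono: "j * N \<le> ndist k k0" if "Suc j * N \<le> ndist k k0" for k
    using that by simp
  have split_v: "v = (\<lambda>k. u k + (w k + z k))"
    using mono by (auto simp: u_def w_def z_def fun_eq_iff)
  have "bil K A u v = (\<Sum>k<K. u k * \<beta> k)"
    unfolding bil_eq_sum_apply using v by simp
  also have "\<dots> = 0"
    by (rule sum.neutral) (auto simp: u_def \<beta>)
  finally have uv: "bil K A u v = 0" .
  have uz: "bil K A u z = 0"
  proof -
    have "A k l = 0" if "k < K" "l < K" "Suc j * N \<le> ndist k k0" "\<not> j * N \<le> ndist l k0" for k l
      by (rule band) (use that in \<open>auto simp: ndist_def\<close>)
    then have "u k * A k l * z l = 0" if "k < K" "l < K" for k l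
      using that by (auto simp: u_def z_def)
    then show ?thesis unfolding bil_def by (intro sum.neutral ballI) simp
  qed
  have "bil K A u v = bil K A u u + (bil K A u w + bil K A u z)"
    by (subst split_v) (simp only: bil_add_right)
  then have uu: "bil K A u u = - bil K A u w" using uv uz by simp
  have "(bil K A u u)\<^sup>2 \<le> bil K A u u * bil K A w w"
    using bil_Cauchy_Schwarz[OF sym psd, where c = u and d = w] uu by simp
  then have le: "bil K A u u \<le> bil K A w w"
    using psd[of u] psd[of w] by (cases "bil K A u u = 0") (auto simp: power2_eq_square)
  have su: "(\<Sum>k<K. (u k)\<^sup>2) = D (Suc j)"
    unfolding D_def u_def
    by (rule sum.mono_neutral_cong_right) auto
  have sw: "(\<Sum>k<K. (w k)\<^sup>2) = D j - D (Suc j)"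
  proof -
    have "D j = (\<Sum>k<K. if j * N \<le> ndist k k0 then (v k)\<^sup>2 else 0)"
      unfolding D_def by (rule sum.mono_neutral_cong_left) auto
    also have "\<dots> = (\<Sum>k<K. (u k)\<^sup>2 + (w k)\<^sup>2)"
      by (rule sum.cong) (use mono in \<open>auto simp: u_def w_def\<close>)
    finally show ?thesis by (simp add: sum.distrib su)
  qed
  have "q * D (Suc j) \<le> p * (D j - D (Suc j))"
    using lower[of u] upper[of w] le unfolding su sw by linarith
  then show ?thesis by (simp add: algebra_simps)
qed

lemma coercive_solution_bound:
  fixes q :: real
  assumes lower: "\<And>c. q * (\<Sum>k<K. (c k)\<^sup>2) \<le> bil K A c c"
    and q: "0 < q"
    and v: "\<And>k. k < K \<Longrightarrow> (\<Sum>l<K. A k l * v l) = \<beta> k"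
  shows "q\<^sup>2 * (\<Sum>k<K. (v k)\<^sup>2) \<le> (\<Sum>k<K. (\<beta> k)\<^sup>2)"
proof -
  define s where "s = (\<Sum>k<K. (v k)\<^sup>2)"
  have s: "0 \<le> s" by (simp add: s_def sum_nonneg)
  have "q * s \<le> (\<Sum>k<K. v k * \<beta> k)"
    using lower[of v] v by (simp add: s_def bil_eq_sum_apply)
  then have "(q * s)\<^sup>2 \<le> (\<Sum>k<K. v k * \<beta> k)\<^sup>2"
    using q s by (intro power_mono) auto
  also have "\<dots> \<le> s * (\<Sum>k<K. (\<beta> k)\<^sup>2)"
    unfolding s_def by (rule Cauchy_Schwarz_ineq_sum)
  finally have "s * (q\<^sup>2 * s) \<le> s * (\<Sum>k<K. (\<beta> k)\<^sup>2)"
    by (simp add: power2_eq_square algebra_simps)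
  then show ?thesis using s sum_nonneg[of "{..<K}" "\<lambda>k. (\<beta> k)\<^sup>2"]
    by (cases "s = 0") (auto simp: s_def[symmetric])
qed

text \<open>The tail energies contract by the factor \<open>p / (p + q)\<close> per step of length \<open>N\<close>, and an entry is bounded
by the square root of the last tail that contains it.\<close>

lemma band_solution_decay:
  fixes p q :: real
  assumes sym: "\<And>k l. k < K \<Longrightarrow> l < K \<Longrightarrow> A k l = A l k"
    and lower: "\<And>c. q * (\<Sum>k<K. (c k)\<^sup>2) \<le> bil K A c c"
    and upper: "\<And>c. bil K A c c \<le> p * (\<Sum>k<K. (c k)\<^sup>2)"
    and q: "0 < q" and p: "0 < p"
    and band: "\<And>k l. k < K \<Longrightarrow> l < K \<Longrightarrow> N \<le> ndist k l \<Longrightarrow> A k l = 0"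
    and v: "\<And>k. k < K \<Longrightarrow> (\<Sum>l<K. A k l * v l) = \<beta> k"
    and \<beta>: "\<And>k. k < K \<Longrightarrow> N \<le> ndist k k0 \<Longrightarrow> \<beta> k = 0"
    and k: "k < K"
  shows "\<bar>v k\<bar> \<le> sqrt (p / (p + q)) ^ (ndist k k0 div N) * (sqrt (\<Sum>k<K. (\<beta> k)\<^sup>2) / q)"
proof -
  define D where "D j = (\<Sum>k | k < K \<and> j * N \<le> ndist k k0. (v k)\<^sup>2)" for j
  define \<rho> where "\<rho> = p / (p + q)"
  have \<rho>: "0 \<le> \<rho>" using p q by (simp add: \<rho>_def)
  have step: "D (Suc j) \<le> \<rho> * D j" for j
    using band_solution_tail_contraction[where N = N and \<beta> = \<beta> and j = j, OF sym lower upper q band v \<beta>] p q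
    by (simp add: D_def \<rho>_def field_simps)
  have D: "D j \<le> \<rho> ^ j * D 0" for j
  proof (induction j)
    case (Suc j)
    have "D (Suc j) \<le> \<rho> * D j" by (rule step)
    also have "\<dots> \<le> \<rho> * (\<rho> ^ j * D 0)" using Suc \<rho> by (rule mult_left_mono)
    finally show ?case by simp
  qed simp
  have D0: "D 0 \<le> (\<Sum>k<K. (\<beta> k)\<^sup>2) / q\<^sup>2"
    using coercive_solution_bound[OF lower q v] q
    by (simp add: D_def field_simps lessThan_def)
  let ?j = "ndist k k0 div N"
  have "(v k)\<^sup>2 \<le> D ?j"
    unfolding D_def by (rule member_le_sum) (use k in \<open>auto simp: mult.commute\<close>)
  also have "\<dots> \<le> \<rho> ^ ?j * ((\<Sum>k<K. (\<beta> k)\<^sup>2) / q\<^sup>2)"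
    using D[of ?j] mult_left_mono[OF D0, of "\<rho> ^ ?j"] \<rho> by simp
  finally have "sqrt ((v k)\<^sup>2) \<le> sqrt (\<rho> ^ ?j * ((\<Sum>k<K. (\<beta> k)\<^sup>2) / q\<^sup>2))"
    by (rule real_sqrt_le_mono)
  then have "\<bar>v k\<bar> \<le> sqrt (\<rho> ^ ?j * ((\<Sum>k<K. (\<beta> k)\<^sup>2) / q\<^sup>2))"
    by (simp only: real_sqrt_abs)
  then show ?thesis using q
    by (simp add: \<rho>_def real_sqrt_mult real_sqrt_divide real_sqrt_power)
qed

lemma sum_power_div_le:
  fixes r :: real
  assumes r: "0 \<le> r" "r < 1" and N: "0 < N"
  shows "(\<Sum>m<L. r ^ (m div N)) \<le> real N / (1 - r)"
proof -
  have "(\<Sum>m<L. r ^ (m div N)) \<le> (\<Sum>m<L * N. r ^ (m div N))"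
    by (rule sum_mono2) (use r N in auto)
  also have "\<dots> = (\<Sum>j<L. \<Sum>m\<in>{j * N..<j * N + N}. r ^ (m div N))"
    by (rule sum.nat_group[symmetric])
  also have "\<dots> = (\<Sum>j<L. real N * r ^ j)"
  proof (rule sum.cong[OF refl])
    fix j
    have "m div N = j" if "m \<in> {j * N..<j * N + N}" for m
      using that N by (auto intro!: div_nat_eqI simp: mult.commute)
    then have "(\<Sum>m\<in>{j * N..<j * N + N}. r ^ (m div N)) = (\<Sum>m\<in>{j * N..<j * N + N}. r ^ j)"
      by (intro sum.cong) auto
    then show "(\<Sum>m\<in>{j * N..<j * N + N}. r ^ (m div N)) = real N * r ^ j" by simp
  qed
  also have "\<dots> = real N * (\<Sum>j<L. r ^ j)" by (simp add: sum_distrib_left)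
  also have "\<dots> \<le> real N * (1 / (1 - r))"
  proof (rule mult_left_mono)
    have "(\<Sum>j<L. r ^ j) = (1 - r ^ L) / (1 - r)"
      using r by (simp add: sum_gp_strict)
    also have "\<dots> \<le> 1 / (1 - r)" using r by (intro divide_right_mono) auto
    finally show "(\<Sum>j<L. r ^ j) \<le> 1 / (1 - r)" .
  qed simp
  finally show ?thesis by simp
qed

text \<open>This bound is independent of \<open>K\<close> and of the centre: it turns the entrywise decay into an
\<open>\<ell>\<^sup>1\<close>-bound that is uniform in the sieve dimension.\<close>

lemma sum_power_ndist_le:
  fixes r :: real
  assumes r: "0 \<le> r" "r < 1" and N: "0 < N"
  shows "(\<Sum>k<K. r ^ (ndist k k0 div N)) \<le> 2 * real N / (1 - r)"
proof -
  let ?g = "\<lambda>k. r ^ (ndist k k0 div N)"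
  have "(\<Sum>k<K. ?g k) \<le> (\<Sum>k\<in>{..k0} \<union> (\<lambda>m. k0 + m) ` {..<K}. ?g k)"
  proof (rule sum_mono2)
    show "{..<K} \<subseteq> {..k0} \<union> (\<lambda>m. k0 + m) ` {..<K}"
    proof
      fix k assume "k \<in> {..<K}"
      then have "k \<le> k0 \<or> (k = k0 + (k - k0) \<and> k - k0 < K)" by auto
      then show "k \<in> {..k0} \<union> (\<lambda>m. k0 + m) ` {..<K}" by blast
    qed
  qed (use r in auto)
  also have "\<dots> \<le> (\<Sum>k\<in>{..k0}. ?g k) + (\<Sum>k\<in>(\<lambda>m. k0 + m) ` {..<K}. ?g k)"
    by (subst sum.union_inter[symmetric]) (use r in \<open>auto intro!: sum_nonneg\<close>)
  also have "(\<Sum>k\<in>{..k0}. ?g k) = (\<Sum>m<Suc k0. r ^ (m div N))"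
    by (rule sum.reindex_bij_witness[of _ "\<lambda>m. k0 - m" "\<lambda>k. k0 - k"]) (auto simp: ndist_def)
  also have "(\<Sum>k\<in>(\<lambda>m. k0 + m) ` {..<K}. ?g k) = (\<Sum>m<K. r ^ (m div N))"
    by (subst sum.reindex) (auto simp: ndist_def inj_on_def)
  also have "(\<Sum>m<Suc k0. r ^ (m div N)) + (\<Sum>m<K. r ^ (m div N)) \<le> 2 * real N / (1 - r)"
    using sum_power_div_le[OF r N, of "Suc k0"] sum_power_div_le[OF r N, of K] by simp
  finally show ?thesis by simp
qed

section \<open>Inverses and extreme eigenvalues\<close>

lemma det_nonzero_mat_inv:
  assumes A: "A \<in> carrier_mat K K" and det: "det A \<noteq> 0"
  shows "mat_inv A \<in> carrier_mat K K" "mat_inv A * A = 1\<^sub>m K"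
proof -
  have "A \<in> Units (ring_mat TYPE(real) K ())"
    using det_non_zero_imp_unit[OF A det] .
  then obtain C where C: "mat_inverse A = Some C"
    using mat_inverse(1)[OF A, of "()"] by (cases "mat_inverse A") auto
  then show "mat_inv A \<in> carrier_mat K K" "mat_inv A * A = 1\<^sub>m K"
    using mat_inverse(2)[OF A C] by (auto simp: mat_inv_def)
qed

text \<open>In this form the entries of the inverse are visibly rational functions of the entries of the matrix.
For singular matrices both sides are \<open>0\<close>, by the conventions for the inverse and for division by zero,
so no case distinction is needed when measurability is derived from it.\<close>

lemma mat_inv_entry:
  assumes A: "A \<in> carrier_mat K K" and k: "k < K" and l: "l < K"
  shows "mat_inv A $$ (k, l) = adj_mat A $$ (k, l) / det A"
proof (cases "det A = 0")
  case True
  have "mat_inverse A = None"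
  proof (rule ccontr)
    assume "mat_inverse A \<noteq> None"
    then obtain C where "mat_inverse A = Some C" by auto
    from mat_inverse(2)[OF A this] have C: "A * C = 1\<^sub>m K" "C \<in> carrier_mat K K" by auto
    then have "det A * det C = 1" using det_mult[OF A C(2)] by simp
    then show False using True by simp
  qed
  then show ?thesis using A k l True by (simp add: mat_inv_def)
next
  case False
  note inv = det_nonzero_mat_inv[OF A False]
  note adj = adj_mat[OF A]
  have "adj_mat A = (mat_inv A * A) * adj_mat A" using inv adj by simp
  also have "\<dots> = mat_inv A * (A * adj_mat A)"
    by (rule assoc_mult_mat[OF inv(1) A adj(1)])
  also have "\<dots> = det A \<cdot>\<^sub>m mat_inv A"
    unfolding adj(2) using mult_smult_distrib[OF inv(1), of "1\<^sub>m K" K "det A"] inv(1) by simp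
  finally have "adj_mat A $$ (k, l) = det A * mat_inv A $$ (k, l)"
    using inv(1) k l by simp
  then show ?thesis using False by simp
qed

lemma mat_mult_vec_index:
  assumes "k < K"
  shows "(mat K K (\<lambda>(k, l). G k l) *\<^sub>v vec K c) $ k = (\<Sum>l<K. G k l * c l)"
  using assms by (simp add: scalar_prod_def lessThan_atLeast0)

lemma coercive_imp_det_nonzero:
  fixes q :: real
  assumes q: "0 < q" and lower: "\<And>c. q * (\<Sum>k<K. (c k)\<^sup>2) \<le> bil K G c c"
  shows "det (mat K K (\<lambda>(k, l). G k l)) \<noteq> 0"
proof
  let ?A = "mat K K (\<lambda>(k, l). G k l)"
  assume "det ?A = 0"
  then obtain v where v: "v \<in> carrier_vec K" "v \<noteq> 0\<^sub>v K" "?A *\<^sub>v v = 0\<^sub>v K"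
    using det_0_iff_vec_prod_zero[of ?A K] by auto
  define c where "c k = v $ k" for k
  have vc: "v = vec K c" using v(1) by (auto simp: c_def)
  have "(\<Sum>l<K. G k l * c l) = 0" if "k < K" for k
    using mat_mult_vec_index[OF that, of G c] v(3) that by (simp add: vc del: index_mult_mat_vec)
  then have "bil K G c c = 0" by (simp add: bil_eq_sum_apply)
  then have "(\<Sum>k<K. (c k)\<^sup>2) \<le> 0"
    using lower[of c] q by (simp add: mult_le_0_iff)
  then have "(\<Sum>k<K. (c k)\<^sup>2) = 0" using sum_nonneg[of "{..<K}" "\<lambda>k. (c k)\<^sup>2"] by simp
  then have "\<forall>k<K. c k = 0" by (simp add: sum_nonneg_eq_0_iff)
  then have "v = 0\<^sub>v K" using vc by auto
  then show False using v(2) by simp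
qed

lemma bil_frobenius:
  assumes "(\<Sum>k<K. \<Sum>l<K. (A k l)\<^sup>2) \<le> F\<^sup>2" and "0 \<le> F"
  shows "\<bar>bil K A c c\<bar> \<le> F * (\<Sum>k<K. (c k)\<^sup>2)"
proof -
  let ?I = "{..<K} \<times> {..<K}"
  have "(bil K A c c)\<^sup>2 = (\<Sum>z\<in>?I. A (fst z) (snd z) * (c (fst z) * c (snd z)))\<^sup>2"
    unfolding bil_def by (simp add: sum.cartesian_product case_prod_beta mult_ac)
  also have "\<dots> \<le> (\<Sum>z\<in>?I. (A (fst z) (snd z))\<^sup>2) * (\<Sum>z\<in>?I. (c (fst z) * c (snd z))\<^sup>2)"
    by (rule Cauchy_Schwarz_ineq_sum)
  also have "(\<Sum>z\<in>?I. (A (fst z) (snd z))\<^sup>2) = (\<Sum>k<K. \<Sum>l<K. (A k l)\<^sup>2)"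
    by (simp add: sum.cartesian_product case_prod_beta)
  also have "(\<Sum>z\<in>?I. (c (fst z) * c (snd z))\<^sup>2) = (\<Sum>k<K. (c k)\<^sup>2)\<^sup>2"
    by (simp add: power2_eq_square[of "sum _ _"] sum_product sum.cartesian_product case_prod_beta
        power_mult_distrib)
  also have "(\<Sum>k<K. \<Sum>l<K. (A k l)\<^sup>2) * (\<Sum>k<K. (c k)\<^sup>2)\<^sup>2 \<le> F\<^sup>2 * (\<Sum>k<K. (c k)\<^sup>2)\<^sup>2"
    by (rule mult_right_mono[OF assms(1)]) simp
  finally have "\<bar>bil K A c c\<bar>\<^sup>2 \<le> (F * (\<Sum>k<K. (c k)\<^sup>2))\<^sup>2"
    by (simp add: power_mult_distrib)
  then show ?thesis
    by (rule power2_le_imp_le) (simp add: assms(2) sum_nonneg)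
qed

lemma bil_bounded: obtains F :: real where "0 \<le> F" "\<And>c. \<bar>bil K A c c\<bar> \<le> F * (\<Sum>k<K. (c k)\<^sup>2)"
proof
  let ?F = "sqrt (\<Sum>k<K. \<Sum>l<K. (A k l)\<^sup>2)"
  show "0 \<le> ?F" by (simp add: sum_nonneg)
  show "\<bar>bil K A c c\<bar> \<le> ?F * (\<Sum>k<K. (c k)\<^sup>2)" for c
    by (rule bil_frobenius) (simp_all add: sum_nonneg)
qed

text \<open>The Frobenius norm of the inverse bounds \<open>c = P\<^sup>-\<^sup>1 (P c)\<close>.\<close>

lemma nonsingular_lower_bound:
  assumes det: "det (mat K K (\<lambda>(k, l). P k l)) \<noteq> 0"
  obtains C :: real where "0 \<le> C"
    "\<And>c. (\<Sum>k<K. (c k)\<^sup>2) \<le> C * (\<Sum>k<K. (\<Sum>l<K. P k l * c l)\<^sup>2)"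
proof
  let ?A = "mat K K (\<lambda>(k, l). P k l)"
  have A: "?A \<in> carrier_mat K K" by simp
  note inv = det_nonzero_mat_inv[OF A det]
  define J where "J k l = mat_inv ?A $$ (k, l)" for k l
  let ?C = "\<Sum>k<K. \<Sum>l<K. (J k l)\<^sup>2"
  show "0 \<le> ?C" by (simp add: sum_nonneg)
  fix c :: "nat \<Rightarrow> real"
  define d where "d k = (\<Sum>l<K. P k l * c l)" for k
  have "mat_inv ?A *\<^sub>v (?A *\<^sub>v vec K c) = vec K c"
    using assoc_mult_mat_vec[OF inv(1) A, of "vec K c"] inv(2) by simp
  moreover have "?A *\<^sub>v vec K c = vec K d"
    by (rule eq_vecI) (auto simp: d_def mat_mult_vec_index simp del: index_mult_mat_vec)
  moreover have "mat_inv ?A = mat K K (\<lambda>(k, l). J k l)"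
    using inv(1) by (auto simp: J_def intro!: eq_matI)
  ultimately have "c k = (\<Sum>l<K. J k l * d l)" if "k < K" for k
    using mat_mult_vec_index[OF that, of J d] that by simp
  then have "(c k)\<^sup>2 \<le> (\<Sum>l<K. (J k l)\<^sup>2) * (\<Sum>l<K. (d l)\<^sup>2)" if "k < K" for k
    using that Cauchy_Schwarz_ineq_sum[of "J k" d "{..<K}"] by simp
  then have "(\<Sum>k<K. (c k)\<^sup>2) \<le> (\<Sum>k<K. (\<Sum>l<K. (J k l)\<^sup>2) * (\<Sum>l<K. (d l)\<^sup>2))"
    by (intro sum_mono) simp
  then show "(\<Sum>k<K. (c k)\<^sup>2) \<le> ?C * (\<Sum>k<K. (\<Sum>l<K. P k l * c l)\<^sup>2)"
    by (simp add: sum_distrib_right d_def)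
qed

text \<open>The infimum \<open>\<mu>\<close> of the Rayleigh quotient is an eigenvalue. Otherwise the positive semidefinite
\<open>P = G - \<mu>\<close> is invertible, so that \<open>|c|\<^sup>2 \<le> C |P c|\<^sup>2\<close>. Cauchy-Schwarz for the form \<open>P\<close> gives
\<open>|P c|\<^sup>2 \<le> F c\<^sup>T P c\<close>, and together \<open>c\<^sup>T P c\<close> is bounded below by a positive multiple of \<open>|c|\<^sup>2\<close>, against
the choice of \<open>\<mu>\<close>. No minimiser is constructed, hence no compactness argument is involved.\<close>

lemma rayleigh_infimum_eigenvalue:
  fixes G :: "nat \<Rightarrow> nat \<Rightarrow> real"
  assumes K: "1 \<le> K" and sym: "\<And>k l. k < K \<Longrightarrow> l < K \<Longrightarrow> G k l = G l k"
  obtains \<mu> where "eigenvalue (mat K K (\<lambda>(k, l). G k l)) \<mu>"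
    "\<And>c. \<mu> * (\<Sum>k<K. (c k)\<^sup>2) \<le> bil K G c c"
proof -
  define R where "R = {bil K G c c | c. (\<Sum>k<K. (c k)\<^sup>2) = 1}"
  obtain F where F: "0 \<le> F" "\<And>c. \<bar>bil K G c c\<bar> \<le> F * (\<Sum>k<K. (c k)\<^sup>2)"
    using bil_bounded[of K G] by blast
  have bdd: "bdd_below R"
  proof (rule bdd_belowI)
    fix r assume "r \<in> R"
    then obtain c where "r = bil K G c c" "(\<Sum>k<K. (c k)\<^sup>2) = 1" by (auto simp: R_def)
    then show "- F \<le> r" using F(2)[of c] by simp
  qed
  have ne: "R \<noteq> {}"
  proof -
    have "(\<Sum>k<K. (if k = 0 then 1 else 0 :: real)\<^sup>2) = (\<Sum>k<K. if k = 0 then 1 else 0)"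
      by (rule sum.cong) auto
    also have "\<dots> = 1" using K by simp
    finally have "bil K G (\<lambda>k. if k = 0 then 1 else 0) (\<lambda>k. if k = 0 then 1 else 0) \<in> R"
      unfolding R_def by (intro CollectI exI[of _ "\<lambda>k. if k = 0 then 1 else 0"] conjI refl)
    then show ?thesis by auto
  qed
  have scaled: "\<mu> * (\<Sum>k<K. (c k)\<^sup>2) \<le> bil K G c c" if \<mu>: "\<And>r. r \<in> R \<Longrightarrow> \<mu> \<le> r" for \<mu> c
  proof -
    define s where "s = (\<Sum>k<K. (c k)\<^sup>2)"
    have s: "0 \<le> s" by (simp add: s_def sum_nonneg)
    show ?thesis
    proof (cases "s = 0")
      case True
      then have "\<forall>k<K. c k = 0" by (simp add: s_def sum_nonneg_eq_0_iff)
      then show ?thesis using True by (simp add: s_def bil_def)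
    next
      case False
      then have s: "s > 0" using s by simp
      have "(\<Sum>k<K. (inverse (sqrt s) * c k)\<^sup>2) = 1"
        using s by (simp add: power_mult_distrib sum_distrib_left[symmetric] s_def[symmetric]
            power_inverse)
      then have "bil K G (\<lambda>k. inverse (sqrt s) * c k) (\<lambda>k. inverse (sqrt s) * c k) \<in> R"
        unfolding R_def by (intro CollectI exI[of _ "\<lambda>k. inverse (sqrt s) * c k"] conjI refl)
      from \<mu>[OF this] have "\<mu> \<le> inverse (sqrt s) * (inverse (sqrt s) * bil K G c c)"
        by (simp only: bil_scale_left bil_scale_right)
      also have "\<dots> = bil K G c c / s"
        using s by (simp add: field_simps flip: mult.assoc)
      finally show ?thesis using s by (simp add: field_simps s_def)
    qed
  qed
  define \<mu> where "\<mu> = Inf R"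
  have low: "\<mu> * (\<Sum>k<K. (c k)\<^sup>2) \<le> bil K G c c" for c
    by (rule scaled) (simp add: \<mu>_def cInf_lower bdd)
  define P where "P k l = G k l - (if k = l then \<mu> else 0)" for k l
  have bilP: "bil K P c c = bil K G c c - \<mu> * (\<Sum>k<K. (c k)\<^sup>2)" for c
  proof -
    have "(\<Sum>l<K. c k * (if k = l then \<mu> else 0) * c l) = \<mu> * (c k)\<^sup>2" if "k < K" for k
    proof -
      have "(\<Sum>l<K. c k * (if k = l then \<mu> else 0) * c l) = (\<Sum>l<K. if k = l then \<mu> * (c k)\<^sup>2 else 0)"
        by (rule sum.cong) (auto simp: power2_eq_square)
      then show ?thesis using that by simp
    qed
    then show ?thesis
      by (simp add: bil_def P_def algebra_simps sum_subtractf sum_distrib_left)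
  qed
  have psd: "0 \<le> bil K P c c" for c using low[of c] by (simp add: bilP)
  have symP: "P k l = P l k" if "k < K" "l < K" for k l
    using sym[OF that] by (simp add: P_def)
  have "det (mat K K (\<lambda>(k, l). P k l)) = 0"
  proof (rule ccontr)
    assume "det (mat K K (\<lambda>(k, l). P k l)) \<noteq> 0"
    then obtain C where C: "0 \<le> C"
      "\<And>c. (\<Sum>k<K. (c k)\<^sup>2) \<le> C * (\<Sum>k<K. (\<Sum>l<K. P k l * c l)\<^sup>2)"
      using nonsingular_lower_bound by blast
    obtain F where F: "0 \<le> F" "\<And>c. \<bar>bil K P c c\<bar> \<le> F * (\<Sum>k<K. (c k)\<^sup>2)"
      using bil_bounded[of K P] by blast
    \<comment> \<open>the spectral gap that an invertible positive semidefinite matrix would have\<close>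
    have gap: "(\<Sum>k<K. (c k)\<^sup>2) \<le> C * F * bil K P c c" for c
    proof -
      define d where "d k = (\<Sum>l<K. P k l * c l)" for k
      define s where "s = (\<Sum>k<K. (d k)\<^sup>2)"
      have s: "0 \<le> s" by (simp add: s_def sum_nonneg)
      have "s = bil K P d c" by (simp add: bil_eq_sum_apply s_def d_def power2_eq_square)
      then have "s\<^sup>2 \<le> bil K P d d * bil K P c c"
        using bil_Cauchy_Schwarz[OF symP psd, where c = d and d = c] by simp
      also have "\<dots> \<le> F * s * bil K P c c"
        using F(2)[of d] psd[of c] by (intro mult_right_mono) (auto simp: s_def)
      finally have "s * s \<le> s * (F * bil K P c c)" by (simp add: power2_eq_square mult_ac)
      then have "s \<le> F * bil K P c c" using s psd[of c] F(1)
        by (cases "s = 0") auto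
      from mult_left_mono[OF this C(1)] C(2)[of c] show ?thesis
        by (simp add: s_def d_def mult.assoc)
    qed
    define \<delta> where "\<delta> = 1 / (C * F + 1)"
    have CF: "0 \<le> C * F" using C F by simp
    have \<delta>: "\<delta> > 0" using CF by (simp add: \<delta>_def)
    have "\<mu> + \<delta> \<le> r" if "r \<in> R" for r
    proof -
      from that obtain c where c: "r = bil K G c c" "(\<Sum>k<K. (c k)\<^sup>2) = 1" by (auto simp: R_def)
      have "1 \<le> C * F * (r - \<mu>)" "0 \<le> r - \<mu>"
        using gap[of c] psd[of c] c by (simp_all add: bilP)
      then have "1 \<le> (C * F + 1) * (r - \<mu>)" by (simp add: algebra_simps)
      then have "\<delta> \<le> r - \<mu>" using CF by (simp add: \<delta>_def divide_le_eq mult.commute)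
      then show ?thesis by simp
    qed
    then have "\<mu> + \<delta> \<le> Inf R" using ne by (intro cInf_greatest)
    then show False using \<delta> by (simp add: \<mu>_def)
  qed
  moreover have "mat K K (\<lambda>(k, l). P k l) = char_matrix (mat K K (\<lambda>(k, l). G k l)) \<mu>"
    by (auto simp: P_def char_matrix_def intro!: eq_matI)
  ultimately have "eigenvalue (mat K K (\<lambda>(k, l). G k l)) \<mu>"
    by (simp add: eigenvalue_det[of _ K])
  then show thesis using low by (rule that)
qed

lemma finite_eigenvalues:
  assumes "(A :: real mat) \<in> carrier_mat K K"
  shows "finite {e. eigenvalue A e}"
proof -
  have "char_poly A \<noteq> 0" using degree_monic_char_poly[OF assms] by auto
  then show ?thesis
    using poly_roots_finite by (simp add: eigenvalue_root_char_poly[OF assms])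
qed

text \<open>The infimum of the Rayleigh quotient is an eigenvalue, so the smallest eigenvalue cannot exceed it.
The upper bound is the lower one for \<open>- G\<close>.\<close>

lemma rayleigh_bounds:
  fixes G :: "nat \<Rightarrow> nat \<Rightarrow> real"
  assumes K: "1 \<le> K" and sym: "\<And>k l. k < K \<Longrightarrow> l < K \<Longrightarrow> G k l = G l k"
  shows "lambda_min (mat K K (\<lambda>(k, l). G k l)) * (\<Sum>k<K. (c k)\<^sup>2) \<le> bil K G c c"
    and "bil K G c c \<le> lambda_max (mat K K (\<lambda>(k, l). G k l)) * (\<Sum>k<K. (c k)\<^sup>2)"
proof -
  let ?A = "mat K K (\<lambda>(k, l). G k l)"
  have A: "?A \<in> carrier_mat K K" by simp
  have nn: "0 \<le> (\<Sum>k<K. (c k)\<^sup>2)" by (simp add: sum_nonneg)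
  obtain \<mu> where \<mu>: "eigenvalue ?A \<mu>" "\<And>c. \<mu> * (\<Sum>k<K. (c k)\<^sup>2) \<le> bil K G c c"
    using rayleigh_infimum_eigenvalue[where G = G, OF K sym] by blast
  have "lambda_min ?A \<le> \<mu>"
    unfolding lambda_min_def using \<mu>(1) finite_eigenvalues[OF A] by (intro Min_le) auto
  then show "lambda_min ?A * (\<Sum>k<K. (c k)\<^sup>2) \<le> bil K G c c"
    using \<mu>(2)[of c] mult_right_mono[OF _ nn] by fastforce
  let ?G = "\<lambda>k l. - G k l"
  obtain \<nu> where \<nu>: "eigenvalue (mat K K (\<lambda>(k, l). ?G k l)) \<nu>"
      "\<And>c. \<nu> * (\<Sum>k<K. (c k)\<^sup>2) \<le> bil K ?G c c"
    using rayleigh_infimum_eigenvalue[where G = ?G, OF K] sym by auto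
  have "char_matrix (mat K K (\<lambda>(k, l). ?G k l)) \<nu> = - char_matrix ?A (- \<nu>)"
    by (rule eq_matI) (auto simp: char_matrix_def)
  then have "eigenvalue ?A (- \<nu>)"
    using \<nu>(1) det_0_negate[of "char_matrix ?A (- \<nu>)" K] by (simp add: eigenvalue_det[of _ K])
  then have "- \<nu> \<le> lambda_max ?A"
    unfolding lambda_max_def using finite_eigenvalues[OF A] by (intro Max_ge) auto
  moreover have "bil K ?G c c = - bil K G c c" by (simp add: bil_def sum_negf)
  ultimately show "bil K G c c \<le> lambda_max ?A * (\<Sum>k<K. (c k)\<^sup>2)"
    using \<nu>(2)[of c] mult_right_mono[OF \<open>- \<nu> \<le> lambda_max ?A\<close> nn] by simp
qed

section \<open>Second moments under independence\<close>

text \<open>The conditional mean of \<open>r(U)\<close> is known given \<open>p(U)\<close> only, whereas the factor \<open>H\<close> also depends on the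
independent variable \<open>Z\<close>. Fubini on the product of the laws of \<open>Z\<close> and \<open>U\<close> freezes \<open>Z\<close>; what remains is a
bounded function of \<open>p(U)\<close>, to which the definition of conditional expectation applies. Boundedness is
asked for each frozen value separately, so that \<open>H\<close> may contain another error as a factor of \<open>Z\<close>.\<close>

lemma (in prob_space) indep_cond_mean_const:
  fixes p r :: "'b \<Rightarrow> real"
  assumes indep: "indep_var N Z P U"
    and p: "p \<in> borel_measurable P" and r: "r \<in> borel_measurable P"
    and int: "integrable M (\<lambda>\<omega>. r (U \<omega>))"
    and cond: "AE \<omega> in M. cond_exp_given M (\<lambda>\<omega>. p (U \<omega>)) (\<lambda>\<omega>. r (U \<omega>)) \<omega> = \<kappa>"
    and H: "H \<in> borel_measurable (N \<Otimes>\<^sub>M borel)"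
    and bounded: "\<And>z. z \<in> space N \<Longrightarrow> \<exists>C. \<forall>x. \<bar>H (z, x)\<bar> \<le> C"
    and intH: "integrable M (\<lambda>\<omega>. H (Z \<omega>, p (U \<omega>)))"
    and intHr: "integrable M (\<lambda>\<omega>. H (Z \<omega>, p (U \<omega>)) * r (U \<omega>))"
  shows "expectation (\<lambda>\<omega>. H (Z \<omega>, p (U \<omega>)) * r (U \<omega>)) = \<kappa> * expectation (\<lambda>\<omega>. H (Z \<omega>, p (U \<omega>)))"
proof -
  have Z[measurable]: "Z \<in> measurable M N" and U[measurable]: "U \<in> measurable M P"
    using indep by (auto dest: indep_var_rv1 indep_var_rv2)
  note [measurable] = H p r
  define D1 where "D1 = distr M N Z"
  define D2 where "D2 = distr M P U"
  interpret D1: prob_space D1 unfolding D1_def by (rule prob_space_distr) measurable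
  interpret D2: prob_space D2 unfolding D2_def by (rule prob_space_distr) measurable
  interpret D: pair_sigma_finite D1 D2 ..
  have joint: "D1 \<Otimes>\<^sub>M D2 = distr M (N \<Otimes>\<^sub>M P) (\<lambda>\<omega>. (Z \<omega>, U \<omega>))"
    using indep unfolding indep_var_distribution_eq D1_def D2_def by simp
  have fubini: "expectation (\<lambda>\<omega>. h (Z \<omega>, U \<omega>)) = (\<integral>z. expectation (\<lambda>\<omega>. h (z, U \<omega>)) \<partial>D1)"
    if h[measurable]: "h \<in> borel_measurable (N \<Otimes>\<^sub>M P)" and ih: "integrable M (\<lambda>\<omega>. h (Z \<omega>, U \<omega>))"
    for h :: "_ \<Rightarrow> real"
  proof -
    have "integrable (D1 \<Otimes>\<^sub>M D2) h"
      unfolding joint using ih by (subst integrable_distr_eq) simp_all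
    then have "(\<integral>z. (\<integral>u. h (z, u) \<partial>D2) \<partial>D1) = integral\<^sup>L (D1 \<Otimes>\<^sub>M D2) h"
      by (rule D.integral_fst')
    also have "\<dots> = expectation (\<lambda>\<omega>. h (Z \<omega>, U \<omega>))"
      unfolding joint by (subst integral_distr) simp_all
    also have "(\<integral>z. (\<integral>u. h (z, u) \<partial>D2) \<partial>D1) = (\<integral>z. expectation (\<lambda>\<omega>. h (z, U \<omega>)) \<partial>D1)"
    proof (rule Bochner_Integration.integral_cong[OF refl])
      fix z assume "z \<in> space D1"
      then have z: "z \<in> space N" by (simp add: D1_def)
      have [measurable]: "(\<lambda>u. h (z, u)) \<in> borel_measurable P"
        by (rule measurable_compose[OF measurable_Pair1'[OF z] h])
      show "(\<integral>u. h (z, u) \<partial>D2) = expectation (\<lambda>\<omega>. h (z, U \<omega>))"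
        unfolding D2_def by (subst integral_distr) simp_all
    qed
    finally show ?thesis by simp
  qed
  let ?X = "\<lambda>\<omega>. p (U \<omega>)"
  let ?F = "vimage_algebra (space M) ?X borel"
  interpret F: finite_measure_subalgebra M ?F
  proof
    have "?X \<in> space M \<rightarrow> space borel" by simp
    moreover have "?X \<in> borel_measurable M" by measurable
    ultimately show "subalgebra M ?F"
      unfolding subalgebra_def using measurable_sets[of ?X M borel]
      by (auto simp: sets_vimage_algebra2)
  qed
  have inner: "expectation (\<lambda>\<omega>. g (p (U \<omega>)) * r (U \<omega>)) = \<kappa> * expectation (\<lambda>\<omega>. g (p (U \<omega>)))"
    if g[measurable]: "g \<in> borel_measurable borel" and C: "\<And>x. \<bar>g x\<bar> \<le> C" for g :: "real \<Rightarrow> real" and C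
  proof -
    have gF: "(\<lambda>\<omega>. g (p (U \<omega>))) \<in> borel_measurable ?F"
      by (rule measurable_compose[OF measurable_vimage_algebra1 g]) simp
    have C0: "0 \<le> C" using C[of 0] by linarith
    have "integrable M (\<lambda>\<omega>. C * \<bar>r (U \<omega>)\<bar>)" using int by simp
    then have "integrable M (\<lambda>\<omega>. g (p (U \<omega>)) * r (U \<omega>))"
    proof (rule Bochner_Integration.integrable_bound)
      show "AE \<omega> in M. norm (g (p (U \<omega>)) * r (U \<omega>)) \<le> norm (C * \<bar>r (U \<omega>)\<bar>)"
        using C C0 by (auto simp: abs_mult intro!: mult_right_mono)
    qed measurable
    then have "expectation (\<lambda>\<omega>. g (p (U \<omega>)) * r (U \<omega>)) =
        expectation (\<lambda>\<omega>. g (p (U \<omega>)) * real_cond_exp M ?F (\<lambda>\<omega>. r (U \<omega>)) \<omega>)"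
      using F.real_cond_exp_intg(2)[OF _ gF] by simp
    also have "\<dots> = expectation (\<lambda>\<omega>. g (p (U \<omega>)) * \<kappa>)"
    proof (rule integral_cong_AE)
      show "AE \<omega> in M. g (p (U \<omega>)) * real_cond_exp M ?F (\<lambda>\<omega>. r (U \<omega>)) \<omega> = g (p (U \<omega>)) * \<kappa>"
        using cond unfolding cond_exp_given_def by eventually_elim simp
    qed measurable
    finally show ?thesis by simp
  qed
  have "expectation (\<lambda>\<omega>. H (Z \<omega>, p (U \<omega>)) * r (U \<omega>)) =
      (\<integral>z. expectation (\<lambda>\<omega>. H (z, p (U \<omega>)) * r (U \<omega>)) \<partial>D1)"
    using fubini[of "\<lambda>(z, u). H (z, p u) * r u"] intHr by simp
  also have "\<dots> = (\<integral>z. \<kappa> * expectation (\<lambda>\<omega>. H (z, p (U \<omega>))) \<partial>D1)"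
  proof (rule Bochner_Integration.integral_cong[OF refl])
    fix z assume "z \<in> space D1"
    then have z: "z \<in> space N" by (simp add: D1_def)
    have m: "(\<lambda>x. H (z, x)) \<in> borel_measurable borel"
      by (rule measurable_compose[OF measurable_Pair1'[OF z] H])
    obtain C where "\<And>x. \<bar>H (z, x)\<bar> \<le> C" using bounded[OF z] by blast
    then show "expectation (\<lambda>\<omega>. H (z, p (U \<omega>)) * r (U \<omega>)) = \<kappa> * expectation (\<lambda>\<omega>. H (z, p (U \<omega>)))"
      by (rule inner[OF m])
  qed
  also have "\<dots> = \<kappa> * (\<integral>z. expectation (\<lambda>\<omega>. H (z, p (U \<omega>))) \<partial>D1)" by simp
  also have "(\<integral>z. expectation (\<lambda>\<omega>. H (z, p (U \<omega>))) \<partial>D1) = expectation (\<lambda>\<omega>. H (Z \<omega>, p (U \<omega>)))"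
    using fubini[of "\<lambda>(z, u). H (z, p u)"] intH by simp
  finally show ?thesis .
qed

text \<open>The noise behaves as if the weights were constants: an error is integrated out against all other
pairs, so \<open>E[w\<^sub>i w\<^sub>j \<epsilon>\<^sub>i \<epsilon>\<^sub>j]\<close> is \<open>0\<close> for \<open>i \<noteq> j\<close> and \<open>E[w\<^sub>i\<^sup>2 \<epsilon>\<^sub>i\<^sup>2] = E[w\<^sub>i\<^sup>2]\<close>. The uniform bound on the
squared weights provides all integrability.\<close>

lemma (in prob_space) truncated_noise_second_moment:
  fixes X e :: "nat \<Rightarrow> 'a \<Rightarrow> real" and w :: "(nat \<Rightarrow> real) \<Rightarrow> nat \<Rightarrow> real"
  assumes fin: "finite I"
    and indep: "indep_vars (\<lambda>_. borel \<Otimes>\<^sub>M borel) (\<lambda>i \<omega>. (X i \<omega>, e i \<omega>)) I"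
    and e1: "\<And>i. i \<in> I \<Longrightarrow> integrable M (e i)"
    and e1c: "\<And>i. i \<in> I \<Longrightarrow> AE \<omega> in M. cond_exp_given M (X i) (e i) \<omega> = 0"
    and e2: "\<And>i. i \<in> I \<Longrightarrow> integrable M (\<lambda>\<omega>. (e i \<omega>)\<^sup>2)"
    and e2c: "\<And>i. i \<in> I \<Longrightarrow> AE \<omega> in M. cond_exp_given M (X i) (\<lambda>\<omega>. (e i \<omega>)\<^sup>2) \<omega> = 1"
    and w: "\<And>i. i \<in> I \<Longrightarrow> (\<lambda>x. w x i) \<in> borel_measurable (Pi\<^sub>M I (\<lambda>_. borel))"
    and bound: "\<And>x. (\<Sum>i\<in>I. (w x i)\<^sup>2) \<le> \<tau>"
  defines "T \<equiv> \<lambda>\<omega>. \<Sum>i\<in>I. w (\<lambda>j\<in>I. X j \<omega>) i * e i \<omega>"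
  shows "integrable M (\<lambda>\<omega>. (T \<omega>)\<^sup>2)" "expectation (\<lambda>\<omega>. (T \<omega>)\<^sup>2) \<le> \<tau>"
proof -
  define W where "W i \<omega> = w (\<lambda>j\<in>I. X j \<omega>) i" for i \<omega>
  have XE: "(\<lambda>\<omega>. (X i \<omega>, e i \<omega>)) \<in> measurable M (borel \<Otimes>\<^sub>M borel)" if "i \<in> I" for i
    using indep that by (simp add: indep_vars_def)
  have X[measurable]: "X i \<in> borel_measurable M" and e[measurable]: "e i \<in> borel_measurable M" if "i \<in> I" for i
    using measurable_compose[OF XE[OF that] measurable_fst] measurable_compose[OF XE[OF that] measurable_snd]
    by simp_all
  have xv: "(\<lambda>\<omega>. \<lambda>j\<in>I. X j \<omega>) \<in> measurable M (Pi\<^sub>M I (\<lambda>_. borel))"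
    by (rule measurable_restrict) (rule X)
  have W: "W i \<in> borel_measurable M" if "i \<in> I" for i
    unfolding W_def by (rule measurable_compose[OF xv w[OF that]])
  have \<tau>: "0 \<le> \<tau>" using order_trans[OF sum_nonneg bound] by simp
  have w2: "(w x i)\<^sup>2 \<le> \<tau>" if "i \<in> I" for x i
    using order_trans[OF member_le_sum[of i I "\<lambda>i. (w x i)\<^sup>2"] bound[of x]] that fin by simp
  have ww: "\<bar>w x i * w x j\<bar> \<le> \<tau>" if "i \<in> I" "j \<in> I" for x i j
  proof -
    have "2 * \<bar>w x i * w x j\<bar> \<le> (w x i)\<^sup>2 + (w x j)\<^sup>2"
      using sum_squares_bound[of "\<bar>w x i\<bar>" "\<bar>w x j\<bar>"] by (simp add: abs_mult)
    then show ?thesis using w2[OF that(1), of x] w2[OF that(2), of x] by linarith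
  qed
  have int_ee: "integrable M (\<lambda>\<omega>. e i \<omega> * e j \<omega>)" if "i \<in> I" "j \<in> I" for i j
  proof (rule Bochner_Integration.integrable_bound)
    show "integrable M (\<lambda>\<omega>. (e i \<omega>)\<^sup>2 + (e j \<omega>)\<^sup>2)" using e2 that by simp
    show "AE \<omega> in M. norm (e i \<omega> * e j \<omega>) \<le> norm ((e i \<omega>)\<^sup>2 + (e j \<omega>)\<^sup>2)"
    proof (rule AE_I2)
      fix \<omega>
      have "2 * \<bar>e i \<omega> * e j \<omega>\<bar> \<le> (e i \<omega>)\<^sup>2 + (e j \<omega>)\<^sup>2"
        using sum_squares_bound[of "\<bar>e i \<omega>\<bar>" "\<bar>e j \<omega>\<bar>"] by (simp add: abs_mult)
      moreover have "0 \<le> (e i \<omega>)\<^sup>2 + (e j \<omega>)\<^sup>2" by simp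
      ultimately show "norm (e i \<omega> * e j \<omega>) \<le> norm ((e i \<omega>)\<^sup>2 + (e j \<omega>)\<^sup>2)"
        unfolding real_norm_def by linarith
    qed
  qed (use e that in measurable)
  have bounded_mult: "integrable M (\<lambda>\<omega>. W i \<omega> * W j \<omega> * f \<omega>)"
    if f: "integrable M f" and ij: "i \<in> I" "j \<in> I" for i j f
  proof (rule Bochner_Integration.integrable_bound)
    show "integrable M (\<lambda>\<omega>. \<tau> * f \<omega>)" using f by simp
    show "(\<lambda>\<omega>. W i \<omega> * W j \<omega> * f \<omega>) \<in> borel_measurable M" using W ij f by simp
    show "AE \<omega> in M. norm (W i \<omega> * W j \<omega> * f \<omega>) \<le> norm (\<tau> * f \<omega>)"
      using ww[OF ij] \<tau> by (auto simp: abs_mult W_def intro!: mult_right_mono)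
  qed
  have int_term: "integrable M (\<lambda>\<omega>. (W i \<omega> * W j \<omega>) * (e i \<omega> * e j \<omega>))" if "i \<in> I" "j \<in> I" for i j
    using bounded_mult[OF int_ee that] that by blast
  have T_eq: "(T \<omega>)\<^sup>2 = (\<Sum>i\<in>I. \<Sum>j\<in>I. (W i \<omega> * W j \<omega>) * (e i \<omega> * e j \<omega>))" for \<omega>
    by (simp add: T_def W_def power2_eq_square sum_product mult_ac)
  show "integrable M (\<lambda>\<omega>. (T \<omega>)\<^sup>2)"
    unfolding T_eq using int_term by (intro Bochner_Integration.integrable_sum) auto
  have block: "expectation (\<lambda>\<omega>. h (\<lambda>j\<in>I. X j \<omega>) (\<lambda>j\<in>I - {i}. (X j \<omega>, e j \<omega>)) * \<theta> (e i \<omega>))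
      = \<kappa> * expectation (\<lambda>\<omega>. h (\<lambda>j\<in>I. X j \<omega>) (\<lambda>j\<in>I - {i}. (X j \<omega>, e j \<omega>)))"
    if i: "i \<in> I"
      and h: "(\<lambda>(x, z). h x z) \<in> borel_measurable (Pi\<^sub>M I (\<lambda>_. borel) \<Otimes>\<^sub>M Pi\<^sub>M (I - {i}) (\<lambda>_. borel \<Otimes>\<^sub>M borel))"
      and hb: "\<And>z. \<exists>C. \<forall>x. \<bar>h x z\<bar> \<le> C"
      and \<theta>: "\<theta> \<in> borel_measurable borel"
      and int: "integrable M (\<lambda>\<omega>. \<theta> (e i \<omega>))"
      and cond: "AE \<omega> in M. cond_exp_given M (X i) (\<lambda>\<omega>. \<theta> (e i \<omega>)) \<omega> = \<kappa>"
      and i1: "integrable M (\<lambda>\<omega>. h (\<lambda>j\<in>I. X j \<omega>) (\<lambda>j\<in>I - {i}. (X j \<omega>, e j \<omega>)))"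
      and i2: "integrable M (\<lambda>\<omega>. h (\<lambda>j\<in>I. X j \<omega>) (\<lambda>j\<in>I - {i}. (X j \<omega>, e j \<omega>)) * \<theta> (e i \<omega>))"
    for i \<theta> \<kappa> and h :: "(nat \<Rightarrow> real) \<Rightarrow> (nat \<Rightarrow> real \<times> real) \<Rightarrow> real"
  proof -
    let ?J = "I - {i}"
    let ?N = "Pi\<^sub>M ?J (\<lambda>_. borel \<Otimes>\<^sub>M borel) :: (nat \<Rightarrow> real \<times> real) measure"
    let ?Z = "\<lambda>\<omega>. \<lambda>j\<in>?J. (X j \<omega>, e j \<omega>)"
    \<comment> \<open>reinserts the separated covariate into the full design vector\<close>
    define put where "put z x = (\<lambda>j\<in>I. if j = i then x else fst (z j))" for z :: "nat \<Rightarrow> real \<times> real" and x :: real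
    let ?P = "Pi\<^sub>M {i} (\<lambda>_. borel \<Otimes>\<^sub>M borel) :: (nat \<Rightarrow> real \<times> real) measure"
    let ?U = "\<lambda>\<omega>. \<lambda>j\<in>{i}. (X j \<omega>, e j \<omega>)"
    have iv: "indep_var ?N ?Z ?P ?U"
      using indep by (rule indep_var_restrict) (use i in auto)
    have proj: "(\<lambda>u. u i) \<in> measurable ?P (borel \<Otimes>\<^sub>M borel)"
      by (rule measurable_component_singleton) simp
    have pm: "(\<lambda>u. fst (u i)) \<in> borel_measurable ?P"
      by (rule measurable_compose[OF proj measurable_fst])
    have rm: "(\<lambda>u. \<theta> (snd (u i))) \<in> borel_measurable ?P"
      by (rule measurable_compose[OF measurable_compose[OF proj measurable_snd] \<theta>])
    have put[measurable]: "(\<lambda>p. put (fst p) (snd p)) \<in> measurable (?N \<Otimes>\<^sub>M borel) (Pi\<^sub>M I (\<lambda>_. borel))"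
      unfolding put_def
    proof (rule measurable_restrict)
      fix j assume j: "j \<in> I"
      show "(\<lambda>p. if j = i then snd p else fst (fst p j)) \<in> borel_measurable (?N \<Otimes>\<^sub>M borel)"
      proof (cases "j = i")
        case False
        then have "(\<lambda>z. z j) \<in> measurable ?N (borel \<Otimes>\<^sub>M borel)"
          using j by (intro measurable_component_singleton) auto
        then have "(\<lambda>p. fst (fst p j)) \<in> borel_measurable (?N \<Otimes>\<^sub>M borel)"
          by (intro measurable_compose[OF _ measurable_fst] measurable_compose[OF measurable_fst])
        then show ?thesis using False by simp
      qed simp
    qed
    define H where "H p = h (put (fst p) (snd p)) (fst p)" for p
    have "(\<lambda>p. (put (fst p) (snd p), fst p)) \<in> measurable (?N \<Otimes>\<^sub>M borel) (Pi\<^sub>M I (\<lambda>_. borel) \<Otimes>\<^sub>M ?N)"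
      by (rule measurable_Pair[OF put measurable_fst])
    from measurable_compose[OF this h] have Hm: "H \<in> borel_measurable (?N \<Otimes>\<^sub>M borel)"
      by (simp add: H_def[abs_def])
    have eq: "put (?Z \<omega>) (X i \<omega>) = (\<lambda>j\<in>I. X j \<omega>)" for \<omega>
      by (auto simp: put_def fun_eq_iff)
    have "expectation (\<lambda>\<omega>. H (?Z \<omega>, fst (?U \<omega> i)) * \<theta> (snd (?U \<omega> i))) =
        \<kappa> * expectation (\<lambda>\<omega>. H (?Z \<omega>, fst (?U \<omega> i)))"
    proof (rule indep_cond_mean_const[OF iv pm rm _ _ Hm])
      show "\<exists>C. \<forall>x. \<bar>H (z, x)\<bar> \<le> C" for z
        using hb[of z] by (auto simp: H_def)
      show "integrable M (\<lambda>\<omega>. \<theta> (snd (?U \<omega> i)))" using int by simp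
      show "AE \<omega> in M. cond_exp_given M (\<lambda>\<omega>. fst (?U \<omega> i)) (\<lambda>\<omega>. \<theta> (snd (?U \<omega> i))) \<omega> = \<kappa>"
        using cond by simp
      show "integrable M (\<lambda>\<omega>. H (?Z \<omega>, fst (?U \<omega> i)))"
        using i1 by (simp add: H_def eq)
      show "integrable M (\<lambda>\<omega>. H (?Z \<omega>, fst (?U \<omega> i)) * \<theta> (snd (?U \<omega> i)))"
        using i2 by (simp add: H_def eq)
    qed
    then show ?thesis by (simp add: H_def eq)
  qed
  have off: "expectation (\<lambda>\<omega>. (W i \<omega> * W j \<omega>) * (e i \<omega> * e j \<omega>)) = 0" if i: "i \<in> I" and j: "j \<in> I" and ij: "i \<noteq> j" for i j
  proof -
    let ?N = "Pi\<^sub>M (I - {i}) (\<lambda>_. borel \<Otimes>\<^sub>M borel) :: (nat \<Rightarrow> real \<times> real) measure"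
    define h where "h x z = w x i * w x j * snd (z j)" for x and z :: "nat \<Rightarrow> real \<times> real"
    have hW: "h (\<lambda>j\<in>I. X j \<omega>) (\<lambda>j\<in>I - {i}. (X j \<omega>, e j \<omega>)) = W i \<omega> * W j \<omega> * e j \<omega>" for \<omega>
      using j ij by (simp add: h_def W_def)
    have "expectation (\<lambda>\<omega>. h (\<lambda>j\<in>I. X j \<omega>) (\<lambda>j\<in>I - {i}. (X j \<omega>, e j \<omega>)) * e i \<omega>)
      = 0 * expectation (\<lambda>\<omega>. h (\<lambda>j\<in>I. X j \<omega>) (\<lambda>j\<in>I - {i}. (X j \<omega>, e j \<omega>)))"
    proof (rule block[of i h "\<lambda>x. x" 0, OF i])
      have 1: "(\<lambda>z. z j) \<in> measurable ?N (borel \<Otimes>\<^sub>M borel)"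
        using j ij by (intro measurable_component_singleton) auto
      have 2: "(\<lambda>p. snd (snd p j)) \<in> borel_measurable (Pi\<^sub>M I (\<lambda>_. borel :: real measure) \<Otimes>\<^sub>M ?N)"
        by (rule measurable_compose[OF measurable_compose[OF measurable_snd 1] measurable_snd])
      have 3: "(\<lambda>p. w (fst p) k) \<in> borel_measurable (Pi\<^sub>M I (\<lambda>_. borel :: real measure) \<Otimes>\<^sub>M ?N)" if "k \<in> I" for k
        by (rule measurable_compose[OF measurable_fst w[OF that]])
      show "(\<lambda>(x, z). h x z) \<in> borel_measurable (Pi\<^sub>M I (\<lambda>_. borel) \<Otimes>\<^sub>M ?N)"
        unfolding h_def case_prod_beta by (intro borel_measurable_times 2 3 i j)
      show "\<exists>C. \<forall>x. \<bar>h x z\<bar> \<le> C" for z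
      proof (intro exI allI)
        show "\<bar>h x z\<bar> \<le> \<tau> * \<bar>snd (z j)\<bar>" for x
          using mult_right_mono[OF ww[OF i j, of x], of "\<bar>snd (z j)\<bar>"] by (simp add: h_def abs_mult)
      qed
      show "integrable M (\<lambda>\<omega>. h (\<lambda>j\<in>I. X j \<omega>) (\<lambda>j\<in>I - {i}. (X j \<omega>, e j \<omega>)))"
        unfolding hW by (rule bounded_mult[OF e1[OF j] i j])
      show "integrable M (\<lambda>\<omega>. h (\<lambda>j\<in>I. X j \<omega>) (\<lambda>j\<in>I - {i}. (X j \<omega>, e j \<omega>)) * e i \<omega>)"
        unfolding hW using int_term[OF i j] by (simp add: mult_ac)
    qed (use e1 e1c i in simp_all)
    then show ?thesis unfolding hW by (simp add: mult_ac)
  qed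
  have diag: "expectation (\<lambda>\<omega>. (W i \<omega> * W i \<omega>) * (e i \<omega> * e i \<omega>)) = expectation (\<lambda>\<omega>. (W i \<omega>)\<^sup>2)" if i: "i \<in> I" for i
  proof -
    let ?N = "Pi\<^sub>M (I - {i}) (\<lambda>_. borel \<Otimes>\<^sub>M borel) :: (nat \<Rightarrow> real \<times> real) measure"
    define h where "h x z = (w x i)\<^sup>2" for x and z :: "nat \<Rightarrow> real \<times> real"
    have hW: "h (\<lambda>j\<in>I. X j \<omega>) (\<lambda>j\<in>I - {i}. (X j \<omega>, e j \<omega>)) = (W i \<omega>)\<^sup>2" for \<omega>
      by (simp add: h_def W_def)
    have "expectation (\<lambda>\<omega>. h (\<lambda>j\<in>I. X j \<omega>) (\<lambda>j\<in>I - {i}. (X j \<omega>, e j \<omega>)) * (e i \<omega>)\<^sup>2)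
      = 1 * expectation (\<lambda>\<omega>. h (\<lambda>j\<in>I. X j \<omega>) (\<lambda>j\<in>I - {i}. (X j \<omega>, e j \<omega>)))"
    proof (rule block[of i h "\<lambda>x. x\<^sup>2" 1, OF i])
      have "(\<lambda>p. w (fst p) i) \<in> borel_measurable (Pi\<^sub>M I (\<lambda>_. borel :: real measure) \<Otimes>\<^sub>M ?N)"
        by (rule measurable_compose[OF measurable_fst w[OF i]])
      then show "(\<lambda>(x, z). h x z) \<in> borel_measurable (Pi\<^sub>M I (\<lambda>_. borel) \<Otimes>\<^sub>M ?N)"
        unfolding h_def case_prod_beta by simp
      show "\<exists>C. \<forall>x. \<bar>h x z\<bar> \<le> C" for z
        using w2[OF i] by (auto simp: h_def)
      show "integrable M (\<lambda>\<omega>. h (\<lambda>j\<in>I. X j \<omega>) (\<lambda>j\<in>I - {i}. (X j \<omega>, e j \<omega>)))"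
        unfolding hW using bounded_mult[OF _ i i, of "\<lambda>_. 1"] by (simp add: power2_eq_square)
      show "integrable M (\<lambda>\<omega>. h (\<lambda>j\<in>I. X j \<omega>) (\<lambda>j\<in>I - {i}. (X j \<omega>, e j \<omega>)) * (e i \<omega>)\<^sup>2)"
        unfolding hW using int_term[OF i i] by (simp add: power2_eq_square)
    qed (use e2 e2c i in simp_all)
    then show ?thesis unfolding hW by (simp add: power2_eq_square)
  qed
  have int_W2: "integrable M (\<lambda>\<omega>. (W i \<omega>)\<^sup>2)" if "i \<in> I" for i
    using bounded_mult[OF _ that that, of "\<lambda>_. 1"] by (simp add: power2_eq_square)
  have "expectation (\<lambda>\<omega>. (T \<omega>)\<^sup>2) = (\<Sum>i\<in>I. \<Sum>j\<in>I. expectation (\<lambda>\<omega>. (W i \<omega> * W j \<omega>) * (e i \<omega> * e j \<omega>)))"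
  proof -
    have "expectation (\<lambda>\<omega>. (T \<omega>)\<^sup>2) =
        (\<Sum>i\<in>I. expectation (\<lambda>\<omega>. \<Sum>j\<in>I. (W i \<omega> * W j \<omega>) * (e i \<omega> * e j \<omega>)))"
      unfolding T_eq using int_term
      by (intro Bochner_Integration.integral_sum Bochner_Integration.integrable_sum)
    also have "\<dots> = (\<Sum>i\<in>I. \<Sum>j\<in>I. expectation (\<lambda>\<omega>. (W i \<omega> * W j \<omega>) * (e i \<omega> * e j \<omega>)))"
      using int_term by (intro sum.cong refl Bochner_Integration.integral_sum)
    finally show ?thesis .
  qed
  also have "\<dots> = (\<Sum>i\<in>I. \<Sum>j\<in>I. if j = i then expectation (\<lambda>\<omega>. (W i \<omega>)\<^sup>2) else 0)"
    by (intro sum.cong refl) (auto simp: diag off)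
  also have "\<dots> = (\<Sum>i\<in>I. expectation (\<lambda>\<omega>. (W i \<omega>)\<^sup>2))"
    using fin by simp
  also have "\<dots> = expectation (\<lambda>\<omega>. \<Sum>i\<in>I. (W i \<omega>)\<^sup>2)"
    using int_W2 by (simp add: Bochner_Integration.integral_sum)
  also have "\<dots> \<le> expectation (\<lambda>\<omega>. \<tau>)"
    by (rule integral_mono) (use int_W2 bound in \<open>auto simp: W_def intro!: Bochner_Integration.integrable_sum\<close>)
  finally show "expectation (\<lambda>\<omega>. (T \<omega>)\<^sup>2) \<le> \<tau>" by (simp add: prob_space)
qed

text \<open>Weights that involve an inverse matrix need not be square integrable. Setting them to \<open>0\<close> whenever the
sum of their squares exceeds \<open>\<tau>\<close> gives bounded weights that are still functions of the design, and
changes nothing on the event in question.\<close>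

lemma (in prob_space) noise_chebyshev:
  fixes X e :: "nat \<Rightarrow> 'a \<Rightarrow> real" and w :: "(nat \<Rightarrow> real) \<Rightarrow> nat \<Rightarrow> real"
  assumes fin: "finite I"
    and indep: "indep_vars (\<lambda>_. borel \<Otimes>\<^sub>M borel) (\<lambda>i \<omega>. (X i \<omega>, e i \<omega>)) I"
    and e1: "\<And>i. i \<in> I \<Longrightarrow> integrable M (e i)"
    and e1c: "\<And>i. i \<in> I \<Longrightarrow> AE \<omega> in M. cond_exp_given M (X i) (e i) \<omega> = 0"
    and e2: "\<And>i. i \<in> I \<Longrightarrow> integrable M (\<lambda>\<omega>. (e i \<omega>)\<^sup>2)"
    and e2c: "\<And>i. i \<in> I \<Longrightarrow> AE \<omega> in M. cond_exp_given M (X i) (\<lambda>\<omega>. (e i \<omega>)\<^sup>2) \<omega> = 1"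
    and w: "\<And>i. i \<in> I \<Longrightarrow> (\<lambda>x. w x i) \<in> borel_measurable (Pi\<^sub>M I (\<lambda>_. borel))"
    and \<tau>: "0 \<le> \<tau>" and s: "0 < s"
  shows "prob {\<omega> \<in> space M. (\<Sum>i\<in>I. (w (\<lambda>j\<in>I. X j \<omega>) i)\<^sup>2) \<le> \<tau> \<and>
      s \<le> \<bar>\<Sum>i\<in>I. w (\<lambda>j\<in>I. X j \<omega>) i * e i \<omega>\<bar>} \<le> \<tau> / s\<^sup>2"
proof -
  define w' where "w' x i = (if (\<Sum>i\<in>I. (w x i)\<^sup>2) \<le> \<tau> then w x i else 0)" for x i
  define T where "T \<omega> = (\<Sum>i\<in>I. w' (\<lambda>j\<in>I. X j \<omega>) i * e i \<omega>)" for \<omega>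
  note [measurable] = w
  have w': "(\<lambda>x. w' x i) \<in> borel_measurable (Pi\<^sub>M I (\<lambda>_. borel))" if "i \<in> I" for i
    unfolding w'_def using that by measurable
  have b': "(\<Sum>i\<in>I. (w' x i)\<^sup>2) \<le> \<tau>" for x
    using \<tau> by (cases "(\<Sum>i\<in>I. (w x i)\<^sup>2) \<le> \<tau>") (simp_all add: w'_def)
  note T = truncated_noise_second_moment[OF fin indep e1 e1c e2 e2c w' b', folded T_def]
  have sub: "{\<omega> \<in> space M. (\<Sum>i\<in>I. (w (\<lambda>j\<in>I. X j \<omega>) i)\<^sup>2) \<le> \<tau> \<and>
      s \<le> \<bar>\<Sum>i\<in>I. w (\<lambda>j\<in>I. X j \<omega>) i * e i \<omega>\<bar>} \<subseteq> {\<omega> \<in> space M. s\<^sup>2 \<le> (T \<omega>)\<^sup>2}"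
  proof safe
    fix \<omega> assume *: "(\<Sum>i\<in>I. (w (\<lambda>j\<in>I. X j \<omega>) i)\<^sup>2) \<le> \<tau>"
      "s \<le> \<bar>\<Sum>i\<in>I. w (\<lambda>j\<in>I. X j \<omega>) i * e i \<omega>\<bar>"
    then have "s \<le> \<bar>T \<omega>\<bar>" by (simp add: T_def w'_def)
    then show "s\<^sup>2 \<le> (T \<omega>)\<^sup>2" using s by (metis abs_of_pos abs_le_square_iff)
  qed
  have "prob {\<omega> \<in> space M. s\<^sup>2 \<le> (T \<omega>)\<^sup>2} \<le> expectation (\<lambda>\<omega>. (T \<omega>)\<^sup>2) / s\<^sup>2"
    by (rule integral_Markov_inequality_measure[where A = "{}"]) (use T s in auto)
  also have "\<dots> \<le> \<tau> / s\<^sup>2" using T by (intro divide_right_mono) auto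
  finally have "prob {\<omega> \<in> space M. s\<^sup>2 \<le> (T \<omega>)\<^sup>2} \<le> \<tau> / s\<^sup>2" .
  moreover have "{\<omega> \<in> space M. s\<^sup>2 \<le> (T \<omega>)\<^sup>2} \<in> events"
    using borel_measurable_integrable[OF T(1)] by measurable
  ultimately show ?thesis using finite_measure_mono[OF sub] by linarith
qed

lemma (in prob_space) indep_mean_square_deviation:
  fixes Y :: "nat \<Rightarrow> 'a \<Rightarrow> real"
  assumes n: "1 \<le> n" and indep: "indep_vars (\<lambda>_. borel) Y {1..n}"
    and int2: "\<And>i. i \<in> {1..n} \<Longrightarrow> integrable M (\<lambda>\<omega>. (Y i \<omega>)\<^sup>2)"
    and mean: "\<And>i. i \<in> {1..n} \<Longrightarrow> expectation (Y i) = \<mu>"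
    and second: "\<And>i. i \<in> {1..n} \<Longrightarrow> expectation (\<lambda>\<omega>. (Y i \<omega>)\<^sup>2) \<le> v"
  shows "integrable M (\<lambda>\<omega>. (1 / real n * (\<Sum>i=1..n. Y i \<omega>) - \<mu>)\<^sup>2)"
    "expectation (\<lambda>\<omega>. (1 / real n * (\<Sum>i=1..n. Y i \<omega>) - \<mu>)\<^sup>2) \<le> v / real n"
proof -
  let ?I = "{1..n}"
  define R where "R i \<omega> = Y i \<omega> - \<mu>" for i \<omega>
  have Ym[measurable]: "Y i \<in> borel_measurable M" if "i \<in> ?I" for i
    using indep that by (simp add: indep_vars_def)
  have intY: "integrable M (Y i)" if "i \<in> ?I" for i
    by (rule square_integrable_imp_integrable[OF Ym int2]) (use that in auto)
  have intR: "integrable M (R i)" if "i \<in> ?I" for i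
    unfolding R_def using intY[OF that] by simp
  have R2: "(R i \<omega>)\<^sup>2 = (Y i \<omega>)\<^sup>2 - 2 * \<mu> * Y i \<omega> + \<mu>\<^sup>2" for i \<omega>
    by (simp add: R_def power2_eq_square algebra_simps)
  have intR2: "integrable M (\<lambda>\<omega>. (R i \<omega>)\<^sup>2)" if "i \<in> ?I" for i
    unfolding R2 using intY[OF that] int2[OF that] by simp
  have R2v: "expectation (\<lambda>\<omega>. (R i \<omega>)\<^sup>2) \<le> v" if "i \<in> ?I" for i
  proof -
    have "expectation (\<lambda>\<omega>. (R i \<omega>)\<^sup>2) = expectation (\<lambda>\<omega>. (Y i \<omega>)\<^sup>2) - \<mu>\<^sup>2"
      unfolding R2 using intY[OF that] int2[OF that] mean[OF that]
      by (simp add: prob_space power2_eq_square)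
    then show ?thesis using second[OF that] by (smt (verit) zero_le_power2)
  qed
  have R0: "expectation (R i) = 0" if "i \<in> ?I" for i
    unfolding R_def using intY[OF that] mean[OF that] by (simp add: prob_space)
  have indepR: "indep_vars (\<lambda>_. borel) R ?I"
    unfolding R_def[abs_def] by (rule indep_vars_compose2[OF indep]) simp
  have cross: "integrable M (\<lambda>\<omega>. R i \<omega> * R j \<omega>) \<and> expectation (\<lambda>\<omega>. R i \<omega> * R j \<omega>) = 0"
    if ij: "i \<in> ?I" "j \<in> ?I" "i \<noteq> j" for i j
  proof -
    have iv: "indep_vars (\<lambda>_. borel) R {i, j}" by (rule indep_vars_subset[OF indepR]) (use ij in auto)
    have "integrable M (\<lambda>\<omega>. \<Prod>k\<in>{i, j}. R k \<omega>)"
      by (rule indep_vars_integrable[OF _ iv]) (use intR ij in auto)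
    moreover have "expectation (\<lambda>\<omega>. \<Prod>k\<in>{i, j}. R k \<omega>) = (\<Prod>k\<in>{i, j}. expectation (R k))"
      by (rule indep_vars_lebesgue_integral[OF _ iv]) (use intR ij in auto)
    ultimately show ?thesis using ij R0 by simp
  qed
  have int_all: "integrable M (\<lambda>\<omega>. R i \<omega> * R j \<omega>)" if "i \<in> ?I" "j \<in> ?I" for i j
    using cross[OF that] intR2[OF that(1)] by (cases "i = j") (auto simp: power2_eq_square)
  have eq: "(1 / real n * (\<Sum>i=1..n. Y i \<omega>) - \<mu>)\<^sup>2 = (1 / real n)\<^sup>2 * (\<Sum>i\<in>?I. \<Sum>j\<in>?I. R i \<omega> * R j \<omega>)" for \<omega>
  proof -
    have "1 / real n * (\<Sum>i=1..n. Y i \<omega>) - \<mu> = 1 / real n * (\<Sum>i\<in>?I. R i \<omega>)"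
      using n by (simp add: R_def sum_subtractf field_simps)
    then show ?thesis by (simp only: power_mult_distrib) (simp add: power2_eq_square sum_product)
  qed
  show "integrable M (\<lambda>\<omega>. (1 / real n * (\<Sum>i=1..n. Y i \<omega>) - \<mu>)\<^sup>2)"
    unfolding eq using int_all by (intro integrable_mult_right Bochner_Integration.integrable_sum) auto
  have "expectation (\<lambda>\<omega>. (1 / real n * (\<Sum>i=1..n. Y i \<omega>) - \<mu>)\<^sup>2) =
      (1 / real n)\<^sup>2 * (\<Sum>i\<in>?I. \<Sum>j\<in>?I. expectation (\<lambda>\<omega>. R i \<omega> * R j \<omega>))"
  proof -
    have "expectation (\<lambda>\<omega>. \<Sum>i\<in>?I. \<Sum>j\<in>?I. R i \<omega> * R j \<omega>) =
        (\<Sum>i\<in>?I. expectation (\<lambda>\<omega>. \<Sum>j\<in>?I. R i \<omega> * R j \<omega>))"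
      using int_all by (intro Bochner_Integration.integral_sum Bochner_Integration.integrable_sum)
    also have "\<dots> = (\<Sum>i\<in>?I. \<Sum>j\<in>?I. expectation (\<lambda>\<omega>. R i \<omega> * R j \<omega>))"
      using int_all by (intro sum.cong refl Bochner_Integration.integral_sum)
    finally show ?thesis unfolding eq by simp
  qed
  also have "(\<Sum>i\<in>?I. \<Sum>j\<in>?I. expectation (\<lambda>\<omega>. R i \<omega> * R j \<omega>)) =
      (\<Sum>i\<in>?I. \<Sum>j\<in>?I. if j = i then expectation (\<lambda>\<omega>. (R i \<omega>)\<^sup>2) else 0)"
    by (intro sum.cong refl) (auto simp: cross power2_eq_square)
  also have "\<dots> = (\<Sum>i\<in>?I. expectation (\<lambda>\<omega>. (R i \<omega>)\<^sup>2))" by simp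
  also have "(1 / real n)\<^sup>2 * \<dots> \<le> (1 / real n)\<^sup>2 * (\<Sum>i\<in>?I. v)"
    by (intro mult_left_mono sum_mono R2v) auto
  also have "\<dots> = v / real n" using n by (simp add: power2_eq_square)
  finally show "expectation (\<lambda>\<omega>. (1 / real n * (\<Sum>i=1..n. Y i \<omega>) - \<mu>)\<^sup>2) \<le> v / real n" .
qed

section \<open>Measurability of the sieve weights\<close>

lemma borel_measurable_det:
  assumes "\<And>i j. i < K \<Longrightarrow> j < K \<Longrightarrow> (\<lambda>x. G x i j) \<in> borel_measurable N"
  shows "(\<lambda>x. det (mat K K (\<lambda>(i, j). G x i j :: real))) \<in> borel_measurable N"
proof -
  have "det (mat K K (\<lambda>(i, j). G x i j)) =
      (\<Sum>p\<in>{p. p permutes {0..<K}}. signof p * (\<Prod>i = 0..<K. G x i (p i)))" for x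
    by (subst det_def'[of _ K]) (auto intro!: sum.cong prod.cong simp: permutes_in_image
        dest: permutes_in_image[of _ "{0..<K}"])
  moreover have "(\<lambda>x. \<Sum>p\<in>{p. p permutes {0..<K}}. signof p * (\<Prod>i = 0..<K. G x i (p i))) \<in> borel_measurable N"
    using assms by (intro borel_measurable_sum borel_measurable_times borel_measurable_const
        borel_measurable_prod) (auto dest: permutes_in_image)
  ultimately show ?thesis by simp
qed

lemma borel_measurable_mat_inv_entry:
  assumes G: "\<And>i j. i < K \<Longrightarrow> j < K \<Longrightarrow> (\<lambda>x. G x i j) \<in> borel_measurable N"
    and k: "k < K" and l: "l < K"
  shows "(\<lambda>x. mat_inv (mat K K (\<lambda>(i, j). G x i j)) $$ (k, l)) \<in> borel_measurable N"
proof -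
  let ?A = "\<lambda>x. mat K K (\<lambda>(i, j). G x i j)"
  have del: "mat_delete (?A x) l k = mat (K - 1) (K - 1)
      (\<lambda>(i, j). G x (if i < l then i else Suc i) (if j < k then j else Suc j))" for x
    unfolding mat_delete_def by (rule eq_matI) auto
  have "adj_mat (?A x) $$ (k, l) = (-1) ^ (l + k) * det (mat_delete (?A x) l k)" for x
    using k l by (simp add: adj_mat_def cofactor_def)
  then have eq: "mat_inv (?A x) $$ (k, l) = (-1) ^ (l + k) * det (mat_delete (?A x) l k) / det (?A x)" for x
    using mat_inv_entry[of "?A x" K, OF _ k l] by simp
  have "(\<lambda>x. det (mat_delete (?A x) l k)) \<in> borel_measurable N"
    unfolding del by (rule borel_measurable_det) (use G in auto)
  moreover have "(\<lambda>x. det (?A x)) \<in> borel_measurable N"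
    by (rule borel_measurable_det) (rule G)
  ultimately show ?thesis unfolding eq by simp
qed

lemma mat_inv_carrier: "A \<in> carrier_mat K K \<Longrightarrow> mat_inv A \<in> carrier_mat K K"
  using mat_inverse(2)[of A K] by (auto simp: mat_inv_def split: option.split)

text \<open>The entries of the empirical Gram matrix of a family \<open>\<phi>\<close> indexed from \<open>0\<close>.\<close>

definition emp_inner :: "(nat \<Rightarrow> real \<Rightarrow> real) \<Rightarrow> nat \<Rightarrow> (nat \<Rightarrow> real) \<Rightarrow> nat \<Rightarrow> nat \<Rightarrow> real" where
  "emp_inner \<phi> n x k l = 1 / real n * (\<Sum>i=1..n. \<phi> k (x i) * \<phi> l (x i))"

lemma emp_gram_eq: "emp_gram B K n x = mat K K (\<lambda>(k, l). emp_inner (\<lambda>k. B K (Suc k)) n x k l)"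
  by (simp add: emp_gram_def emp_inner_def)

lemma emp_inner_commute: "emp_inner \<phi> n x k l = emp_inner \<phi> n x l k"
  by (simp add: emp_inner_def mult.commute)

text \<open>The quadratic form of the empirical Gram matrix is the empirical mean square of a sieve function.\<close>

lemma bil_emp_inner:
  "bil K (emp_inner \<phi> n x) c d =
    1 / real n * (\<Sum>i=1..n. (\<Sum>k<K. c k * \<phi> k (x i)) * (\<Sum>l<K. d l * \<phi> l (x i)))"
proof -
  have "bil K (emp_inner \<phi> n x) c d =
      1 / real n * (\<Sum>k<K. \<Sum>l<K. \<Sum>i=1..n. c k * \<phi> k (x i) * (d l * \<phi> l (x i)))"
    by (simp add: bil_def emp_inner_def sum_distrib_left mult_ac)
  also have "(\<Sum>k<K. \<Sum>l<K. \<Sum>i=1..n. c k * \<phi> k (x i) * (d l * \<phi> l (x i))) =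
      (\<Sum>k<K. \<Sum>i=1..n. \<Sum>l<K. c k * \<phi> k (x i) * (d l * \<phi> l (x i)))"
    by (intro sum.cong refl sum.swap)
  also have "\<dots> = (\<Sum>i=1..n. \<Sum>k<K. \<Sum>l<K. c k * \<phi> k (x i) * (d l * \<phi> l (x i)))"
    by (rule sum.swap)
  finally show ?thesis by (simp add: sum_product)
qed

lemma sieve_weight_eq:
  "sieve_weight B K n x i = 1 / real n *
    (\<Sum>k<K. \<Sum>l<K. B K (Suc k) 0 * mat_inv (emp_gram B K n x) $$ (k, l) * B K (Suc l) (x i))"
proof -
  have "mat_inv (emp_gram B K n x) \<in> carrier_mat K K"
    by (rule mat_inv_carrier) (simp add: emp_gram_def)
  then show ?thesis
    by (simp add: sieve_weight_def basis_vec_def scalar_prod_def lessThan_atLeast0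
        sum_distrib_left mult_ac)
qed

lemma borel_measurable_sieve_weight:
  assumes B: "\<And>k. k \<in> {1..K} \<Longrightarrow> B K k \<in> borel_measurable borel" and i: "i \<in> {1..n}"
  shows "(\<lambda>x. sieve_weight B K n x i) \<in> borel_measurable (Pi\<^sub>M {1..n} (\<lambda>_. borel))"
proof -
  let ?P = "Pi\<^sub>M {1..n} (\<lambda>_. borel :: real measure)"
  have Bx: "(\<lambda>x. B K (Suc k) (x j)) \<in> borel_measurable ?P" if "k < K" "j \<in> {1..n}" for k j
    using measurable_component_singleton[of j "{1..n}" "\<lambda>_. borel"] B[of "Suc k"] that
    by (auto intro: measurable_compose)
  have "(\<lambda>x. emp_inner (\<lambda>k. B K (Suc k)) n x k l) \<in> borel_measurable ?P" if "k < K" "l < K" for k l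
    unfolding emp_inner_def using that by (intro borel_measurable_times borel_measurable_const
      borel_measurable_sum Bx) auto
  then have "(\<lambda>x. mat_inv (emp_gram B K n x) $$ (k, l)) \<in> borel_measurable ?P" if "k < K" "l < K" for k l
    unfolding emp_gram_eq using that by (intro borel_measurable_mat_inv_entry) auto
  then show ?thesis
    unfolding sieve_weight_eq using i
    by (intro borel_measurable_times borel_measurable_const borel_measurable_sum Bx) auto
qed

section \<open>Sieve weights at a well-conditioned design\<close>

text \<open>A design at which the empirical Gram matrix is well conditioned. Indices refer to the basis functions
\<open>B K (Suc k)\<close> with \<open>k < K\<close>, and \<open>k0\<close> is an index around which the basis functions that do not vanish at
\<open>0\<close> are clustered.\<close>

locale regular_design =
  fixes B :: sieve and K n :: nat and x :: "nat \<Rightarrow> real" and q p :: real and N k0 :: nat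
  assumes n: "1 \<le> n" and q: "0 < q" and p: "0 < p" and N: "0 < N"
    and lower: "\<And>c. q * (\<Sum>k<K. (c k)\<^sup>2) \<le> bil K (emp_inner (\<lambda>k. B K (Suc k)) n x) c c"
    and upper: "\<And>c. bil K (emp_inner (\<lambda>k. B K (Suc k)) n x) c c \<le> p * (\<Sum>k<K. (c k)\<^sup>2)"
    and band: "\<And>k l i. k < K \<Longrightarrow> l < K \<Longrightarrow> N \<le> ndist k l \<Longrightarrow> i \<in> {1..n} \<Longrightarrow>
        B K (Suc k) (x i) * B K (Suc l) (x i) = 0"
    and local_at_0: "\<And>k. k < K \<Longrightarrow> N \<le> ndist k k0 \<Longrightarrow> B K (Suc k) 0 = 0"
begin

abbreviation \<phi> :: "nat \<Rightarrow> real \<Rightarrow> real" where "\<phi> k \<equiv> B K (Suc k)"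
abbreviation W :: "nat \<Rightarrow> real" where "W i \<equiv> sieve_weight B K n x i"
abbreviation A :: "nat \<Rightarrow> nat \<Rightarrow> real" where "A \<equiv> emp_inner \<phi> n x"
definition \<beta> :: real where "\<beta> = (\<Sum>k<K. (\<phi> k 0)\<^sup>2)"

text \<open>The solution \<open>v\<close> of the normal equations with right-hand side \<open>b(0)\<close>, written as a row vector times the
inverse because the weights have this form.\<close>

definition dual :: "nat \<Rightarrow> real" where
  "dual l = (\<Sum>k<K. \<phi> k 0 * mat_inv (emp_gram B K n x) $$ (k, l))"

lemma weight_eq: "W i = 1 / real n * (\<Sum>l<K. dual l * \<phi> l (x i))"
  unfolding sieve_weight_eq dual_def sum_distrib_right by (subst sum.swap) simp

lemma normal_equation:
  assumes k: "k < K"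
  shows "(\<Sum>l<K. A k l * dual l) = \<phi> k 0"
proof -
  let ?G = "emp_gram B K n x"
  have G: "?G \<in> carrier_mat K K" by (simp add: emp_gram_def)
  have "det ?G \<noteq> 0"
    unfolding emp_gram_eq by (rule coercive_imp_det_nonzero[OF q lower])
  note inv = det_nonzero_mat_inv[OF G this]
  define J where "J i j = mat_inv ?G $$ (i, j)" for i j
  have J: "(\<Sum>l<K. J i l * A l k) = (if i = k then 1 else 0)" if "i < K" for i
  proof -
    have "(\<Sum>l<K. J i l * A l k) = (mat_inv ?G * ?G) $$ (i, k)"
      using that k inv(1) G by (simp add: J_def emp_gram_eq scalar_prod_def lessThan_atLeast0)
    then show ?thesis using that k inv(2) by simp
  qed
  have "(\<Sum>l<K. A k l * dual l) = (\<Sum>l<K. \<Sum>i<K. \<phi> i 0 * (J i l * A l k))"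
    by (simp add: dual_def J_def sum_distrib_left mult_ac emp_inner_commute[of _ n x k])
  also have "\<dots> = (\<Sum>i<K. \<phi> i 0 * (\<Sum>l<K. J i l * A l k))"
    by (subst sum.swap) (simp add: sum_distrib_left)
  also have "\<dots> = (\<Sum>i<K. if i = k then \<phi> k 0 else 0)"
    by (intro sum.cong refl) (auto simp: J)
  also have "\<dots> = \<phi> k 0" using k by simp
  finally show ?thesis .
qed

text \<open>The weighted sum is the empirical inner product of the sieve function with \<open>v\<^sup>T b\<close>, and the normal
equations say that this inner product is evaluation at \<open>0\<close>.\<close>

lemma reproducing: "(\<Sum>i=1..n. W i * (\<Sum>k<K. c k * \<phi> k (x i))) = (\<Sum>k<K. c k * \<phi> k 0)"
proof -
  have "(\<Sum>i=1..n. W i * (\<Sum>k<K. c k * \<phi> k (x i))) =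
      (\<Sum>i=1..n. 1 / real n * ((\<Sum>k<K. c k * \<phi> k (x i)) * (\<Sum>l<K. dual l * \<phi> l (x i))))"
    by (intro sum.cong refl) (simp add: weight_eq)
  also have "\<dots> = bil K A c dual"
    unfolding bil_emp_inner by (rule sum_distrib_left[symmetric])
  also have "\<dots> = (\<Sum>k<K. c k * \<phi> k 0)"
    unfolding bil_eq_sum_apply by (intro sum.cong refl) (simp add: normal_equation)
  finally show ?thesis .
qed

lemma psd: "0 \<le> bil K A c c"
  unfolding bil_emp_inner by (intro mult_nonneg_nonneg sum_nonneg zero_le_square) simp

lemma sum_weight_sq: "(\<Sum>i=1..n. (W i)\<^sup>2) = bil K A dual dual / real n"
  by (simp add: weight_eq bil_emp_inner power2_eq_square sum_distrib_left sum_distrib_right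
      sum_divide_distrib mult_ac)

lemma \<beta>_nonneg: "0 \<le> \<beta>"
  by (simp add: \<beta>_def sum_nonneg)

lemma sum_weight_sq_upper: "(\<Sum>i=1..n. (W i)\<^sup>2) \<le> p * \<beta> / (q\<^sup>2 * real n)"
proof -
  have "q\<^sup>2 * (\<Sum>k<K. (dual k)\<^sup>2) \<le> \<beta>"
    unfolding \<beta>_def by (rule coercive_solution_bound[OF lower q normal_equation])
  then have "(\<Sum>k<K. (dual k)\<^sup>2) \<le> \<beta> / q\<^sup>2" using q by (simp add: field_simps)
  from mult_left_mono[OF this, of p] have "bil K A dual dual \<le> p * (\<beta> / q\<^sup>2)"
    using upper[of dual] p by simp
  from divide_right_mono[OF this, of "real n"] show ?thesis
    unfolding sum_weight_sq by simp
qed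

text \<open>Cauchy-Schwarz for the empirical form, applied to \<open>b(0)\<^sup>T b(0) = b(0)\<^sup>T Q v\<close>.\<close>

lemma sum_weight_sq_lower: "\<beta> / (p * real n) \<le> (\<Sum>i=1..n. (W i)\<^sup>2)"
proof -
  let ?b = "\<lambda>k. \<phi> k 0"
  have "\<beta> = bil K A ?b dual"
    unfolding bil_eq_sum_apply \<beta>_def by (intro sum.cong refl) (simp add: normal_equation power2_eq_square)
  then have "\<beta>\<^sup>2 \<le> bil K A ?b ?b * bil K A dual dual"
    using bil_Cauchy_Schwarz[where c = ?b and d = dual, OF emp_inner_commute psd] by simp
  also have "\<dots> \<le> (p * \<beta>) * bil K A dual dual"
    by (rule mult_right_mono[OF _ psd]) (use upper[of ?b] in \<open>simp add: \<beta>_def\<close>)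
  finally have "\<beta> * \<beta> \<le> \<beta> * (p * bil K A dual dual)" by (simp add: power2_eq_square mult_ac)
  then have "\<beta> \<le> p * bil K A dual dual"
    using \<beta>_nonneg psd[of dual] p by (cases "\<beta> = 0") auto
  then show ?thesis unfolding sum_weight_sq using p n by (simp add: field_simps)
qed

text \<open>Here the decay of the dual vector pays off: each basis function enters only with its empirical
absolute mean, of order \<open>K\<^bsup>-1/2\<^esup>\<close>, and the geometric factors are summable.\<close>

lemma sum_abs_weight:
  "(\<Sum>i=1..n. \<bar>W i\<bar>) \<le> sqrt \<beta> / q *
    (\<Sum>k<K. sqrt (p / (p + q)) ^ (ndist k k0 div N) * (1 / real n * (\<Sum>i=1..n. \<bar>\<phi> k (x i)\<bar>)))"
proof -
  let ?r = "\<lambda>k. sqrt (p / (p + q)) ^ (ndist k k0 div N)"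
  have bandA: "A k l = 0" if "k < K" "l < K" "N \<le> ndist k l" for k l
    unfolding emp_inner_def using band[OF that] by (simp add: sum.neutral)
  have v: "\<bar>dual k\<bar> \<le> ?r k * (sqrt \<beta> / q)" if "k < K" for k
    unfolding \<beta>_def
    by (rule band_solution_decay[where A = A, OF emp_inner_commute lower upper q p bandA normal_equation
          local_at_0 that])
  have "(\<Sum>i=1..n. \<bar>W i\<bar>) \<le> (\<Sum>i=1..n. \<Sum>k<K. 1 / real n * (\<bar>dual k\<bar> * \<bar>\<phi> k (x i)\<bar>))"
  proof (rule sum_mono)
    fix i
    have "\<bar>W i\<bar> = 1 / real n * \<bar>\<Sum>l<K. dual l * \<phi> l (x i)\<bar>" by (simp add: weight_eq abs_mult)
    also have "\<dots> \<le> 1 / real n * (\<Sum>l<K. \<bar>dual l * \<phi> l (x i)\<bar>)"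
      by (intro mult_left_mono sum_abs) simp
    finally show "\<bar>W i\<bar> \<le> (\<Sum>k<K. 1 / real n * (\<bar>dual k\<bar> * \<bar>\<phi> k (x i)\<bar>))"
      by (simp add: sum_distrib_left abs_mult)
  qed
  also have "\<dots> = (\<Sum>k<K. \<bar>dual k\<bar> * (1 / real n * (\<Sum>i=1..n. \<bar>\<phi> k (x i)\<bar>)))"
    by (subst sum.swap) (simp add: sum_distrib_left mult_ac)
  also have "\<dots> \<le> (\<Sum>k<K. ?r k * (sqrt \<beta> / q) * (1 / real n * (\<Sum>i=1..n. \<bar>\<phi> k (x i)\<bar>)))"
    by (intro sum_mono mult_right_mono v mult_nonneg_nonneg sum_nonneg) auto
  also have "\<dots> = sqrt \<beta> / q * (\<Sum>k<K. ?r k * (1 / real n * (\<Sum>i=1..n. \<bar>\<phi> k (x i)\<bar>)))"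
    unfolding sum_distrib_left[of "sqrt \<beta> / q"] by (intro sum.cong refl) (simp only: mult_ac)
  finally show ?thesis .
qed

text \<open>The weights integrate the sieve approximation exactly, so only the approximation error is
propagated, with the sum of the absolute weights as amplification factor.\<close>

lemma bias_bound:
  assumes "\<And>y. y \<in> insert 0 (x ` {1..n}) \<Longrightarrow> \<bar>(\<Sum>k<K. c k * \<phi> k y) - f y\<bar> \<le> \<delta>"
  shows "\<bar>(\<Sum>i=1..n. W i * f (x i)) - f 0\<bar> \<le> \<delta> * (1 + (\<Sum>i=1..n. \<bar>W i\<bar>))"
proof -
  define g where "g y = (\<Sum>k<K. c k * \<phi> k y)" for y
  have "(\<Sum>i=1..n. W i * f (x i)) - f 0 = (g 0 - f 0) - (\<Sum>i=1..n. W i * (g (x i) - f (x i)))"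
    using reproducing[of c] by (simp add: g_def algebra_simps sum_subtractf)
  also have "\<bar>\<dots>\<bar> \<le> \<bar>g 0 - f 0\<bar> + (\<Sum>i=1..n. \<bar>W i * (g (x i) - f (x i))\<bar>)"
    by (rule order_trans[OF abs_triangle_ineq4 add_left_mono[OF sum_abs]])
  also have "\<dots> \<le> \<delta> + (\<Sum>i=1..n. \<bar>W i\<bar> * \<delta>)"
    using assms by (intro add_mono sum_mono) (auto simp: g_def abs_mult intro!: mult_left_mono)
  also have "\<dots> = \<delta> * (1 + (\<Sum>i=1..n. \<bar>W i\<bar>))" by (simp add: algebra_simps sum_distrib_left)
  finally show ?thesis .
qed

text \<open>Read backwards, this is a lower bound on the absolute weights as soon as \<open>f\<close> does not vanish at \<open>0\<close>.
It excludes bases that degenerate at the point of interest.\<close>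

lemma value_at_0_bound:
  assumes approx: "\<And>y. y \<in> insert 0 (x ` {1..n}) \<Longrightarrow> \<bar>(\<Sum>k<K. c k * \<phi> k y) - f y\<bar> \<le> \<delta>"
    and R: "\<And>y. y \<in> x ` {1..n} \<Longrightarrow> \<bar>f y\<bar> \<le> R"
  shows "\<bar>f 0\<bar> \<le> \<delta> + (R + \<delta>) * (\<Sum>i=1..n. \<bar>W i\<bar>)"
proof -
  define g where "g y = (\<Sum>k<K. c k * \<phi> k y)" for y
  have "\<bar>g 0\<bar> = \<bar>\<Sum>i=1..n. W i * g (x i)\<bar>" using reproducing[of c] by (simp add: g_def)
  also have "\<dots> \<le> (\<Sum>i=1..n. \<bar>W i * g (x i)\<bar>)" by (rule sum_abs)
  also have "\<dots> \<le> (\<Sum>i=1..n. \<bar>W i\<bar> * (R + \<delta>))"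
  proof (rule sum_mono)
    fix i assume "i \<in> {1..n}"
    then have "\<bar>g (x i)\<bar> \<le> R + \<delta>"
      using approx[of "x i"] R[of "x i"] by (auto simp: g_def)
    then show "\<bar>W i * g (x i)\<bar> \<le> \<bar>W i\<bar> * (R + \<delta>)" by (simp add: abs_mult mult_left_mono)
  qed
  also have "\<dots> = (R + \<delta>) * (\<Sum>i=1..n. \<bar>W i\<bar>)" by (simp add: sum_distrib_left mult.commute)
  finally show ?thesis using approx[of 0] by (simp add: g_def abs_le_iff)
qed

end

section \<open>Pointwise forms of the sieve conditions\<close>

text \<open>The infimum over the sieve space need not be attained; the factor \<open>2\<close> makes room for an approximant.\<close>

lemma sieve_approx_pointwise:
  assumes approx: "sieve_approx a b B F S CS" and CS: "0 < CS" and f: "f \<in> F" and K: "1 \<le> K"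
  obtains c where "\<And>x. x \<in> {a..b} \<Longrightarrow>
    \<bar>(\<Sum>k<K. c k * B K (Suc k) x) - f x\<bar> \<le> 2 * CS * real K powr (- S)"
proof -
  let ?d = "CS * real K powr (- S)"
  have d: "0 < ?d" using CS K by simp
  have "(INF g\<in>sieve_space B K. sup_norm_on {a..b} (\<lambda>x. g x - f x)) \<le> ennreal ?d"
  proof -
    have "(INF g\<in>sieve_space B K. sup_norm_on {a..b} (\<lambda>x. g x - f x)) \<le>
        (SUP f\<in>F. INF g\<in>sieve_space B K. sup_norm_on {a..b} (\<lambda>x. g x - f x))"
      using f by (rule SUP_upper)
    also have "\<dots> \<le> ennreal ?d" using approx K unfolding sieve_approx_def by blast
    finally show ?thesis .
  qed
  also have "\<dots> < ennreal (2 * ?d)" using d by (intro ennreal_lessI) auto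
  finally obtain g where g: "g \<in> sieve_space B K" "sup_norm_on {a..b} (\<lambda>x. g x - f x) < ennreal (2 * ?d)"
    by (auto simp: INF_less_iff)
  then obtain c where c: "g = (\<lambda>x. \<Sum>k=1..K. c k * B K k x)" by (auto simp: sieve_space_def)
  have shift: "(\<Sum>k<K. c (Suc k) * B K (Suc k) x) = g x" for x
    unfolding c by (rule sum.reindex_bij_witness[of _ "\<lambda>k. k - 1" Suc]) auto
  show thesis
  proof (rule that[of "\<lambda>k. c (Suc k)"])
    fix x assume x: "x \<in> {a..b}"
    have "ennreal \<bar>g x - f x\<bar> \<le> sup_norm_on {a..b} (\<lambda>x. g x - f x)"
      unfolding sup_norm_on_def using x by (rule SUP_upper)
    also note g(2)
    finally have "\<bar>g x - f x\<bar> \<le> 2 * ?d"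
      using d by (simp add: ennreal_less_iff)
    then show "\<bar>(\<Sum>k<K. c (Suc k) * B K (Suc k) x) - f x\<bar> \<le> 2 * CS * real K powr (- S)"
      unfolding shift by simp
  qed
qed

lemma sup_norm_on_le_imp_abs_le:
  assumes "sup_norm_on A f \<le> ennreal (C * r)" and "x \<in> A" and "0 \<le> r"
  shows "\<bar>f x\<bar> \<le> \<bar>C\<bar> * r"
proof -
  have "ennreal \<bar>f x\<bar> \<le> sup_norm_on A f"
    unfolding sup_norm_on_def using assms(2) by (rule SUP_upper)
  also note assms(1)
  also have "ennreal (C * r) \<le> ennreal (\<bar>C\<bar> * r)"
    using assms(3) by (intro ennreal_leI mult_right_mono) auto
  finally show ?thesis using assms(3) by (simp add: ennreal_le_iff)
qed

text \<open>The basis functions are measurable on the design interval only. Extending them by \<open>0\<close> gives Borel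
functions on the line that satisfy the uniform bounds everywhere, and changes nothing
observable, since the design and the point \<open>0\<close> lie in the interval.\<close>

definition clip_sieve :: "real \<Rightarrow> real \<Rightarrow> sieve \<Rightarrow> sieve" where
  "clip_sieve a b B = (\<lambda>K k x. if x \<in> {a..b} then B K k x else 0)"

lemma clip_sieve_eq: "x \<in> {a..b} \<Longrightarrow> clip_sieve a b B K k x = B K k x"
  by (simp add: clip_sieve_def)

lemma borel_measurable_clip_sieve:
  assumes "B K k \<in> borel_measurable (restrict_space borel {a..b})"
  shows "clip_sieve a b B K k \<in> borel_measurable borel"
proof -
  have "(\<lambda>x. indicator {a..b} x *\<^sub>R B K k x) \<in> borel_measurable borel"
    using assms by (subst (asm) borel_measurable_restrict_space_iff) auto
  also have "(\<lambda>x. indicator {a..b} x *\<^sub>R B K k x) = clip_sieve a b B K k"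
    by (auto simp: clip_sieve_def fun_eq_iff indicator_def)
  finally show ?thesis .
qed

lemma design_exp_cong:
  assumes "\<And>x. x \<in> {a..b} \<Longrightarrow> h x = g x"
  shows "design_exp a b f h = design_exp a b f g"
  unfolding design_exp_def set_lebesgue_integral_def
  by (intro Bochner_Integration.integral_cong refl) (simp add: indicator_def assms)

lemma sieve_conf_int_clip:
  assumes "\<And>i. i \<in> {1..n} \<Longrightarrow> X i \<omega> \<in> {a..b}" and "0 \<in> {a..b}"
  shows "sieve_conf_int (clip_sieve a b B) K S \<alpha> d Vhat n X Y \<omega> = sieve_conf_int B K S \<alpha> d Vhat n X Y \<omega>"
proof -
  have "emp_gram (clip_sieve a b B) K n (\<lambda>i. X i \<omega>) = emp_gram B K n (\<lambda>i. X i \<omega>)"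
    unfolding emp_gram_def by (intro cong_mat refl) (use assms(1) in \<open>auto intro!: sum.cong simp: clip_sieve_def\<close>)
  moreover have "basis_vec (clip_sieve a b B) K y = basis_vec B K y" if "y \<in> {a..b}" for y
    unfolding basis_vec_def using that by (simp add: clip_sieve_eq)
  ultimately have "sieve_weight (clip_sieve a b B) K n (\<lambda>i. X i \<omega>) i = sieve_weight B K n (\<lambda>i. X i \<omega>) i"
    if "i \<in> {1..n}" for i
    unfolding sieve_weight_def using assms that by simp
  then show ?thesis
    unfolding sieve_conf_int_def sieve_est_def sieve_CW_def by simp
qed

lemma expectation_eq_design_exp:
  assumes X: "distributed M lborel X (\<lambda>x. ennreal (indicator {a..b} x * f x))"
    and f: "\<And>x. x \<in> {a..b} \<Longrightarrow> 0 \<le> f x"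
    and h: "h \<in> borel_measurable borel"
  shows "(\<integral>\<omega>. h (X \<omega>) \<partial>M) = design_exp a b f h"
proof -
  have "(\<integral>\<omega>. h (X \<omega>) \<partial>M) = (\<integral>x. indicator {a..b} x * f x * h x \<partial>lborel)"
    by (rule distributed_integral[OF X, symmetric]) (use h f in \<open>auto simp: indicator_def\<close>)
  then show ?thesis
    by (simp add: design_exp_def set_lebesgue_integral_def mult_ac)
qed

section \<open>Concentration of the design\<close>

text \<open>Each entry has variance at most \<open>E[\<phi>\<^sub>k\<^sup>2 \<phi>\<^sub>l\<^sup>2] / n\<close>. Summing over all entries before estimating gives
\<open>E[(\<Sum>\<^sub>k \<phi>\<^sub>k\<^sup>2)\<^sup>2]\<close>, and one of the two factors is bounded pointwise. With \<open>\<beta>\<close> of order \<open>K\<close> the total is of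
order \<open>K\<^sup>2/n\<close>, whereas bounding the \<open>K\<^sup>2\<close> entries one by one would lose another factor \<open>K\<close>. The
functional \<open>D\<close> stands for the common expectation of functions of the covariates.\<close>

lemma (in prob_space) gram_concentration:
  fixes X :: "nat \<Rightarrow> 'a \<Rightarrow> real" and \<phi> :: "nat \<Rightarrow> real \<Rightarrow> real" and D :: "(real \<Rightarrow> real) \<Rightarrow> real"
  assumes n: "1 \<le> n" and indep: "indep_vars (\<lambda>_. borel) X {1..n}"
    and \<phi>: "\<And>k. k < K \<Longrightarrow> \<phi> k \<in> borel_measurable borel"
    and D: "\<And>i h. i \<in> {1..n} \<Longrightarrow> h \<in> borel_measurable borel \<Longrightarrow> expectation (\<lambda>\<omega>. h (X i \<omega>)) = D h"
    and bound: "\<And>y. (\<Sum>k<K. (\<phi> k y)\<^sup>2) \<le> \<beta>"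
    and second: "\<And>k. k < K \<Longrightarrow> D (\<lambda>y. (\<phi> k y)\<^sup>2) \<le> C2"
    and \<delta>: "0 < \<delta>"
  shows "prob {\<omega> \<in> space M. \<delta>\<^sup>2 \<le>
      (\<Sum>k<K. \<Sum>l<K. (emp_inner \<phi> n (\<lambda>i. X i \<omega>) k l - D (\<lambda>y. \<phi> k y * \<phi> l y))\<^sup>2)}
    \<le> \<beta> * (real K * C2) / real n / \<delta>\<^sup>2"
proof -
  note [measurable] = \<phi>
  have X[measurable]: "X i \<in> borel_measurable M" if "i \<in> {1..n}" for i
    using indep that by (simp add: indep_vars_def)
  have one: "1 \<in> {1..n}" using n by simp
  have hm: "(\<lambda>y. \<phi> k y * \<phi> l y) \<in> borel_measurable borel"
      "(\<lambda>y. (\<phi> k y * \<phi> l y)\<^sup>2) \<in> borel_measurable borel"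
      "(\<lambda>y. (\<phi> k y)\<^sup>2) \<in> borel_measurable borel" if "k < K" "l < K" for k l
    using \<phi>[OF that(1)] \<phi>[OF that(2)] by simp_all
  have b0: "0 \<le> \<beta>" using order_trans[OF sum_nonneg bound] by simp
  have sq: "(\<phi> k y)\<^sup>2 \<le> \<beta>" if "k < K" for k y
    using order_trans[OF member_le_sum[of k "{..<K}" "\<lambda>k. (\<phi> k y)\<^sup>2"] bound[of y]] that by simp
  have int_sq: "integrable M (\<lambda>\<omega>. (\<phi> k (X i \<omega>))\<^sup>2)" if "k < K" "i \<in> {1..n}" for k i
    by (rule integrable_const_bound[of _ \<beta>]) (use that sq in auto)
  have int4: "integrable M (\<lambda>\<omega>. (\<phi> k (X i \<omega>) * \<phi> l (X i \<omega>))\<^sup>2)" if "k < K" "l < K" "i \<in> {1..n}" for k l i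
  proof (rule integrable_const_bound[of _ "\<beta> * \<beta>"])
    show "AE \<omega> in M. norm ((\<phi> k (X i \<omega>) * \<phi> l (X i \<omega>))\<^sup>2) \<le> \<beta> * \<beta>"
      using sq that b0 by (auto simp: power_mult_distrib intro!: mult_mono)
  qed (use that in measurable)
  define v where "v k l = D (\<lambda>y. (\<phi> k y * \<phi> l y)\<^sup>2)" for k l
  define dev where "dev k l \<omega> = (emp_inner \<phi> n (\<lambda>i. X i \<omega>) k l - D (\<lambda>y. \<phi> k y * \<phi> l y))\<^sup>2" for k l \<omega>
  have dev: "integrable M (dev k l)" "expectation (dev k l) \<le> v k l / real n" if "k < K" "l < K" for k l
  proof -
    have indepY: "indep_vars (\<lambda>_. borel) (\<lambda>i \<omega>. \<phi> k (X i \<omega>) * \<phi> l (X i \<omega>)) {1..n}"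
      by (rule indep_vars_compose2[OF indep, where Y = "\<lambda>_ y. \<phi> k y * \<phi> l y"]) (use that in \<open>simp_all add: hm\<close>)
    have D1: "expectation (\<lambda>\<omega>. \<phi> k (X i \<omega>) * \<phi> l (X i \<omega>)) = D (\<lambda>y. \<phi> k y * \<phi> l y)"
      if "i \<in> {1..n}" for i
      by (rule D[OF that hm(1)[OF \<open>k < K\<close> \<open>l < K\<close>]])
    have D2: "expectation (\<lambda>\<omega>. (\<phi> k (X i \<omega>) * \<phi> l (X i \<omega>))\<^sup>2) \<le> v k l"
      if "i \<in> {1..n}" for i
      unfolding v_def using D[OF that hm(2)[OF \<open>k < K\<close> \<open>l < K\<close>]] by simp
    show "integrable M (dev k l)" "expectation (dev k l) \<le> v k l / real n"
      using indep_mean_square_deviation[OF n indepY int4[OF that] D1 D2]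
      by (simp_all add: dev_def[abs_def] emp_inner_def)
  qed
  have total: "(\<Sum>k<K. \<Sum>l<K. v k l) \<le> \<beta> * (real K * C2)"
  proof -
    have "(\<Sum>k<K. \<Sum>l<K. v k l) = (\<Sum>k<K. \<Sum>l<K. expectation (\<lambda>\<omega>. (\<phi> k (X 1 \<omega>) * \<phi> l (X 1 \<omega>))\<^sup>2))"
      unfolding v_def by (intro sum.cong refl D[OF one hm(2), symmetric]) auto
    also have "\<dots> = (\<Sum>k<K. expectation (\<lambda>\<omega>. \<Sum>l<K. (\<phi> k (X 1 \<omega>) * \<phi> l (X 1 \<omega>))\<^sup>2))"
      using int4[OF _ _ one] by (intro sum.cong refl Bochner_Integration.integral_sum[symmetric]) auto
    also have "\<dots> \<le> (\<Sum>k<K. expectation (\<lambda>\<omega>. \<beta> * (\<phi> k (X 1 \<omega>))\<^sup>2))"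
    proof (intro sum_mono integral_mono)
      fix k \<omega> assume k: "k \<in> {..<K}"
      have "(\<Sum>l<K. (\<phi> k (X 1 \<omega>) * \<phi> l (X 1 \<omega>))\<^sup>2) = (\<phi> k (X 1 \<omega>))\<^sup>2 * (\<Sum>l<K. (\<phi> l (X 1 \<omega>))\<^sup>2)"
        by (simp add: power_mult_distrib sum_distrib_left)
      also have "\<dots> \<le> (\<phi> k (X 1 \<omega>))\<^sup>2 * \<beta>" by (intro mult_left_mono bound) simp
      finally show "(\<Sum>l<K. (\<phi> k (X 1 \<omega>) * \<phi> l (X 1 \<omega>))\<^sup>2) \<le> \<beta> * (\<phi> k (X 1 \<omega>))\<^sup>2" by (simp add: mult.commute)
    next
      fix k assume k: "k \<in> {..<K}"
      show "integrable M (\<lambda>\<omega>. \<Sum>l<K. (\<phi> k (X 1 \<omega>) * \<phi> l (X 1 \<omega>))\<^sup>2)"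
        using int4[OF _ _ one] k by (intro Bochner_Integration.integrable_sum) auto
      show "integrable M (\<lambda>\<omega>. \<beta> * (\<phi> k (X 1 \<omega>))\<^sup>2)" using int_sq[OF _ one] k by simp
    qed
    also have "\<dots> = (\<Sum>k<K. \<beta> * D (\<lambda>y. (\<phi> k y)\<^sup>2))"
    proof (intro sum.cong refl)
      fix k assume "k \<in> {..<K}"
      then have "expectation (\<lambda>\<omega>. (\<phi> k (X 1 \<omega>))\<^sup>2) = D (\<lambda>y. (\<phi> k y)\<^sup>2)"
        by (intro D[OF one hm(3)[of k k]]) auto
      then show "expectation (\<lambda>\<omega>. \<beta> * (\<phi> k (X 1 \<omega>))\<^sup>2) = \<beta> * D (\<lambda>y. (\<phi> k y)\<^sup>2)" by simp
    qed
    also have "\<dots> \<le> (\<Sum>k<K. \<beta> * C2)" using b0 second by (intro sum_mono mult_left_mono) auto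
    finally show ?thesis by (simp add: mult_ac)
  qed
  define T where "T \<omega> = (\<Sum>k<K. \<Sum>l<K. dev k l \<omega>)" for \<omega>
  have intT: "integrable M T"
    unfolding T_def[abs_def] using dev(1) by (intro Bochner_Integration.integrable_sum) auto
  have "expectation T = (\<Sum>k<K. expectation (\<lambda>\<omega>. \<Sum>l<K. dev k l \<omega>))"
    unfolding T_def[abs_def] using dev(1)
    by (intro Bochner_Integration.integral_sum Bochner_Integration.integrable_sum) auto
  also have "\<dots> = (\<Sum>k<K. \<Sum>l<K. expectation (dev k l))"
    using dev(1) by (intro sum.cong refl Bochner_Integration.integral_sum) auto
  also have "\<dots> \<le> (\<Sum>k<K. \<Sum>l<K. v k l / real n)" using dev(2) by (intro sum_mono) auto
  also have "\<dots> = (\<Sum>k<K. \<Sum>l<K. v k l) / real n" by (simp add: sum_divide_distrib)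
  also have "\<dots> \<le> \<beta> * (real K * C2) / real n" by (intro divide_right_mono total) simp
  finally have ET: "expectation T \<le> \<beta> * (real K * C2) / real n" .
  have "0 \<le> T \<omega>" for \<omega>
    unfolding T_def dev_def by (intro sum_nonneg) auto
  then have "prob {\<omega> \<in> space M. \<delta>\<^sup>2 \<le> T \<omega>} \<le> expectation T / \<delta>\<^sup>2"
    using intT \<delta> by (intro integral_Markov_inequality_measure[where A = "{}"]) simp_all
  also have "\<dots> \<le> \<beta> * (real K * C2) / real n / \<delta>\<^sup>2" by (intro divide_right_mono ET) simp
  finally show ?thesis unfolding T_def dev_def .
qed

text \<open>Since the weights \<open>\<rho>\<close> are deterministic, Markov's inequality applies to the weighted sum as a whole, and no
simultaneous control of the \<open>K\<close> empirical means is required.\<close>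

lemma (in prob_space) weighted_abs_mean_markov:
  fixes X :: "nat \<Rightarrow> 'a \<Rightarrow> real" and \<phi> :: "nat \<Rightarrow> real \<Rightarrow> real"
  assumes n: "1 \<le> n"
    and X: "\<And>i. i \<in> {1..n} \<Longrightarrow> X i \<in> borel_measurable M"
    and \<phi>: "\<And>k. k < K \<Longrightarrow> \<phi> k \<in> borel_measurable borel"
    and bound: "\<And>k y. k < K \<Longrightarrow> \<bar>\<phi> k y\<bar> \<le> R"
    and first: "\<And>k i. k < K \<Longrightarrow> i \<in> {1..n} \<Longrightarrow> expectation (\<lambda>\<omega>. \<bar>\<phi> k (X i \<omega>)\<bar>) \<le> c"
    and \<rho>: "\<And>k. 0 \<le> \<rho> k" "(\<Sum>k<K. \<rho> k) \<le> H" and c: "0 \<le> c" and t: "0 < t"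
  shows "prob {\<omega> \<in> space M. t \<le> (\<Sum>k<K. \<rho> k * (1 / real n * (\<Sum>i=1..n. \<bar>\<phi> k (X i \<omega>)\<bar>)))} \<le> H * c / t"
proof -
  note [measurable] = X \<phi>
  have int: "integrable M (\<lambda>\<omega>. \<bar>\<phi> k (X i \<omega>)\<bar>)" if "k < K" "i \<in> {1..n}" for k i
    by (rule integrable_const_bound[of _ R]) (use that bound in auto)
  define Z where "Z \<omega> = (\<Sum>k<K. \<rho> k * (1 / real n * (\<Sum>i=1..n. \<bar>\<phi> k (X i \<omega>)\<bar>)))" for \<omega>
  have inner: "integrable M (\<lambda>\<omega>. \<rho> k * (1 / real n * (\<Sum>i=1..n. \<bar>\<phi> k (X i \<omega>)\<bar>)))" if "k < K" for k
    using int[OF that] by (intro integrable_mult_right Bochner_Integration.integrable_sum) auto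
  have intZ: "integrable M Z"
    unfolding Z_def[abs_def] using inner by (intro Bochner_Integration.integrable_sum) auto
  have "expectation Z = (\<Sum>k<K. expectation (\<lambda>\<omega>. \<rho> k * (1 / real n * (\<Sum>i=1..n. \<bar>\<phi> k (X i \<omega>)\<bar>))))"
    unfolding Z_def[abs_def] using inner by (intro Bochner_Integration.integral_sum) auto
  also have "\<dots> = (\<Sum>k<K. \<rho> k * (1 / real n * (\<Sum>i=1..n. expectation (\<lambda>\<omega>. \<bar>\<phi> k (X i \<omega>)\<bar>))))"
  proof (rule sum.cong[OF refl])
    fix k assume "k \<in> {..<K}"
    then have "expectation (\<lambda>\<omega>. \<Sum>i=1..n. \<bar>\<phi> k (X i \<omega>)\<bar>) = (\<Sum>i=1..n. expectation (\<lambda>\<omega>. \<bar>\<phi> k (X i \<omega>)\<bar>))"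
      using int by (intro Bochner_Integration.integral_sum) auto
    then show "expectation (\<lambda>\<omega>. \<rho> k * (1 / real n * (\<Sum>i=1..n. \<bar>\<phi> k (X i \<omega>)\<bar>))) =
        \<rho> k * (1 / real n * (\<Sum>i=1..n. expectation (\<lambda>\<omega>. \<bar>\<phi> k (X i \<omega>)\<bar>)))"
      by (simp only: integral_mult_right_zero)
  qed
  also have "\<dots> \<le> (\<Sum>k<K. \<rho> k * (1 / real n * (\<Sum>i=1..n. c)))"
    using first \<rho>(1) by (intro sum_mono mult_left_mono) auto
  also have "\<dots> = (\<Sum>k<K. \<rho> k) * c" using n by (simp add: sum_distrib_right)
  also have "\<dots> \<le> H * c" by (rule mult_right_mono[OF \<rho>(2) c])
  finally have EZ: "expectation Z \<le> H * c" .
  have "0 \<le> Z \<omega>" for \<omega>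
    unfolding Z_def by (intro sum_nonneg mult_nonneg_nonneg \<rho>(1)) auto
  then have "prob {\<omega> \<in> space M. t \<le> Z \<omega>} \<le> expectation Z / t"
    using intZ t by (intro integral_Markov_inequality_measure[where A = "{}"]) simp_all
  also have "\<dots> \<le> H * c / t" using t by (intro divide_right_mono EZ) simp
  finally show ?thesis unfolding Z_def .
qed

section \<open>Coverage at a fixed sample size\<close>

lemma (in prob_space) indep_vars_cong_space:
  assumes indep: "indep_vars M' X I"
    and eq: "\<And>i \<omega>. i \<in> I \<Longrightarrow> \<omega> \<in> space M \<Longrightarrow> X i \<omega> = Y i \<omega>"
  shows "indep_vars M' Y I"
proof -
  have rv: "random_variable (M' i) (Y i)" if "i \<in> I" for i
    using indep that measurable_cong[of M "X i" "Y i" "M' i", OF eq[OF that]]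
    by (simp add: indep_vars_def2)
  have "indep_sets (\<lambda>i. {X i -` A \<inter> space M | A. A \<in> sets (M' i)}) I"
    using indep by (simp add: indep_vars_def2)
  moreover have "{X i -` A \<inter> space M | A. A \<in> sets (M' i)} = {Y i -` A \<inter> space M | A. A \<in> sets (M' i)}"
    if "i \<in> I" for i
  proof -
    have "X i -` A \<inter> space M = Y i -` A \<inter> space M" for A using eq[OF that] by auto
    then show ?thesis by simp
  qed
  ultimately have "indep_sets (\<lambda>i. {Y i -` A \<inter> space M | A. A \<in> sets (M' i)}) I"
    by (subst indep_sets_cong[OF refl, symmetric]) auto
  then show ?thesis using rv by (simp add: indep_vars_def2)
qed

text \<open>Regression functions carry no measurability condition of their own. They inherit it, on the design
interval, from the sieve functions that approximate them uniformly.\<close>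

lemma borel_measurable_uniform_approx:
  fixes f :: "real \<Rightarrow> real"
  assumes A: "A \<in> sets borel" and \<delta>: "\<delta> \<longlonglongrightarrow> 0"
    and g: "\<And>j::nat. g j \<in> borel_measurable borel"
    and approx: "\<And>j x. x \<in> A \<Longrightarrow> \<bar>g j x - f x\<bar> \<le> \<delta> j"
  shows "(\<lambda>x. if x \<in> A then f x else 0) \<in> borel_measurable borel"
proof (rule borel_measurable_LIMSEQ_real)
  show "(\<lambda>j. if x \<in> A then g j x else 0) \<longlonglongrightarrow> (if x \<in> A then f x else 0)" for x
  proof (cases "x \<in> A")
    case True
    have "(\<lambda>j. g j x - f x) \<longlonglongrightarrow> 0"
      by (rule Lim_null_comparison[OF _ \<delta>]) (use approx[OF True] in auto)
    then show ?thesis using True by (simp add: LIM_zero_iff)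
  qed simp
  show "(\<lambda>x. if x \<in> A then g j x else 0) \<in> borel_measurable borel" for j
    using g[of j] A by measurable
qed

lemma sieve_weight_restrict:
  assumes "i \<in> {1..n}"
  shows "sieve_weight B K n (\<lambda>j\<in>{1..n}. x j) i = sieve_weight B K n x i"
proof -
  have "emp_gram B K n (\<lambda>j\<in>{1..n}. x j) = emp_gram B K n x"
    unfolding emp_gram_def by (intro cong_mat refl) (auto intro!: sum.cong)
  then show ?thesis using assms by (simp add: sieve_weight_def)
qed

text \<open>One sample with Borel measurable basis functions. The functional \<open>D\<close> gives expectations under the design
distribution. In the application \<open>R\<close> is of order \<open>K\<^bsup>1/2\<^esup>\<close>, \<open>\<beta>\<close> of order \<open>K\<close> and \<open>c1\<close> of order
\<open>K\<^bsup>-1/2\<^esup>\<close>.\<close>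

locale sieve_sample = prob_space M for M :: "'a measure" +
  fixes a b :: real and D :: "(real \<Rightarrow> real) \<Rightarrow> real" and B :: sieve and K n N :: nat
    and X :: "nat \<Rightarrow> 'a \<Rightarrow> real" and R \<beta> c1 C2 qm qp :: real
  assumes n: "1 \<le> n" and K: "1 \<le> K" and N: "0 < N" and zero: "0 \<in> {a..b}"
    and X_range: "\<And>i \<omega>. i \<in> {1..n} \<Longrightarrow> \<omega> \<in> space M \<Longrightarrow> X i \<omega> \<in> {a..b}"
    and X_indep: "indep_vars (\<lambda>_. borel) X {1..n}"
    and law: "\<And>i h. i \<in> {1..n} \<Longrightarrow> h \<in> borel_measurable borel \<Longrightarrow> expectation (\<lambda>\<omega>. h (X i \<omega>)) = D h"
    and B_meas: "\<And>k. k < K \<Longrightarrow> B K (Suc k) \<in> borel_measurable borel"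
    and bound: "\<And>k y. k < K \<Longrightarrow> \<bar>B K (Suc k) y\<bar> \<le> R"
    and energy: "\<And>y. (\<Sum>k<K. (B K (Suc k) y)\<^sup>2) \<le> \<beta>"
    and first: "\<And>k. k < K \<Longrightarrow> D (\<lambda>y. \<bar>B K (Suc k) y\<bar>) \<le> c1"
    and second: "\<And>k. k < K \<Longrightarrow> D (\<lambda>y. (B K (Suc k) y)\<^sup>2) \<le> C2"
    and qm: "0 < qm" and qp: "0 < qp"
    and rayleigh_lower: "\<And>c. qm * (\<Sum>k<K. (c k)\<^sup>2) \<le> bil K (\<lambda>k l. D (\<lambda>y. B K (Suc k) y * B K (Suc l) y)) c c"
    and rayleigh_upper: "\<And>c. bil K (\<lambda>k l. D (\<lambda>y. B K (Suc k) y * B K (Suc l) y)) c c \<le> qp * (\<Sum>k<K. (c k)\<^sup>2)"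
    and band: "\<And>k l y. k < K \<Longrightarrow> l < K \<Longrightarrow> N \<le> ndist k l \<Longrightarrow> B K (Suc k) y * B K (Suc l) y = 0"
begin

abbreviation "\<phi> k \<equiv> B K (Suc k)"
abbreviation "q \<equiv> qm / 2"
abbreviation "p \<equiv> qp + qm / 2"
text \<open>The decay rate of the dual vector when the empirical form lies between \<open>q\<close> and \<open>p\<close>.\<close>

definition "\<rho> = sqrt (p / (p + q))"
text \<open>If all basis functions vanish at \<open>0\<close>, the choice is arbitrary and any value serves as a centre.\<close>

definition "k0 = (SOME k. k < K \<and> \<phi> k 0 \<noteq> 0)"
definition "gram_dev \<omega> = (\<Sum>k<K. \<Sum>l<K. (emp_inner \<phi> n (\<lambda>i. X i \<omega>) k l - D (\<lambda>y. \<phi> k y * \<phi> l y))\<^sup>2)"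
definition "abs_mean \<omega> = (\<Sum>k<K. \<rho> ^ (ndist k k0 div N) * (1 / real n * (\<Sum>i=1..n. \<bar>\<phi> k (X i \<omega>)\<bar>)))"
abbreviation "W \<omega> i \<equiv> sieve_weight B K n (\<lambda>i. X i \<omega>) i"

lemma X_meas: "i \<in> {1..n} \<Longrightarrow> X i \<in> borel_measurable M"
  using X_indep by (simp add: indep_vars_def)

lemma \<rho>: "0 \<le> \<rho>" "\<rho> < 1"
proof -
  have "0 \<le> p / (p + q)" "p / (p + q) < 1" using qm qp by (simp_all add: divide_less_eq)
  then show "0 \<le> \<rho>" "\<rho> < 1" by (simp_all add: \<rho>_def del: times_divide_eq_right)
qed

lemma local_at_0:
  assumes "k < K" "N \<le> ndist k k0"
  shows "\<phi> k 0 = 0"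
proof (rule ccontr)
  assume nz: "\<phi> k 0 \<noteq> 0"
  then have "k0 < K \<and> \<phi> k0 0 \<noteq> 0"
    using someI[of "\<lambda>k. k < K \<and> \<phi> k 0 \<noteq> 0" k] assms(1) by (simp add: k0_def)
  then show False using band[of k k0 0] assms nz by simp
qed

text \<open>An error of \<open>qm / 2\<close> in Frobenius norm shifts the bounds of the quadratic form by at most \<open>qm / 2\<close>; this is
where the locale constants \<open>q\<close> and \<open>p\<close> come from.\<close>

lemma regular_designI:
  assumes dev: "gram_dev \<omega> < q\<^sup>2"
  shows "regular_design B K n (\<lambda>i. X i \<omega>) q p N k0"
proof
  let ?G = "\<lambda>k l. D (\<lambda>y. \<phi> k y * \<phi> l y)"
  let ?A = "emp_inner \<phi> n (\<lambda>i. X i \<omega>)"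
  have diff: "\<bar>bil K ?A c c - bil K ?G c c\<bar> \<le> q * (\<Sum>k<K. (c k)\<^sup>2)" for c
  proof -
    have "bil K ?A c c - bil K ?G c c = bil K (\<lambda>k l. ?A k l - ?G k l) c c"
      by (simp add: bil_def algebra_simps sum_subtractf)
    moreover have "\<bar>bil K (\<lambda>k l. ?A k l - ?G k l) c c\<bar> \<le> q * (\<Sum>k<K. (c k)\<^sup>2)"
      by (rule bil_frobenius) (use dev qm in \<open>auto simp: gram_dev_def\<close>)
    ultimately show ?thesis by simp
  qed
  show "q * (\<Sum>k<K. (c k)\<^sup>2) \<le> bil K ?A c c" for c
    using diff[of c] rayleigh_lower[of c] by linarith
  show "bil K ?A c c \<le> p * (\<Sum>k<K. (c k)\<^sup>2)" for c
    using diff[of c] rayleigh_upper[of c] unfolding distrib_right by linarith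
  show "1 \<le> n" "0 < q" "0 < p" "0 < N" using n qm qp N by simp_all
  show "\<phi> k (X i \<omega>) * \<phi> l (X i \<omega>) = 0" if "k < K" "l < K" "N \<le> ndist k l" for k l i
    using that by (rule band)
  show "\<phi> k 0 = 0" if "k < K" "N \<le> ndist k k0" for k
    using that by (rule local_at_0)
qed

lemma basis_meas:
  assumes "k < K" "i \<in> {1..n}"
  shows "(\<lambda>\<omega>. \<phi> k (X i \<omega>)) \<in> borel_measurable M"
  by (rule measurable_compose[OF X_meas[OF assms(2)] B_meas[OF assms(1)]])

lemma emp_inner_meas:
  assumes "k < K" "l < K"
  shows "(\<lambda>\<omega>. emp_inner \<phi> n (\<lambda>i. X i \<omega>) k l) \<in> borel_measurable M"
proof -
  have "(\<lambda>\<omega>. \<Sum>i=1..n. \<phi> k (X i \<omega>) * \<phi> l (X i \<omega>)) \<in> borel_measurable M"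
    by (rule borel_measurable_sum, rule borel_measurable_times)
      (rule basis_meas[OF assms(1)], assumption, rule basis_meas[OF assms(2)], assumption)
  then show ?thesis unfolding emp_inner_def by (rule borel_measurable_times[OF borel_measurable_const])
qed

lemma gram_dev_meas [measurable]: "gram_dev \<in> borel_measurable M"
  unfolding gram_dev_def[abs_def]
  by (intro borel_measurable_sum borel_measurable_power borel_measurable_diff emp_inner_meas
      borel_measurable_const) simp_all

lemma abs_mean_meas [measurable]: "abs_mean \<in> borel_measurable M"
proof -
  have "(\<lambda>\<omega>. \<Sum>i=1..n. \<bar>\<phi> k (X i \<omega>)\<bar>) \<in> borel_measurable M" if "k < K" for k
    by (rule borel_measurable_sum, rule borel_measurable_abs) (rule basis_meas[OF that], assumption)
  then have "(\<lambda>\<omega>. \<rho> ^ (ndist k k0 div N) * (1 / real n * (\<Sum>i=1..n. \<bar>\<phi> k (X i \<omega>)\<bar>))) \<in> borel_measurable M"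
    if "k < K" for k
    using that by (intro borel_measurable_times[OF borel_measurable_const]) simp
  then show ?thesis unfolding abs_mean_def[abs_def] by (rule borel_measurable_sum) simp
qed

lemma weight_meas: "i \<in> {1..n} \<Longrightarrow> (\<lambda>\<omega>. W \<omega> i) \<in> borel_measurable M"
proof -
  assume i: "i \<in> {1..n}"
  have "(\<lambda>x. sieve_weight B K n x i) \<in> borel_measurable (Pi\<^sub>M {1..n} (\<lambda>_. borel))"
  proof (rule borel_measurable_sieve_weight[OF _ i])
    fix k assume "k \<in> {1..K}"
    then show "B K k \<in> borel_measurable borel" using B_meas[of "k - 1"] by auto
  qed
  moreover have "(\<lambda>\<omega>. \<lambda>j\<in>{1..n}. X j \<omega>) \<in> measurable M (Pi\<^sub>M {1..n} (\<lambda>_. borel))"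
    by (rule measurable_restrict) (rule X_meas)
  ultimately have "(\<lambda>\<omega>. sieve_weight B K n (\<lambda>j\<in>{1..n}. X j \<omega>) i) \<in> borel_measurable M"
    by (rule measurable_compose[rotated])
  then show ?thesis unfolding sieve_weight_restrict[OF i] .
qed

lemma prob_gram_dev: "prob {\<omega> \<in> space M. q\<^sup>2 \<le> gram_dev \<omega>} \<le> \<beta> * (real K * C2) / real n / q\<^sup>2"
  unfolding gram_dev_def
  by (rule gram_concentration[OF n X_indep B_meas law energy second]) (use qm in simp_all)

lemma prob_abs_mean:
  assumes "0 < t" and "0 \<le> c1"
  shows "prob {\<omega> \<in> space M. t \<le> abs_mean \<omega>} \<le> 2 * real N / (1 - \<rho>) * c1 / t"
  unfolding abs_mean_def
proof (rule weighted_abs_mean_markov[OF n X_meas B_meas bound])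
  show "expectation (\<lambda>\<omega>. \<bar>\<phi> k (X i \<omega>)\<bar>) \<le> c1" if "k < K" "i \<in> {1..n}" for k i
  proof -
    have "(\<lambda>y. \<bar>\<phi> k y\<bar>) \<in> borel_measurable borel" using B_meas[OF that(1)] by simp
    from law[OF that(2) this] show ?thesis using first[OF that(1)] by simp
  qed
  show "(\<Sum>k<K. \<rho> ^ (ndist k k0 div N)) \<le> 2 * real N / (1 - \<rho>)"
    by (rule sum_power_ndist_le[OF \<rho> N])
qed (use assms \<rho> in simp_all)

text \<open>The three deterministic facts behind the coverage. The constant in the second one comes from solving
the bound of \<open>value_at_0_bound\<close> for \<open>|b(0)|\<close>; half of \<open>|f 0|\<close> is given away for the approximation error.
The functions \<open>f\<close> and \<open>m\<close> are separate because \<open>f\<close> is a fixed witness of nondegeneracy, while the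
bounds have to hold for every regression function \<open>m\<close> with the same constants.\<close>

lemma design_bounds:
  assumes \<omega>: "\<omega> \<in> space M" and dev: "gram_dev \<omega> < q\<^sup>2" and mean: "abs_mean \<omega> < t"
    and f: "\<And>y. y \<in> {a..b} \<Longrightarrow> \<bar>(\<Sum>k<K. cf k * \<phi> k y) - f y\<bar> \<le> \<delta>"
    and Rf: "\<And>y. y \<in> {a..b} \<Longrightarrow> \<bar>f y\<bar> \<le> Rf" and f0: "f 0 \<noteq> 0" "\<delta> \<le> \<bar>f 0\<bar> / 2"
    and m: "\<And>y. y \<in> {a..b} \<Longrightarrow> \<bar>(\<Sum>k<K. cm k * \<phi> k y) - m y\<bar> \<le> \<delta>"
  shows "(\<Sum>i=1..n. (W \<omega> i)\<^sup>2) \<le> p * \<beta> / (q\<^sup>2 * real n)"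
    and "(\<bar>f 0\<bar> * q / (2 * t * (Rf + \<delta>)))\<^sup>2 / (p * real n) \<le> (\<Sum>i=1..n. (W \<omega> i)\<^sup>2)"
    and "\<bar>(\<Sum>i=1..n. W \<omega> i * m (X i \<omega>)) - m 0\<bar> \<le> \<delta> * (1 + sqrt \<beta> / q * t)"
proof -
  interpret d: regular_design B K n "\<lambda>i. X i \<omega>" q p N k0
    by (rule regular_designI[OF dev])
  have pos: "0 < q" "0 < p" using qm qp by simp_all
  have \<delta>: "0 \<le> \<delta>" using f[OF zero] by linarith
  have Rf_pos: "0 < Rf + \<delta>" using Rf[OF zero] f0(1) \<delta> by simp
  have d\<beta>: "d.\<beta> \<le> \<beta>" unfolding d.\<beta>_def by (rule energy)
  have abs_mean_nn: "0 \<le> abs_mean \<omega>"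
    unfolding abs_mean_def using \<rho> by (intro sum_nonneg mult_nonneg_nonneg) auto
  then have t: "0 < t" using mean by linarith
  have in_range: "y \<in> {a..b}" if "y \<in> insert 0 ((\<lambda>i. X i \<omega>) ` {1..n})" for y
    using that zero X_range[OF _ \<omega>] by auto
  have leb: "(\<Sum>i=1..n. \<bar>W \<omega> i\<bar>) \<le> sqrt d.\<beta> / q * t"
  proof -
    have "(\<Sum>i=1..n. \<bar>W \<omega> i\<bar>) \<le> sqrt d.\<beta> / q * abs_mean \<omega>"
      using d.sum_abs_weight by (simp only: abs_mean_def \<rho>_def)
    also have "\<dots> \<le> sqrt d.\<beta> / q * t"
      using mean pos d.\<beta>_nonneg by (intro mult_left_mono) auto
    finally show ?thesis .
  qed
  have "p * d.\<beta> / (q\<^sup>2 * real n) \<le> p * \<beta> / (q\<^sup>2 * real n)"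
    using d\<beta> pos by (intro divide_right_mono mult_left_mono) auto
  then show "(\<Sum>i=1..n. (W \<omega> i)\<^sup>2) \<le> p * \<beta> / (q\<^sup>2 * real n)"
    using d.sum_weight_sq_upper by linarith
  have "\<bar>f 0\<bar> \<le> \<delta> + (Rf + \<delta>) * (\<Sum>i=1..n. \<bar>W \<omega> i\<bar>)"
    by (rule d.value_at_0_bound[where c = cf]) (use f Rf in_range in auto)
  also have "\<dots> \<le> \<bar>f 0\<bar> / 2 + (Rf + \<delta>) * (sqrt d.\<beta> / q * t)"
    using f0 leb Rf_pos by (intro add_mono mult_left_mono) auto
  finally have "\<bar>f 0\<bar> / 2 \<le> (Rf + \<delta>) * (sqrt d.\<beta> / q * t)" by linarith
  then have "\<bar>f 0\<bar> * q / (2 * t * (Rf + \<delta>)) \<le> sqrt d.\<beta>"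
  proof -
    assume "\<bar>f 0\<bar> / 2 \<le> (Rf + \<delta>) * (sqrt d.\<beta> / q * t)"
    then have "\<bar>f 0\<bar> / 2 * (2 * q) \<le> (Rf + \<delta>) * (sqrt d.\<beta> / q * t) * (2 * q)"
      using pos by (intro mult_right_mono) auto
    also have "\<dots> = sqrt d.\<beta> * (2 * t * (Rf + \<delta>))" using pos(1) qm by simp
    finally have "\<bar>f 0\<bar> * q \<le> sqrt d.\<beta> * (2 * t * (Rf + \<delta>))" by simp
    moreover have "0 < 2 * t * (Rf + \<delta>)" using t Rf_pos by simp
    ultimately show ?thesis by (simp only: pos_divide_le_eq)
  qed
  then have "(\<bar>f 0\<bar> * q / (2 * t * (Rf + \<delta>)))\<^sup>2 \<le> (sqrt d.\<beta>)\<^sup>2"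
    using Rf_pos t pos by (intro power_mono) auto
  then have "(\<bar>f 0\<bar> * q / (2 * t * (Rf + \<delta>)))\<^sup>2 \<le> d.\<beta>"
    using d.\<beta>_nonneg by simp
  then have "(\<bar>f 0\<bar> * q / (2 * t * (Rf + \<delta>)))\<^sup>2 / (p * real n) \<le> d.\<beta> / (p * real n)"
    using pos by (intro divide_right_mono) auto
  then show "(\<bar>f 0\<bar> * q / (2 * t * (Rf + \<delta>)))\<^sup>2 / (p * real n) \<le> (\<Sum>i=1..n. (W \<omega> i)\<^sup>2)"
    using d.sum_weight_sq_lower by linarith
  have "\<bar>(\<Sum>i=1..n. W \<omega> i * m (X i \<omega>)) - m 0\<bar> \<le> \<delta> * (1 + (\<Sum>i=1..n. \<bar>W \<omega> i\<bar>))"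
    by (rule d.bias_bound[where c = cm]) (use m in_range in auto)
  also have "\<dots> \<le> \<delta> * (1 + sqrt \<beta> / q * t)"
  proof -
    have "sqrt d.\<beta> / q * t \<le> sqrt \<beta> / q * t"
      using d\<beta> pos t by (intro mult_right_mono divide_right_mono) auto
    then show ?thesis using leb \<delta> by (intro mult_left_mono) auto
  qed
  finally show "\<bar>(\<Sum>i=1..n. W \<omega> i * m (X i \<omega>)) - m 0\<bar> \<le> \<delta> * (1 + sqrt \<beta> / q * t)" .
qed

text \<open>Coverage can fail only if the empirical Gram matrix is far from its mean, the absolute means are
large, the noise exceeds \<open>s\<close> although the weights are small, or the variance estimator falls below
\<open>V / 2\<close>. The four summands bound these events. The hypothesis \<open>width\<close> compares the worst case of bias plus
noise with the smallest half-width that the remaining event allows.\<close>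

lemma coverage_lower_bound:
  assumes indep: "indep_vars (\<lambda>_. borel \<Otimes>\<^sub>M borel) (\<lambda>i \<omega>. (X i \<omega>, \<epsilon> i \<omega>)) {1..n}"
    and errors: "homoskedastic_errors M n X \<epsilon>"
    and Y: "\<And>i. i \<in> {1..n} \<Longrightarrow> response m V X \<epsilon> i \<in> borel_measurable M"
    and Vhat: "is_estimator Vhat" and V: "0 < V"
    and Vhat_rate: "prob {\<omega> \<in> space M. \<bar>estimate Vhat n X (response m V X \<epsilon>) \<omega> - V\<bar> \<le> v} \<ge> 1 - rv"
    and v: "v \<le> V / 2"
    and f: "\<And>y. y \<in> {a..b} \<Longrightarrow> \<bar>(\<Sum>k<K. cf k * \<phi> k y) - f y\<bar> \<le> \<delta>"
    and Rf: "\<And>y. y \<in> {a..b} \<Longrightarrow> \<bar>f y\<bar> \<le> Rf" and f0: "f 0 \<noteq> 0" "\<delta> \<le> \<bar>f 0\<bar> / 2"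
    and m: "\<And>y. y \<in> {a..b} \<Longrightarrow> \<bar>(\<Sum>k<K. cm k * \<phi> k y) - m y\<bar> \<le> \<delta>"
    and t: "0 < t" and c1: "0 \<le> c1" and s: "0 < s" and d: "0 \<le> d" and \<alpha>: "0 < \<alpha>" "\<alpha> < 1" and S: "0 \<le> S"
    and width: "\<delta> * (1 + sqrt \<beta> / q * t) + sqrt V * s \<le>
      d * (ln (2 / \<alpha>) * V * ((\<bar>f 0\<bar> * q / (2 * t * (Rf + \<delta>)))\<^sup>2 / (p * real K)) / real n) powr (S / (2 * S + 1))"
  shows "prob {\<omega> \<in> space M. m 0 \<in> sieve_conf_int B K S \<alpha> d Vhat n X (response m V X \<epsilon>) \<omega>} \<ge>
    1 - (\<beta> * (real K * C2) / real n / q\<^sup>2 + 2 * real N / (1 - \<rho>) * c1 / t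
      + p * \<beta> / (q\<^sup>2 * real n) / s\<^sup>2 + rv)"
proof -
  let ?Y = "response m V X \<epsilon>"
  define \<tau> where "\<tau> = p * \<beta> / (q\<^sup>2 * real n)"
  define cW where "cW = (\<bar>f 0\<bar> * q / (2 * t * (Rf + \<delta>)))\<^sup>2 / p"
  define Q where "Q \<omega> = (\<Sum>i=1..n. (W \<omega> i)\<^sup>2)" for \<omega>
  define noise where "noise \<omega> = (\<Sum>i=1..n. W \<omega> i * \<epsilon> i \<omega>)" for \<omega>
  define Vn where "Vn \<omega> = estimate Vhat n X ?Y \<omega>" for \<omega>
  define T where "T = {\<omega> \<in> space M. m 0 \<in> sieve_conf_int B K S \<alpha> d Vhat n X ?Y \<omega>}"
  define E1 where "E1 = {\<omega> \<in> space M. q\<^sup>2 \<le> gram_dev \<omega>}"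
  define E2 where "E2 = {\<omega> \<in> space M. t \<le> abs_mean \<omega>}"
  define E3 where "E3 = {\<omega> \<in> space M. Q \<omega> \<le> \<tau> \<and> s \<le> \<bar>noise \<omega>\<bar>}"
  define E4 where "E4 = {\<omega> \<in> space M. \<not> \<bar>Vn \<omega> - V\<bar> \<le> v}"
  have pos: "0 < q" "0 < p" using qm qp by simp_all
  have \<beta>: "0 \<le> \<beta>" using order_trans[OF sum_nonneg energy] by simp
  have \<epsilon>_meas: "\<epsilon> i \<in> borel_measurable M" if "i \<in> {1..n}" for i
    using errors that by (simp add: homoskedastic_errors_def)
  have Q_meas[measurable]: "Q \<in> borel_measurable M"
    unfolding Q_def[abs_def] by (intro borel_measurable_sum borel_measurable_power weight_meas)
  have noise_meas[measurable]: "noise \<in> borel_measurable M"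
    unfolding noise_def[abs_def] by (intro borel_measurable_sum borel_measurable_times weight_meas \<epsilon>_meas)
  have Vn_meas[measurable]: "Vn \<in> borel_measurable M"
  proof -
    have "(\<lambda>\<omega>. \<lambda>i\<in>{1..n}. (X i \<omega>, ?Y i \<omega>)) \<in> measurable M (Pi\<^sub>M {1..n} (\<lambda>_. borel \<Otimes>\<^sub>M borel))"
      by (intro measurable_restrict measurable_Pair X_meas Y)
    moreover have "Vhat n \<in> borel_measurable (Pi\<^sub>M {1..n} (\<lambda>_. borel \<Otimes>\<^sub>M borel))"
      using Vhat by (simp add: is_estimator_def)
    ultimately show ?thesis unfolding Vn_def[abs_def] estimate_def by (rule measurable_compose)
  qed
  have est_meas[measurable]: "(\<lambda>\<omega>. sieve_est B K n (\<lambda>i. X i \<omega>) (\<lambda>i. ?Y i \<omega>)) \<in> borel_measurable M"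
    unfolding sieve_est_def by (intro borel_measurable_sum borel_measurable_times weight_meas Y)
  have CW_eq: "sieve_CW B K n (\<lambda>i. X i \<omega>) = real n / real K * Q \<omega>" for \<omega>
    by (simp add: sieve_CW_def Q_def)
  have sets: "T \<in> events" "E1 \<in> events" "E2 \<in> events" "E3 \<in> events" "E4 \<in> events"
    unfolding T_def E1_def E2_def E3_def E4_def sieve_conf_int_def pm_interval_def CW_eq Vn_def[symmetric]
      atLeastAtMost_iff by measurable
  have P1: "prob E1 \<le> \<beta> * (real K * C2) / real n / q\<^sup>2"
    unfolding E1_def by (rule prob_gram_dev)
  have P2: "prob E2 \<le> 2 * real N / (1 - \<rho>) * c1 / t"
    unfolding E2_def by (rule prob_abs_mean[OF t c1])
  have P3: "prob E3 \<le> \<tau> / s\<^sup>2"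
  proof -
    have "prob {\<omega> \<in> space M. (\<Sum>i\<in>{1..n}. (sieve_weight B K n (\<lambda>j\<in>{1..n}. X j \<omega>) i)\<^sup>2) \<le> \<tau> \<and>
        s \<le> \<bar>\<Sum>i\<in>{1..n}. sieve_weight B K n (\<lambda>j\<in>{1..n}. X j \<omega>) i * \<epsilon> i \<omega>\<bar>} \<le> \<tau> / s\<^sup>2"
    proof (rule noise_chebyshev[OF finite_atLeastAtMost indep])
      show "(\<lambda>x. sieve_weight B K n x i) \<in> borel_measurable (Pi\<^sub>M {1..n} (\<lambda>_. borel))"
        if "i \<in> {1..n}" for i
      proof (rule borel_measurable_sieve_weight[OF _ that])
        fix k assume "k \<in> {1..K}"
        then show "B K k \<in> borel_measurable borel" using B_meas[of "k - 1"] by auto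
      qed
      show "0 \<le> \<tau>" using \<beta> pos by (simp add: \<tau>_def)
    qed (use errors s in \<open>auto simp: homoskedastic_errors_def\<close>)
    moreover have "(\<Sum>i\<in>{1..n}. (sieve_weight B K n (\<lambda>j\<in>{1..n}. X j \<omega>) i)\<^sup>2) = Q \<omega>" for \<omega>
      unfolding Q_def by (intro sum.cong refl) (simp only: sieve_weight_restrict)
    moreover have "(\<Sum>i\<in>{1..n}. sieve_weight B K n (\<lambda>j\<in>{1..n}. X j \<omega>) i * \<epsilon> i \<omega>) = noise \<omega>" for \<omega>
      unfolding noise_def by (intro sum.cong refl) (simp only: sieve_weight_restrict)
    ultimately show ?thesis by (simp only: E3_def)
  qed
  have P4: "prob E4 \<le> rv"
  proof -
    have ev: "{\<omega> \<in> space M. \<bar>Vn \<omega> - V\<bar> \<le> v} \<in> events" by measurable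
    have "E4 = space M - {\<omega> \<in> space M. \<bar>Vn \<omega> - V\<bar> \<le> v}" by (auto simp: E4_def)
    then have "prob E4 = 1 - prob {\<omega> \<in> space M. \<bar>Vn \<omega> - V\<bar> \<le> v}"
      using prob_compl[OF ev] by simp
    then show ?thesis using Vhat_rate by (simp add: Vn_def)
  qed
  have cover: "\<omega> \<in> T" if \<omega>: "\<omega> \<in> space M" and no: "\<omega> \<notin> E1" "\<omega> \<notin> E2" "\<omega> \<notin> E3" "\<omega> \<notin> E4" for \<omega>
  proof -
    have dev: "gram_dev \<omega> < q\<^sup>2" and mean: "abs_mean \<omega> < t"
      using \<omega> no by (auto simp: E1_def E2_def)
    note b = design_bounds[OF \<omega> dev mean f Rf f0 m]
    have Q_up: "Q \<omega> \<le> \<tau>" using b(1) by (simp add: Q_def \<tau>_def)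
    have Q_low: "cW / real n \<le> Q \<omega>" using b(2) by (simp add: Q_def cW_def)
    have nz: "\<bar>noise \<omega>\<bar> < s" using \<omega> no(3) Q_up by (auto simp: E3_def)
    have Vn: "V / 2 \<le> Vn \<omega>" using \<omega> no(4) v by (auto simp: E4_def abs_le_iff)
    have cW: "0 \<le> cW" using pos by (simp add: cW_def)
    have lnp: "0 < ln (2 / \<alpha>)" using \<alpha> by simp
    have "ln (2 / \<alpha>) * V * (cW / real K) / real n \<le> 2 * ln (2 / \<alpha>) * Vn \<omega> * (real n / real K * Q \<omega>) / real n"
    proof (rule divide_right_mono)
      have "cW / real K = real n / real K * (cW / real n)" using n by simp
      also have "\<dots> \<le> real n / real K * Q \<omega>" by (intro mult_left_mono Q_low) simp
      finally have "cW / real K \<le> real n / real K * Q \<omega>" .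
      moreover have "ln (2 / \<alpha>) * V \<le> 2 * ln (2 / \<alpha>) * Vn \<omega>"
        using mult_left_mono[OF Vn, of "2 * ln (2 / \<alpha>)"] lnp by simp
      moreover have "0 \<le> 2 * ln (2 / \<alpha>) * Vn \<omega>" "0 \<le> cW / real K"
        using Vn V cW lnp by simp_all
      ultimately show "ln (2 / \<alpha>) * V * (cW / real K) \<le> 2 * ln (2 / \<alpha>) * Vn \<omega> * (real n / real K * Q \<omega>)"
        by (simp only: mult_mono)
    qed simp
    then have "(ln (2 / \<alpha>) * V * (cW / real K) / real n) powr (S / (2 * S + 1)) \<le>
        (2 * ln (2 / \<alpha>) * Vn \<omega> * (real n / real K * Q \<omega>) / real n) powr (S / (2 * S + 1))"
      using S V cW lnp by (intro powr_mono2) auto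
    from mult_left_mono[OF this d]
    have hw: "\<delta> * (1 + sqrt \<beta> / q * t) + sqrt V * s \<le>
        d * (2 * ln (2 / \<alpha>) * Vn \<omega> * (real n / real K * Q \<omega>) / real n) powr (S / (2 * S + 1))"
      using width by (simp add: cW_def)
    have "sieve_est B K n (\<lambda>i. X i \<omega>) (\<lambda>i. ?Y i \<omega>) = (\<Sum>i=1..n. W \<omega> i * m (X i \<omega>)) + sqrt V * noise \<omega>"
      by (simp add: sieve_est_def response_def noise_def algebra_simps sum.distrib sum_distrib_left)
    moreover have "\<bar>sqrt V * noise \<omega>\<bar> \<le> sqrt V * s"
      using nz V by (simp add: abs_mult)
    ultimately have "\<bar>sieve_est B K n (\<lambda>i. X i \<omega>) (\<lambda>i. ?Y i \<omega>) - m 0\<bar> \<le>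
        d * (2 * ln (2 / \<alpha>) * Vn \<omega> * (real n / real K * Q \<omega>) / real n) powr (S / (2 * S + 1))"
      using hw b(3) by linarith
    then show ?thesis
      using \<omega> unfolding T_def sieve_conf_int_def pm_interval_def CW_eq Vn_def[symmetric]
      by (simp add: abs_le_iff)
  qed
  have "1 = prob (space M)" by (simp add: prob_space)
  also have "\<dots> \<le> prob (T \<union> (E1 \<union> (E2 \<union> (E3 \<union> E4))))"
    by (rule finite_measure_mono) (use cover sets in auto)
  also have "\<dots> \<le> prob T + (prob E1 + (prob E2 + (prob E3 + prob E4)))"
    by (intro order_trans[OF measure_Un_le] add_mono order_refl sets sets.Un)
  also have "\<dots> \<le> prob T + (\<beta> * (real K * C2) / real n / q\<^sup>2 + (2 * real N / (1 - \<rho>) * c1 / t + (\<tau> / s\<^sup>2 + rv)))"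
    by (intro add_mono order_refl P1 P2 P3 P4)
  finally show ?thesis by (simp add: T_def \<tau>_def)
qed

end

section \<open>Asymptotics of bias, noise and half-width\<close>

lemma sieve_dimension_bounds:
  fixes \<theta> :: real and K :: "nat \<Rightarrow> nat"
  assumes "(\<lambda>n. real (K n)) \<in> \<Theta>(\<lambda>n. real n powr \<theta>)"
  obtains \<kappa>1 \<kappa>2 where "0 < \<kappa>1" "0 < \<kappa>2"
    "eventually (\<lambda>n. \<kappa>1 * real n powr \<theta> \<le> real (K n) \<and> real (K n) \<le> \<kappa>2 * real n powr \<theta>) sequentially"
proof -
  obtain \<kappa>2 where k2: "\<kappa>2 > 0" "eventually (\<lambda>n. norm (real (K n)) \<le> \<kappa>2 * norm (real n powr \<theta>)) sequentially"
    using landau_o.bigE[OF bigthetaD1[OF assms]] by blast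
  obtain \<kappa>1 where k1: "\<kappa>1 > 0" "eventually (\<lambda>n. \<kappa>1 * norm (real n powr \<theta>) \<le> norm (real (K n))) sequentially"
    using landau_omega.bigE[OF bigthetaD2[OF assms]] by blast
  show thesis
    by (rule that[OF k1(1) k2(1)]) (use eventually_conj[OF k1(2) k2(2)] in simp)
qed

lemma sieve_dimension_at_top:
  fixes \<theta> :: real and K :: "nat \<Rightarrow> nat"
  assumes K: "(\<lambda>n. real (K n)) \<in> \<Theta>(\<lambda>n. real n powr \<theta>)" and \<theta>: "0 < \<theta>"
  shows "filterlim (\<lambda>n. real (K n)) at_top sequentially"
proof -
  obtain \<kappa>1 \<kappa>2 where k: "0 < \<kappa>1" "0 < \<kappa>2"
    "eventually (\<lambda>n. \<kappa>1 * real n powr \<theta> \<le> real (K n) \<and> real (K n) \<le> \<kappa>2 * real n powr \<theta>) sequentially"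
    by (rule sieve_dimension_bounds[OF K])
  have "filterlim (\<lambda>n. \<kappa>1 * real n powr \<theta>) at_top sequentially"
  proof (rule filterlim_tendsto_pos_mult_at_top[OF tendsto_const k(1)])
    have "filterlim (\<lambda>n. exp (\<theta> * ln (real n))) at_top sequentially"
      by (intro filterlim_compose[OF exp_at_top] filterlim_tendsto_pos_mult_at_top[OF tendsto_const \<theta>]
          filterlim_compose[OF ln_at_top filterlim_real_sequentially])
    then show "filterlim (\<lambda>n. real n powr \<theta>) at_top sequentially"
      by (rule filterlim_mono_eventually[OF _ order_refl order_refl])
        (use eventually_gt_at_top[of 0] in eventually_elim, simp add: powr_def)
  qed
  then show ?thesis
    by (rule filterlim_at_top_mono) (use k(3) in eventually_elim, simp)
qed

lemma sieve_dimension_sq_div_n: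
  fixes \<theta> :: real and K :: "nat \<Rightarrow> nat"
  assumes K: "(\<lambda>n. real (K n)) \<in> \<Theta>(\<lambda>n. real n powr \<theta>)" and \<theta>: "\<theta> < 1 / 2"
  shows "(\<lambda>n. (real (K n))\<^sup>2 / real n) \<longlonglongrightarrow> 0"
proof -
  obtain \<kappa>1 \<kappa>2 where k: "0 < \<kappa>1" "0 < \<kappa>2"
    "eventually (\<lambda>n. \<kappa>1 * real n powr \<theta> \<le> real (K n) \<and> real (K n) \<le> \<kappa>2 * real n powr \<theta>) sequentially"
    by (rule sieve_dimension_bounds[OF K])
  have "(\<lambda>n. \<kappa>2\<^sup>2 * real n powr (2 * \<theta> - 1)) \<longlonglongrightarrow> 0"
  proof -
    have "(\<lambda>n. real n powr (2 * \<theta> - 1)) \<longlonglongrightarrow> 0"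
      using \<theta> by (intro tendsto_neg_powr filterlim_real_sequentially) simp
    from tendsto_mult_left[OF this, of "\<kappa>2\<^sup>2"] show ?thesis by simp
  qed
  then show ?thesis
  proof (rule Lim_null_comparison[rotated])
    show "eventually (\<lambda>n. norm ((real (K n))\<^sup>2 / real n) \<le> \<kappa>2\<^sup>2 * real n powr (2 * \<theta> - 1)) sequentially"
      using k(3) eventually_gt_at_top[of 0]
    proof eventually_elim
      case (elim n)
      have "(real (K n))\<^sup>2 \<le> (\<kappa>2 * real n powr \<theta>)\<^sup>2" using elim by (intro power_mono) auto
      also have "\<dots> = \<kappa>2\<^sup>2 * real n powr (2 * \<theta>)"
        using elim by (simp add: power_mult_distrib powr_power)
      finally have "(real (K n))\<^sup>2 / real n \<le> \<kappa>2\<^sup>2 * real n powr (2 * \<theta>) / real n"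
        by (intro divide_right_mono) auto
      also have "\<dots> = \<kappa>2\<^sup>2 * real n powr (2 * \<theta> - 1)"
        using elim by (simp add: powr_diff)
      finally show ?case by simp
    qed
  qed
qed

text \<open>All three terms are of order \<open>n\<^bsup>-S/(2S+1)\<^esup>\<close>, apart from the divergent factor \<open>d\<^sub>n\<close>: this is
the balance of bias and standard deviation that determines the order of \<open>K\<close>.\<close>

lemma eventually_width_dominates:
  fixes S :: real and K :: "nat \<Rightarrow> nat" and d :: "nat \<Rightarrow> real"
  assumes S: "0 < S" and K: "(\<lambda>n. real (K n)) \<in> \<Theta>(\<lambda>n. real n powr (1 / (2 * S + 1)))"
    and d: "filterlim d at_top sequentially"
    and pos: "0 \<le> A" "0 \<le> A'" "0 < c"
  shows "eventually (\<lambda>n. A * real (K n) powr (- S) + A' * sqrt (real (K n) / real n)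
      \<le> d n * (c / real n) powr (S / (2 * S + 1))) sequentially"
proof -
  define e where "e = S / (2 * S + 1)"
  obtain \<kappa>1 \<kappa>2 where k: "0 < \<kappa>1" "0 < \<kappa>2"
    "eventually (\<lambda>n. \<kappa>1 * real n powr (1 / (2 * S + 1)) \<le> real (K n) \<and>
      real (K n) \<le> \<kappa>2 * real n powr (1 / (2 * S + 1))) sequentially"
    by (rule sieve_dimension_bounds[OF K])
  define C where "C = A * \<kappa>1 powr (- S) + A' * sqrt \<kappa>2"
  have "eventually (\<lambda>n. C / c powr e \<le> d n) sequentially"
    using d by (simp add: filterlim_at_top)
  then show ?thesis
    using k(3) eventually_gt_at_top[of 0]
  proof eventually_elim
    case (elim n)
    let ?r = "real n powr (1 / (2 * S + 1))"
    have n: "0 < real n" using elim by simp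
    then have r: "0 < ?r" by simp
    have "real (K n) powr (- S) \<le> (\<kappa>1 * ?r) powr (- S)"
      using elim k(1) r S by (intro powr_mono2') auto
    also have "\<dots> = \<kappa>1 powr (- S) * real n powr (- e)"
      using k(1) r n by (simp add: powr_mult powr_powr e_def)
    finally have b1: "real (K n) powr (- S) \<le> \<kappa>1 powr (- S) * real n powr (- e)" .
    have "sqrt (real (K n) / real n) \<le> sqrt (\<kappa>2 * ?r / real n)"
      using elim n by (intro real_sqrt_le_mono divide_right_mono) auto
    also have "\<kappa>2 * ?r / real n = \<kappa>2 * (real n powr (- e))\<^sup>2"
    proof -
      have "?r / real n = real n powr (1 / (2 * S + 1) - 1)" using n by (simp add: powr_diff)
      also have "1 / (2 * S + 1) - 1 = 2 * (- e)" using S by (simp add: e_def field_simps)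
      also have "real n powr (2 * (- e)) = (real n powr (- e))\<^sup>2" using n by (simp add: powr_power mult.commute)
      finally show ?thesis by (simp flip: times_divide_eq_right)
    qed
    also have "sqrt (\<kappa>2 * (real n powr (- e))\<^sup>2) = sqrt \<kappa>2 * real n powr (- e)"
      by (simp add: real_sqrt_mult)
    finally have b2: "sqrt (real (K n) / real n) \<le> sqrt \<kappa>2 * real n powr (- e)" .
    have "A * real (K n) powr (- S) + A' * sqrt (real (K n) / real n) \<le> 
        A * (\<kappa>1 powr (- S) * real n powr (- e)) + A' * (sqrt \<kappa>2 * real n powr (- e))"
      by (intro add_mono mult_left_mono b1 b2 pos)
    also have "\<dots> = C * real n powr (- e)" by (simp add: C_def algebra_simps)
    also have "\<dots> \<le> (d n * c powr e) * real n powr (- e)"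
      using elim(1) pos(3) by (intro mult_right_mono) (auto simp: pos_divide_le_eq)
    also have "\<dots> = d n * (c / real n) powr e"
      using n pos(3) by (simp add: powr_divide powr_minus field_simps)
    finally show ?case by (simp add: e_def)
  qed
qed

lemma filterlim_at_top_of_sqrt_ln_quotient:
  fixes d :: "nat \<Rightarrow> real"
  assumes d: "filterlim (\<lambda>n. d n / sqrt (ln (real n))) at_top sequentially"
  shows "filterlim d at_top sequentially"
proof (rule filterlim_at_top_mono[OF d])
  have "filterlim (\<lambda>n. ln (real n)) at_top sequentially"
    by (rule filterlim_compose[OF ln_at_top filterlim_real_sequentially])
  then have "eventually (\<lambda>n. 1 \<le> ln (real n)) sequentially" by (simp add: filterlim_at_top)
  moreover have "eventually (\<lambda>n. 0 \<le> d n / sqrt (ln (real n))) sequentially"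
    using d by (simp add: filterlim_at_top)
  ultimately show "eventually (\<lambda>n. d n / sqrt (ln (real n)) \<le> d n) sequentially"
  proof eventually_elim
    case (elim n)
    then have s: "1 \<le> sqrt (ln (real n))" by simp
    then have "0 \<le> d n" using elim(2) by (simp add: zero_le_divide_iff)
    from mult_left_mono[OF s this] show ?case using s by (simp add: divide_le_eq)
  qed
qed

section \<open>Coverage of the sieve confidence interval\<close>

theorem theorem3:
  fixes S V a b L \<sigma> E C0 Cinf C1 C2 qm qp CS \<gamma> \<alpha> :: real
    and M0 :: nat
    and M :: "nat \<Rightarrow> 'a measure"
    and X \<epsilon> :: "nat \<Rightarrow> nat \<Rightarrow> 'a \<Rightarrow> real"
    and fX :: "real \<Rightarrow> real"
    and B :: sieve
    and F :: "(real \<Rightarrow> real) set"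
    and Vhat :: estimator
    and K :: "nat \<Rightarrow> nat"
    and d rV :: "nat \<Rightarrow> real"
  assumes S: "S \<ge> 1" and V: "V > 0"
    and interval: "(a = -1 \<or> a = 0) \<and> b = 1"
    and prob: "\<And>n. n \<ge> 1 \<Longrightarrow> prob_space (M n)"
    \<comment> \<open>design\<close>
    and X_range: "\<And>n i \<omega>. n \<ge> 1 \<Longrightarrow> i \<in> {1..n} \<Longrightarrow> \<omega> \<in> space (M n) \<Longrightarrow> X n i \<omega> \<in> {a..b}"
    and X_density: "\<And>n i. n \<ge> 1 \<Longrightarrow> i \<in> {1..n} \<Longrightarrow>
          distributed (M n) lborel (X n i) (\<lambda>x. ennreal (indicator {a..b} x * fX x))"
    and fX_lipschitz: "L-lipschitz_on {a..b} fX"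
    and fX_pos: "(INF x\<in>{a..b}. fX x) > 0"
    and pairs_indep: "\<And>n m. n \<ge> 1 \<Longrightarrow> m \<in> F \<Longrightarrow>
          prob_space.indep_vars (M n) (\<lambda>_. borel \<Otimes>\<^sub>M borel)
            (\<lambda>i \<omega>. (X n i \<omega>, response m V (X n) (\<epsilon> n) i \<omega>)) {1..n}"
    \<comment> \<open>errors\<close>
    and errors: "\<And>n. n \<ge> 1 \<Longrightarrow> homoskedastic_errors (M n) n (X n) (\<epsilon> n)"
    and \<sigma>: "\<sigma> > 4 + 1 / S" and E: "E > 0"
    and moments: "\<And>n. n \<ge> 1 \<Longrightarrow> cond_moment_bound (M n) n (X n) (\<epsilon> n) \<sigma> E"
    \<comment> \<open>sieve\<close>
    and B_meas: "\<And>J k. J \<ge> 1 \<Longrightarrow> k \<in> {1..J} \<Longrightarrow> B J k \<in> borel_measurable (restrict_space borel {a..b})"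
    and regular: "basis_regular a b fX B C0 Cinf C1 C2"
    and non_overlap: "basis_non_overlap a b B M0"
    and q: "0 < qm" "qm < qp"
    and eigenvalues: "gram_eigenvalue_bounds a b fX B qm qp"
    and CS: "CS > 0"
    and approx: "sieve_approx a b B F S CS"
    \<comment> \<open>without this the basis may degenerate at \<open>0\<close>, and the coverage claim fails\<close>
    and F_nondegenerate: "\<exists>f\<in>F. f 0 \<noteq> 0"
    \<comment> \<open>variance estimator\<close>
    and Vhat: "is_estimator Vhat"
    and \<gamma>: "\<gamma> > 0"
    and rV: "rV \<in> o(\<lambda>n. real n powr (- (2 * S / (2 * S + 1))))"
    and Vhat_rate: "\<And>n m. n \<ge> 1 \<Longrightarrow> m \<in> F \<Longrightarrow>
          measure (M n) {\<omega> \<in> space (M n).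
             \<bar>estimate Vhat n (X n) (response m V (X n) (\<epsilon> n)) \<omega> - V\<bar> \<le> real n powr (-\<gamma>)}
          \<ge> 1 - rV n"
    \<comment> \<open>tuning\<close>
    and K: "(\<lambda>n. real (K n)) \<in> \<Theta>(\<lambda>n. real n powr (1 / (2 * S + 1)))"
    and \<alpha>: "0 < \<alpha>" "\<alpha> < 1"
    and d: "filterlim (\<lambda>n. d n / sqrt (ln (real n))) at_top sequentially"
  shows "\<exists>CE :: nat \<Rightarrow> real. CE \<in> o(\<lambda>n. real n powr (- (2 * S / (2 * S + 1)))) \<and>
    (\<forall>n\<ge>1. (INF m\<in>F. measure (M n) {\<omega> \<in> space (M n).
         m 0 \<in> sieve_conf_int B (K n) S \<alpha> (d n) Vhat n (X n) (response m V (X n) (\<epsilon> n)) \<omega>})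
      \<ge> 1 - \<alpha> - CE n)"
proof -
  define N where "N = Suc M0"
  define q where "q = qm / 2"
  define p where "p = qp + qm / 2"
  define H where "H = 2 * real N / (1 - sqrt (p / (p + q)))"
  define C1' where "C1' = \<bar>C1\<bar> + 1"
  define Cb where "Cb = \<bar>C0\<bar> * Cinf\<^sup>2 + 1"
  define T where "T = 4 * H * C1' / \<alpha>"
  define \<theta> where "\<theta> = 1 / (2 * S + 1)"
  let ?D = "design_exp a b fX"
  define B' where "B' = clip_sieve a b B"
  have pos: "0 < q" "0 < p" "0 < N" "0 < C1'" "0 < Cb" "0 < S"
    using q S by (auto simp: q_def p_def N_def C1'_def Cb_def add_nonneg_pos)
  have zero: "0 \<in> {a..b}" using interval by auto
  have H: "0 < H"
  proof -
    have "p / (p + q) < 1" using pos by simp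
    then have "sqrt (p / (p + q)) < 1" by (simp only: real_sqrt_lt_1_iff)
    then show ?thesis using pos unfolding H_def by simp
  qed
  have T: "0 < T" using H pos \<alpha> by (simp add: T_def)
  have fX_nn: "0 \<le> fX x" if x: "x \<in> {a..b}" for x
  proof -
    have "compact (fX ` {a..b})"
      by (intro compact_continuous_image lipschitz_on_continuous_on[OF fX_lipschitz] compact_Icc)
    then have "bdd_below (fX ` {a..b})"
      by (intro bounded_imp_bdd_below compact_imp_bounded)
    then show ?thesis using cINF_lower[of fX "{a..b}" x] x fX_pos by linarith
  qed
  obtain f where f: "f \<in> F" "f 0 \<noteq> 0" using F_nondegenerate by blast

  \<comment> \<open>From here on the clipped basis replaces the given one; it has the same Gram matrices and the same
    confidence interval, and satisfies the sieve conditions on the whole line.\<close>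
  have sup: "\<bar>B J k x\<bar> \<le> \<bar>Cinf\<bar> * real J powr (1 / 2)" if "1 \<le> J" "k \<in> {1..J}" "x \<in> {a..b}" for J k x
    by (rule sup_norm_on_le_imp_abs_le[where A = "{a..b}"])
      (use regular that in \<open>auto simp: basis_regular_def\<close>)
  have B'_meas: "B' J (Suc k) \<in> borel_measurable borel" if "k < J" for J k
    unfolding B'_def by (rule borel_measurable_clip_sieve) (use B_meas[of J "Suc k"] that in auto)
  have B'_bound: "\<bar>B' J (Suc k) y\<bar> \<le> \<bar>Cinf\<bar> * real J powr (1 / 2)" if "k < J" for J k y
    using sup[of J "Suc k" y] that by (auto simp: B'_def clip_sieve_def)
  have B'_energy: "(\<Sum>k<J. (B' J (Suc k) y)\<^sup>2) \<le> Cb * real J" if J: "1 \<le> J" for J y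
  proof (cases "y \<in> {a..b}")
    case True
    let ?A = "{k \<in> {1..J}. B J k y \<noteq> 0}"
    have "(\<Sum>k<J. (B' J (Suc k) y)\<^sup>2) = (\<Sum>k\<in>{1..J}. (B J k y)\<^sup>2)"
      unfolding B'_def clip_sieve_eq[OF True]
      by (rule sum.reindex_bij_witness[of _ "\<lambda>k. k - 1" Suc]) auto
    also have "\<dots> = (\<Sum>k\<in>?A. (B J k y)\<^sup>2)"
      by (rule sum.mono_neutral_right) auto
    also have "\<dots> \<le> (\<Sum>k\<in>?A. Cinf\<^sup>2 * real J)"
    proof (rule sum_mono)
      fix k assume "k \<in> ?A"
      then have "\<bar>B J k y\<bar>\<^sup>2 \<le> (\<bar>Cinf\<bar> * real J powr (1 / 2))\<^sup>2"
        by (intro power_mono sup J True) auto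
      also have "\<dots> = Cinf\<^sup>2 * real J" using J by (simp add: power_mult_distrib powr_power)
      finally show "(B J k y)\<^sup>2 \<le> Cinf\<^sup>2 * real J" by simp
    qed
    also have "\<dots> = real (card ?A) * (Cinf\<^sup>2 * real J)" by simp
    also have "\<dots> \<le> \<bar>C0\<bar> * (Cinf\<^sup>2 * real J)"
      using regular J True unfolding basis_regular_def
      by (intro mult_right_mono) (fastforce intro: order_trans[OF _ abs_ge_self])+
    also have "\<dots> \<le> Cb * real J" by (simp add: Cb_def algebra_simps)
    finally show ?thesis .
  next
    case False
    then have "B' J (Suc k) y = 0" for k by (auto simp: B'_def clip_sieve_def)
    then show ?thesis using pos by simp
  qed
  have B'_first: "?D (\<lambda>y. \<bar>B' J (Suc k) y\<bar>) \<le> C1' * real J powr (-1 / 2)" if "k < J" for J k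
  proof -
    have "?D (\<lambda>y. \<bar>B' J (Suc k) y\<bar>) = ?D (\<lambda>y. \<bar>B J (Suc k) y\<bar>)"
      by (rule design_exp_cong) (simp add: B'_def clip_sieve_eq)
    also have "\<dots> \<le> C1 * real J powr (-1 / 2)"
      using regular that by (simp add: basis_regular_def)
    also have "\<dots> \<le> C1' * real J powr (-1 / 2)"
      by (rule mult_right_mono) (auto simp: C1'_def)
    finally show ?thesis .
  qed
  have B'_second: "?D (\<lambda>y. (B' J (Suc k) y)\<^sup>2) \<le> \<bar>C2\<bar>" if "k < J" for J k
  proof -
    have "?D (\<lambda>y. (B' J (Suc k) y)\<^sup>2) = ?D (\<lambda>y. (B J (Suc k) y)\<^sup>2)"
      by (rule design_exp_cong) (simp add: B'_def clip_sieve_eq)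
    also have "\<dots> \<le> C2" using regular that by (simp add: basis_regular_def)
    finally show ?thesis by linarith
  qed
  have B'_band: "B' J (Suc k) y * B' J (Suc l) y = 0" if "k < J" "l < J" "N \<le> ndist k l" for J k l y
  proof (cases "y \<in> {a..b}")
    case True
    have "\<bar>int (Suc k) - int (Suc l)\<bar> > int M0"
      using that(3) by (auto simp: N_def ndist_def)
    then show ?thesis
      using non_overlap that(1,2) True by (simp add: basis_non_overlap_def B'_def clip_sieve_eq)
  qed (auto simp: B'_def clip_sieve_def)
  have gram: "qm * (\<Sum>k<J. (c k)\<^sup>2) \<le> bil J (\<lambda>k l. ?D (\<lambda>y. B' J (Suc k) y * B' J (Suc l) y)) c c"
    "bil J (\<lambda>k l. ?D (\<lambda>y. B' J (Suc k) y * B' J (Suc l) y)) c c \<le> qp * (\<Sum>k<J. (c k)\<^sup>2)"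
    if J: "1 \<le> J" for J c
  proof -
    let ?G = "\<lambda>k l. ?D (\<lambda>y. B J (Suc k) y * B J (Suc l) y)"
    have eq: "?D (\<lambda>y. B' J (Suc k) y * B' J (Suc l) y) = ?G k l" for k l
      by (rule design_exp_cong) (simp add: B'_def clip_sieve_eq)
    have sym: "?G k l = ?G l k" for k l by (simp add: mult.commute)
    have nn: "0 \<le> (\<Sum>k<J. (c k)\<^sup>2)" by (simp add: sum_nonneg)
    have ev: "qm \<le> lambda_min (gram a b fX B J)" "lambda_max (gram a b fX B J) \<le> qp"
      using eigenvalues J by (auto simp: gram_eigenvalue_bounds_def)
    note ray = rayleigh_bounds[OF J, where G = ?G, OF sym, folded gram_def, of c]
    show "qm * (\<Sum>k<J. (c k)\<^sup>2) \<le> bil J (\<lambda>k l. ?D (\<lambda>y. B' J (Suc k) y * B' J (Suc l) y)) c c"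
      unfolding eq by (rule order_trans[OF mult_right_mono[OF ev(1) nn] ray(1)])
    show "bil J (\<lambda>k l. ?D (\<lambda>y. B' J (Suc k) y * B' J (Suc l) y)) c c \<le> qp * (\<Sum>k<J. (c k)\<^sup>2)"
      unfolding eq by (rule order_trans[OF ray(2) mult_right_mono[OF ev(2) nn]])
  qed
  define \<delta> where "\<delta> J = 2 * CS * real J powr (- S)" for J
  have B'_approx: "\<exists>c. \<forall>x\<in>{a..b}. \<bar>(\<Sum>k<J. c k * B' J (Suc k) x) - g x\<bar> \<le> \<delta> J"
    if g: "g \<in> F" and J: "1 \<le> J" for g J
  proof -
    obtain c where "\<And>x. x \<in> {a..b} \<Longrightarrow> \<bar>(\<Sum>k<J. c k * B J (Suc k) x) - g x\<bar> \<le> \<delta> J"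
      unfolding \<delta>_def by (rule sieve_approx_pointwise[OF approx CS g J]) blast
    then show ?thesis by (intro exI[of _ c] ballI) (simp add: B'_def clip_sieve_eq)
  qed
  have \<delta>_lim: "(\<lambda>n. \<delta> (J n)) \<longlonglongrightarrow> 0" if "filterlim (\<lambda>n. real (J n)) at_top sequentially" for J
  proof -
    have "(\<lambda>n. real (J n) powr (- S)) \<longlonglongrightarrow> 0"
      using pos that by (intro tendsto_neg_powr) auto
    from tendsto_mult_left[OF this, of "2 * CS"] show ?thesis by (simp add: \<delta>_def)
  qed
  have \<delta>_le: "\<delta> J \<le> 2 * CS" if "1 \<le> J" for J
  proof -
    have "real J powr (- S) \<le> real J powr 0" using that pos by (intro powr_mono) auto
    then show ?thesis using CS that by (simp add: \<delta>_def)
  qed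
  obtain Rf where Rf: "\<And>x. x \<in> {a..b} \<Longrightarrow> \<bar>f x\<bar> \<le> Rf" "0 \<le> Rf"
  proof -
    obtain c where c: "\<forall>x\<in>{a..b}. \<bar>(\<Sum>k<1. c k * B' 1 (Suc k) x) - f x\<bar> \<le> \<delta> 1"
      using B'_approx[OF f(1), of 1] by auto
    have "\<bar>f x\<bar> \<le> \<bar>c 0\<bar> * \<bar>Cinf\<bar> + \<delta> 1" if x: "x \<in> {a..b}" for x
    proof -
      have "\<bar>c 0 * B' 1 (Suc 0) x\<bar> \<le> \<bar>c 0\<bar> * \<bar>Cinf\<bar>"
        using B'_bound[of 0 1 x] by (simp add: abs_mult mult_left_mono)
      moreover have "\<bar>c 0 * B' 1 (Suc 0) x - f x\<bar> \<le> \<delta> 1" using c x by simp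
      ultimately show ?thesis by linarith
    qed
    moreover have "0 \<le> \<delta> 1" using CS unfolding \<delta>_def by simp
    ultimately show thesis by (intro that[of "\<bar>c 0\<bar> * \<bar>Cinf\<bar> + \<delta> 1"]) simp_all
  qed
  have F_meas: "(\<lambda>x. if x \<in> {a..b} then g x else 0) \<in> borel_measurable borel" if g: "g \<in> F" for g
  proof -
    have "\<forall>j. \<exists>c. \<forall>x\<in>{a..b}. \<bar>(\<Sum>k<Suc j. c k * B' (Suc j) (Suc k) x) - g x\<bar> \<le> \<delta> (Suc j)"
      by (intro allI B'_approx[OF g]) simp
    then obtain c where c: "\<And>j x. x \<in> {a..b} \<Longrightarrow>
        \<bar>(\<Sum>k<Suc j. c j k * B' (Suc j) (Suc k) x) - g x\<bar> \<le> \<delta> (Suc j)"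
      by metis
    show ?thesis
    proof (rule borel_measurable_uniform_approx[OF _ _ _ c])
      show "(\<lambda>j. \<delta> (Suc j)) \<longlonglongrightarrow> 0"
        by (rule \<delta>_lim) (rule filterlim_compose[OF filterlim_real_sequentially filterlim_Suc])
      show "(\<lambda>x. \<Sum>k<Suc j. c j k * B' (Suc j) (Suc k) x) \<in> borel_measurable borel" for j
        by (intro borel_measurable_sum borel_measurable_times borel_measurable_const B'_meas) simp
    qed simp
  qed

  \<comment> \<open>\<open>\<Lambda>\<close> is the amplification of the approximation error in the bias, \<open>cW\<close> the lower bound on \<open>C\<^sub>W\<close>, and
    \<open>Cs\<close> makes the Chebyshev bound for the noise equal to \<open>\<alpha> / 4\<close>, just as \<open>T\<close> does for the absolute means.\<close>
  define \<Lambda> where "\<Lambda> = 1 + sqrt Cb / q * T"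
  define cW where "cW = (\<bar>f 0\<bar> * q / (2 * T * (Rf + 2 * CS)))\<^sup>2 / p"
  define Cs where "Cs = sqrt (4 * p * Cb / (q\<^sup>2 * \<alpha>))"
  have cW: "0 < cW" using f pos T Rf CS by (auto simp: cW_def)
  have lnp: "0 < ln (2 / \<alpha>)" using \<alpha> by simp
  have Cs: "0 < Cs" using pos \<alpha> by (simp add: Cs_def)

  have single: "1 - \<alpha> \<le> measure (M n) {\<omega> \<in> space (M n).
      m 0 \<in> sieve_conf_int B (K n) S \<alpha> (d n) Vhat n (X n) (response m V (X n) (\<epsilon> n)) \<omega>}"
    if n: "1 \<le> n" and m: "m \<in> F" and Kn: "1 \<le> K n"
      and small: "\<delta> (K n) \<le> \<bar>f 0\<bar> / 2" and conc: "Cb * \<bar>C2\<bar> / q\<^sup>2 * ((real (K n))\<^sup>2 / real n) \<le> \<alpha> / 4"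
      and width: "2 * CS * \<Lambda> * real (K n) powr (- S) + sqrt V * Cs * sqrt (real (K n) / real n)
          \<le> d n * (ln (2 / \<alpha>) * V * cW / real n) powr (S / (2 * S + 1))"
      and vn: "real n powr (- \<gamma>) \<le> V / 2" and rn: "rV n \<le> \<alpha> / 4" and dn: "0 \<le> d n"
    for n m
  proof -
    let ?K = "K n"
    let ?k = "real (K n)"
    define t where "t = T * ?k powr (-1 / 2)"
    define s where "s = Cs * sqrt (?k / real n)"
    have kpos: "0 < ?k" "0 < real n" using Kn n by simp_all
    have t: "0 < t" using T kpos by (simp add: t_def)
    have s: "0 < s" using Cs kpos by (simp add: s_def)
    interpret prob_space "M n" by (rule prob[OF n])
    have pairs: "indep_vars (\<lambda>_. borel \<Otimes>\<^sub>M borel) (\<lambda>i \<omega>. (X n i \<omega>, response m V (X n) (\<epsilon> n) i \<omega>)) {1..n}"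
      by (rule pairs_indep[OF n m])
    have X_indep: "indep_vars (\<lambda>_. borel) (X n) {1..n}"
      using indep_vars_compose2[OF pairs, of "\<lambda>_. fst" "\<lambda>_. borel"] by simp
    have Y_meas: "response m V (X n) (\<epsilon> n) i \<in> borel_measurable (M n)" if "i \<in> {1..n}" for i
    proof -
      have "(\<lambda>\<omega>. (X n i \<omega>, response m V (X n) (\<epsilon> n) i \<omega>)) \<in> measurable (M n) (borel \<Otimes>\<^sub>M borel)"
        using pairs that by (simp add: indep_vars_def)
      from measurable_compose[OF this measurable_snd] show ?thesis by simp
    qed
    \<comment> \<open>The errors are recovered from the pairs by a Borel map, which transfers the independence.\<close>
    define m' where "m' x = (if x \<in> {a..b} then m x else 0)" for x
    have m'_meas[measurable]: "m' \<in> borel_measurable borel"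
      using F_meas[OF m] by (simp add: m'_def[abs_def])
    have errs_indep: "indep_vars (\<lambda>_. borel \<Otimes>\<^sub>M borel) (\<lambda>i \<omega>. (X n i \<omega>, \<epsilon> n i \<omega>)) {1..n}"
    proof (rule indep_vars_cong_space)
      show "indep_vars (\<lambda>_. borel \<Otimes>\<^sub>M borel) (\<lambda>i \<omega>. (\<lambda>(x, y). (x, (y - m' x) / sqrt V))
          (X n i \<omega>, response m V (X n) (\<epsilon> n) i \<omega>)) {1..n}"
        by (rule indep_vars_compose2[OF pairs]) measurable
      show "(\<lambda>(x, y). (x, (y - m' x) / sqrt V)) (X n i \<omega>, response m V (X n) (\<epsilon> n) i \<omega>) =
          (X n i \<omega>, \<epsilon> n i \<omega>)" if "i \<in> {1..n}" "\<omega> \<in> space (M n)" for i \<omega>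
        using X_range[OF n that] V by (simp add: response_def m'_def)
    qed
    interpret s: sieve_sample "M n" a b ?D B' ?K n N "X n" "\<bar>Cinf\<bar> * ?k powr (1 / 2)"
      "Cb * ?k" "C1' * ?k powr (-1 / 2)" "\<bar>C2\<bar>" qm qp
    proof
      show "1 \<le> n" "1 \<le> K n" "0 < N" "0 \<in> {a..b}" "0 < qm" "0 < qp"
        using n Kn pos zero q by simp_all
      show "X n i \<omega> \<in> {a..b}" if "i \<in> {1..n}" "\<omega> \<in> space (M n)" for i \<omega>
        by (rule X_range[OF n that])
      show "indep_vars (\<lambda>_. borel) (X n) {1..n}" by (rule X_indep)
      show "expectation (\<lambda>\<omega>. h (X n i \<omega>)) = ?D h" if "i \<in> {1..n}" "h \<in> borel_measurable borel" for i h
        by (rule expectation_eq_design_exp[OF X_density[OF n that(1)] fX_nn that(2)])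
    qed (fact B'_meas B'_bound B'_energy[OF Kn] B'_first B'_second gram[OF Kn] B'_band)+
    obtain cf where cf: "\<And>y. y \<in> {a..b} \<Longrightarrow> \<bar>(\<Sum>k<?K. cf k * B' ?K (Suc k) y) - f y\<bar> \<le> \<delta> ?K"
      using B'_approx[OF f(1) Kn] by blast
    obtain cm where cm: "\<And>y. y \<in> {a..b} \<Longrightarrow> \<bar>(\<Sum>k<?K. cm k * B' ?K (Suc k) y) - m y\<bar> \<le> \<delta> ?K"
      using B'_approx[OF m Kn] by blast
    have sqrt_t: "sqrt (Cb * ?k) / (qm / 2) * t = sqrt Cb / q * T"
    proof -
      have "sqrt ?k * ?k powr (-1 / 2) = 1"
        using kpos by (simp add: powr_half_sqrt[symmetric] powr_add[symmetric])
      then show ?thesis by (simp add: t_def q_def real_sqrt_mult)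
    qed
    have t2k: "t\<^sup>2 * ?k = T\<^sup>2"
  proof -
      have "(?k powr (-1 / 2))\<^sup>2 * ?k = ?k powr (-1 / 2) * ?k powr (-1 / 2) * ?k powr 1"
        using kpos by (simp add: power2_eq_square)
      also have "\<dots> = 1" using kpos by (simp flip: powr_add)
      finally show ?thesis by (simp add: t_def power_mult_distrib)
    qed
    have \<delta>K: "0 \<le> \<delta> ?K" "\<delta> ?K \<le> 2 * CS" using CS \<delta>_le[OF Kn] by (simp_all add: \<delta>_def)
    have low: "cW \<le> (\<bar>f 0\<bar> * (qm / 2) / (2 * t * (Rf + \<delta> ?K)))\<^sup>2 / ((qp + qm / 2) * ?k)"
    proof -
      define G where "G = Rf + \<delta> ?K"
      have Rp: "0 < Rf + \<delta> ?K" using Rf(1)[OF zero] f(2) \<delta>K by simp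
      have "\<bar>f 0\<bar> * q / (2 * T * (Rf + 2 * CS)) \<le> \<bar>f 0\<bar> * q / (2 * T * (Rf + \<delta> ?K))"
        using \<delta>K Rp T pos by (intro divide_left_mono mult_left_mono mult_pos_pos) auto
      then have "(\<bar>f 0\<bar> * q / (2 * T * (Rf + 2 * CS)))\<^sup>2 \<le> (\<bar>f 0\<bar> * q / (2 * T * (Rf + \<delta> ?K)))\<^sup>2"
        using Rf CS T pos by (intro power_mono) auto
      then have "cW \<le> (\<bar>f 0\<bar> * q / (2 * T * (Rf + \<delta> ?K)))\<^sup>2 / p"
        unfolding cW_def using pos by (intro divide_right_mono) auto
      also have "\<dots> = (\<bar>f 0\<bar> * q)\<^sup>2 / (4 * T\<^sup>2 * (Rf + \<delta> ?K)\<^sup>2 * p)"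
        by (simp add: power_divide power_mult_distrib)
      also have "\<dots> = (\<bar>f 0\<bar> * q / (2 * t * (Rf + \<delta> ?K)))\<^sup>2 / (p * ?k)"
        unfolding t2k[symmetric] G_def[symmetric] by (simp add: power_divide power_mult_distrib mult_ac)
      finally show ?thesis by (simp add: p_def q_def)
    qed
    have wid: "\<delta> ?K * (1 + sqrt (Cb * ?k) / (qm / 2) * t) + sqrt V * s \<le>
      d n * (ln (2 / \<alpha>) * V * ((\<bar>f 0\<bar> * (qm / 2) / (2 * t * (Rf + \<delta> ?K)))\<^sup>2 / ((qp + qm / 2) * ?k))
        / real n) powr (S / (2 * S + 1))"
    proof -
      have "\<delta> ?K * (1 + sqrt (Cb * ?k) / (qm / 2) * t) + sqrt V * s =
          2 * CS * \<Lambda> * ?k powr (- S) + sqrt V * Cs * sqrt (?k / real n)"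
        unfolding sqrt_t by (simp add: \<delta>_def \<Lambda>_def s_def mult_ac)
      also note width
      also have "d n * (ln (2 / \<alpha>) * V * cW / real n) powr (S / (2 * S + 1)) \<le>
          d n * (ln (2 / \<alpha>) * V * ((\<bar>f 0\<bar> * (qm / 2) / (2 * t * (Rf + \<delta> ?K)))\<^sup>2 / ((qp + qm / 2) * ?k))
            / real n) powr (S / (2 * S + 1))"
        using low cW lnp V pos kpos
        by (intro mult_left_mono[OF _ dn] powr_mono2 divide_right_mono mult_left_mono) auto
      finally show ?thesis .
    qed
    have c1_nn: "0 \<le> C1' * ?k powr (-1 / 2)" and S_nn: "0 \<le> S" using pos by simp_all
    note cov = s.coverage_lower_bound[OF errs_indep errors[OF n] Y_meas Vhat V Vhat_rate[OF n m] vn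
        cf Rf(1) f(2) small cm t c1_nn s dn \<alpha> S_nn wid]
    have e1: "Cb * ?k * (?k * \<bar>C2\<bar>) / real n / (qm / 2)\<^sup>2 \<le> \<alpha> / 4"
      using conc by (simp add: q_def power2_eq_square mult_ac)
    have e2: "2 * real N / (1 - s.\<rho>) * (C1' * ?k powr (-1 / 2)) / t = \<alpha> / 4"
  proof -
      have "2 * real N / (1 - s.\<rho>) = H" by (simp only: s.\<rho>_def H_def p_def q_def)
      moreover have "0 < ?k powr (-1 / 2)" using kpos by simp
      ultimately show ?thesis using H pos \<alpha> by (simp add: t_def T_def)
    qed
    have e3: "(qp + qm / 2) * (Cb * ?k) / ((qm / 2)\<^sup>2 * real n) / s\<^sup>2 = \<alpha> / 4"
    proof -
      have "s\<^sup>2 = 4 * p * Cb / (q\<^sup>2 * \<alpha>) * (?k / real n)"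
        using pos \<alpha> kpos by (simp add: s_def Cs_def power_mult_distrib)
      then have "p * (Cb * ?k) / (q\<^sup>2 * real n) / s\<^sup>2 = \<alpha> / 4"
        using pos \<alpha> kpos by simp
      then show ?thesis by (simp only: p_def q_def)
    qed
    have "1 - \<alpha> \<le> prob {\<omega> \<in> space (M n).
        m 0 \<in> sieve_conf_int B' ?K S \<alpha> (d n) Vhat n (X n) (response m V (X n) (\<epsilon> n)) \<omega>}"
      using cov e1 e2 e3 rn by linarith
    also have "{\<omega> \<in> space (M n). m 0 \<in> sieve_conf_int B' ?K S \<alpha> (d n) Vhat n (X n) (response m V (X n) (\<epsilon> n)) \<omega>} =
        {\<omega> \<in> space (M n). m 0 \<in> sieve_conf_int B ?K S \<alpha> (d n) Vhat n (X n) (response m V (X n) (\<epsilon> n)) \<omega>}"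
      unfolding B'_def using sieve_conf_int_clip[of n "X n" _ a b, OF X_range[OF n] zero] by (intro Collect_cong conj_cong refl) simp
    finally show ?thesis .
  qed

  have K': "(\<lambda>n. real (K n)) \<in> \<Theta>(\<lambda>n. real n powr \<theta>)" using K by (simp add: \<theta>_def)
  have \<theta>: "0 < \<theta>" "\<theta> < 1 / 2" using S by (simp_all add: \<theta>_def)
  have K_top: "filterlim (\<lambda>n. real (K n)) at_top sequentially"
    by (rule sieve_dimension_at_top[OF K' \<theta>(1)])
  have d_top: "filterlim d at_top sequentially"
    by (rule filterlim_at_top_of_sqrt_ln_quotient[OF d])
  have below: "eventually (\<lambda>n. u n \<le> c) sequentially" if "u \<longlonglongrightarrow> 0" "0 < c" for u :: "nat \<Rightarrow> real" and c
    using order_tendstoD(2)[OF that] by eventually_elim simp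
  have ev_K: "eventually (\<lambda>n. 1 \<le> K n) sequentially"
    using K_top by (simp add: filterlim_at_top) (metis (mono_tags, lifting) eventually_mono of_nat_1 of_nat_le_iff)
  have ev_small: "eventually (\<lambda>n. \<delta> (K n) \<le> \<bar>f 0\<bar> / 2) sequentially"
    using f by (intro below \<delta>_lim K_top) auto
  have ev_conc: "eventually (\<lambda>n. Cb * \<bar>C2\<bar> / q\<^sup>2 * ((real (K n))\<^sup>2 / real n) \<le> \<alpha> / 4) sequentially"
    using \<alpha> by (intro below tendsto_mult_right_zero sieve_dimension_sq_div_n[OF K' \<theta>(2)]) auto
  have ev_width: "eventually (\<lambda>n. 2 * CS * \<Lambda> * real (K n) powr (- S) + sqrt V * Cs * sqrt (real (K n) / real n)
      \<le> d n * (ln (2 / \<alpha>) * V * cW / real n) powr (S / (2 * S + 1))) sequentially"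
    by (rule eventually_width_dominates[OF _ K d_top])
      (use pos CS V Cs cW lnp T in \<open>auto simp: \<Lambda>_def intro!: mult_nonneg_nonneg add_nonneg_nonneg\<close>)
  have ev_v: "eventually (\<lambda>n. real n powr (- \<gamma>) \<le> V / 2) sequentially"
    using V \<gamma> by (intro below tendsto_neg_powr filterlim_real_sequentially) auto
  have ev_r: "eventually (\<lambda>n. rV n \<le> \<alpha> / 4) sequentially"
  proof (rule below)
    have lim: "(\<lambda>n. real n powr (- (2 * S / (2 * S + 1)))) \<longlonglongrightarrow> 0"
      using S by (intro tendsto_neg_powr filterlim_real_sequentially) (simp add: field_simps)
    have "eventually (\<lambda>n. norm (rV n) \<le> 1 * norm (real n powr (- (2 * S / (2 * S + 1))))) sequentially"
      using landau_o.smallD[OF rV, of 1] by simp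
    then show "rV \<longlonglongrightarrow> 0"
      by (intro Lim_null_comparison[OF _ lim]) simp
  qed (use \<alpha> in simp)
  have ev_d: "eventually (\<lambda>n. 0 \<le> d n) sequentially"
    using d_top by (simp add: filterlim_at_top)
  have "eventually (\<lambda>n. \<forall>m\<in>F. 1 - \<alpha> \<le> measure (M n) {\<omega> \<in> space (M n).
      m 0 \<in> sieve_conf_int B (K n) S \<alpha> (d n) Vhat n (X n) (response m V (X n) (\<epsilon> n)) \<omega>}) sequentially"
    using ev_K ev_small ev_conc ev_width ev_v ev_r ev_d eventually_ge_at_top[of 1]
    by eventually_elim (blast intro: single)
  then obtain n0 where n0: "\<And>n m. n0 \<le> n \<Longrightarrow> m \<in> F \<Longrightarrow> 1 - \<alpha> \<le> measure (M n) {\<omega> \<in> space (M n).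
      m 0 \<in> sieve_conf_int B (K n) S \<alpha> (d n) Vhat n (X n) (response m V (X n) (\<epsilon> n)) \<omega>}"
    by (auto simp: eventually_at_top_linorder)
  \<comment> \<open>Finitely many sample sizes are covered by the trivial bound \<open>measure \<ge> 0\<close>.\<close>
  define CE :: "nat \<Rightarrow> real" where "CE n = (if n < n0 then 1 else 0)" for n
  show ?thesis
  proof (intro exI[of _ CE] conjI allI impI)
    have "eventually (\<lambda>n. CE n = 0) sequentially"
      using eventually_ge_at_top[of n0] by eventually_elim (simp add: CE_def)
    then show "CE \<in> o(\<lambda>n. real n powr (- (2 * S / (2 * S + 1))))"
      by (subst landau_o.small.in_cong[where g = "\<lambda>_. 0"]) simp_all
    fix n :: nat
    show "1 - \<alpha> - CE n \<le> (INF m\<in>F. measure (M n) {\<omega> \<in> space (M n).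
        m 0 \<in> sieve_conf_int B (K n) S \<alpha> (d n) Vhat n (X n) (response m V (X n) (\<epsilon> n)) \<omega>})"
    proof (rule cINF_greatest)
      show "F \<noteq> {}" using f by auto
      fix m assume m: "m \<in> F"
      show "1 - \<alpha> - CE n \<le> measure (M n) {\<omega> \<in> space (M n).
          m 0 \<in> sieve_conf_int B (K n) S \<alpha> (d n) Vhat n (X n) (response m V (X n) (\<epsilon> n)) \<omega>}"
      proof (cases "n < n0")
        case True
        then show ?thesis using \<alpha> by (simp add: CE_def) (smt (verit) measure_nonneg)
      next
        case False
        then show ?thesis using n0[OF _ m] by (simp add: CE_def)
      qed
    qed
  qed
qed

end
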